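(* Let $\Phi:\Delta\to\mathbb{R}^{n\times n}$, $\Delta=\{(t,\tau)\in\mathbb{R}\times\mathbb{R}:t\ge\tau\}$, be measurable and locally essentially bounded, and let $f,\tilde f:\mathbb{R}\times\mathbb{R}^n\to\mathbb{R}^n$ satisfy the Filippov Condition. If $f$ is locally one-sided Lipschitz and $\tilde f$ is locally Lipschitz, then, for any $t^0\in\mathbb{R}$ and $x^0\in\mathbb{R}^n$, the IVP $$\dot x(t)=f(t,x(t))+\int_{t^0}^t\Phi(t,\tau)\tilde f(\tau,x(\tau))\,d\tau,\quad t>t^0,\qquad x(t^0)=x^0,$$ has a unique Filippov solution defined, at least, locally in the forward time.
   Context: $\|\cdot\|$ is the Euclidean norm and $\mathcal{B}(r)\subset\mathbb{R}^n$ is the open ball of radius $r>0$ centered at $0$. A function is locally essentially bounded on a set if its norm has finite essential supremum over every compact subset of that set. Filippov Condition: $g:\mathbb{R}\times\mathbb{R}^n\to\mathbb{R}^n$ is measurable and for any $\alpha,r>0$ there exists $m\in L^1((-\alpha,\alpha);\mathbb{R})$ such that $\|g(t,x)\|\le m(t)$ for almost all $t\in(-\alpha,\alpha)$ and almost all $x\in\mathcal{B}(r)$. A measurable $g:\mathbb{R}\times\mathbb{R}^n\to\mathbb{R}^n$ is locally one-sided Lipschitz (resp. locally Lipschitz) if for every compact $\mathcal{X}\subset\mathbb{R}^n$ there is $\ell\in L^\infty_{\rm loc}(\mathbb{R};\mathbb{R})$ with $(x-y)^\top(g(t,x)-g(t,y))\le\ell(t)\|x-y\|^2$ (resp. $\|g(t,x)-g(t,y)\|\le\ell(t)\|x-y\|$)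 for all $t\in\mathbb{R}$, $x,y\in\mathcal{X}$. Filippov regularization: $K[g](t,x)=\bigcap_{\delta>0}\bigcap_{\mu(M)=0}\overline{\mathrm{co}}\,g(t,x+\mathcal{B}(\delta)\setminus M)$, where $\overline{\mathrm{co}}$ is the convex closure and the intersections are over all $\delta>0$ and all $M\subset\mathbb{R}^n$ of Lebesgue measure zero. Filippov solution of the IVP on $\mathcal{I}=[t^0,t^0+\alpha)$ (with $\alpha>0$) or $\mathcal{I}=[t^0,+\infty)$: an absolutely continuous $x:\mathcal{I}\to\mathbb{R}^n$ with $x(t^0)=x^0$ such that for almost all $t\in\mathcal{I}$, $\dot x(t)\in K[f](t,x(t))+\int_{t^0}^t\Phi(t,\tau)K[\tilde f](\tau,x(\tau))\,d\tau$, with the integral of the set-valued map in the sense of Aumann. *)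

theory Defs
  imports "HOL-Analysis.Analysis" "HOL-Probability.Essential_Supremum"
begin

definition locally_ess_bounded_on ::
    "'a::euclidean_space set \<Rightarrow> ('a \<Rightarrow> 'b::real_normed_vector) \<Rightarrow> bool" where
  "locally_ess_bounded_on S g \<longleftrightarrow>
     (\<forall>C. compact C \<and> C \<subseteq> S \<longrightarrow> esssup (lebesgue_on C) (\<lambda>z. ereal (norm (g z))) < \<infinity>)"

definition Linf_loc :: "(real \<Rightarrow> real) \<Rightarrow> bool" where
  "Linf_loc l \<longleftrightarrow> l \<in> borel_measurable lebesgue \<and> locally_ess_bounded_on UNIV l"

definition Filippov_condition :: "(real \<times> (real^'n) \<Rightarrow> real^'n) \<Rightarrow> bool" where
  "Filippov_condition g \<longleftrightarrow>
     g \<in> borel_measurable lebesgue \<and>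
     (\<forall>\<alpha>>0. \<forall>r>0. \<exists>m::real \<Rightarrow> real.
        integrable (lebesgue_on {-\<alpha><..<\<alpha>}) m \<and>
        (AE t in lebesgue_on {-\<alpha><..<\<alpha>}. AE x in lebesgue_on (ball 0 r). norm (g (t, x)) \<le> m t))"

definition locally_one_sided_Lipschitz :: "(real \<times> (real^'n) \<Rightarrow> real^'n) \<Rightarrow> bool" where
  "locally_one_sided_Lipschitz g \<longleftrightarrow>
     g \<in> borel_measurable lebesgue \<and>
     (\<forall>X. compact X \<longrightarrow> (\<exists>l. Linf_loc l \<and>
        (\<forall>t. \<forall>x\<in>X. \<forall>y\<in>X. (x - y) \<bullet> (g (t, x) - g (t, y)) \<le> l t * (norm (x - y))\<^sup>2)))"

definition locally_Lipschitz :: "(real \<times> (real^'n) \<Rightarrow> real^'n) \<Rightarrow> bool" where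
  "locally_Lipschitz g \<longleftrightarrow>
     g \<in> borel_measurable lebesgue \<and>
     (\<forall>X. compact X \<longrightarrow> (\<exists>l. Linf_loc l \<and>
        (\<forall>t. \<forall>x\<in>X. \<forall>y\<in>X. norm (g (t, x) - g (t, y)) \<le> l t * norm (x - y))))"

definition Filippov_reg ::
    "(real \<times> (real^'n) \<Rightarrow> real^'n) \<Rightarrow> real \<Rightarrow> real^'n \<Rightarrow> (real^'n) set" where
  "Filippov_reg g t x =
     (\<Inter>\<delta>\<in>{0<..}. \<Inter>M\<in>null_sets lebesgue. closure (convex hull ((\<lambda>y. g (t, y)) ` (ball x \<delta> - M))))"

text \<open>The Aumann integral of a set-valued map is the set of integrals of its integrable
  selections; a selection has to lie in the map almost everywhere.\<close>

definition Aumann_integral :: "real set \<Rightarrow> (real \<Rightarrow> (real^'n) set) \<Rightarrow> (real^'n) set" where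
  "Aumann_integral S F =
     {integral\<^sup>L (lebesgue_on S) s | s.
        integrable (lebesgue_on S) s \<and> (AE \<tau> in lebesgue_on S. s \<tau> \<in> F \<tau>)}"

text \<open>Absolute continuity on a compact interval: \<open>D\<close> is a finite family of subintervals
  \<open>[u, v]\<close>, given by their end points, with pairwise disjoint interiors.\<close>

definition abs_continuous_on_interval :: "real \<Rightarrow> real \<Rightarrow> (real \<Rightarrow> real^'n) \<Rightarrow> bool" where
  "abs_continuous_on_interval a b x \<longleftrightarrow>
     (\<forall>\<epsilon>>0. \<exists>\<delta>>0. \<forall>D. finite D \<and>
        (\<forall>(u, v)\<in>D. a \<le> u \<and> u \<le> v \<and> v \<le> b) \<and>
        disjoint_family_on (\<lambda>(u, v). {u<..<v}) D \<and>
        (\<Sum>(u, v)\<in>D. v - u) < \<delta>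
        \<longrightarrow> (\<Sum>(u, v)\<in>D. norm (x v - x u)) < \<epsilon>)"

text \<open>On the half-open or unbounded intervals on which solutions live, absolute continuity is
  understood, as usual for Caratheodory and Filippov solutions, on every compact subinterval.\<close>

definition abs_continuous_on :: "real set \<Rightarrow> (real \<Rightarrow> real^'n) \<Rightarrow> bool" where
  "abs_continuous_on I x \<longleftrightarrow> (\<forall>a b. a \<le> b \<and> {a..b} \<subseteq> I \<longrightarrow> abs_continuous_on_interval a b x)"

text \<open>Only the values of \<open>x\<close> on \<open>I\<close> matter, and only those of \<open>\<Phi>\<close> at points
  \<open>(t, \<tau>)\<close> with \<open>t \<ge> \<tau>\<close>.\<close>

definition Filippov_solution ::
    "(real \<times> real \<Rightarrow> real^'n^'n) \<Rightarrow> (real \<times> (real^'n) \<Rightarrow> real^'n) \<Rightarrow> (real \<times> (real^'n) \<Rightarrow> real^'n)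
     \<Rightarrow> real \<Rightarrow> real^'n \<Rightarrow> real set \<Rightarrow> (real \<Rightarrow> real^'n) \<Rightarrow> bool" where
  "Filippov_solution \<Phi> f f' t0 x0 I x \<longleftrightarrow>
     ((\<exists>\<alpha>>0. I = {t0..<t0 + \<alpha>}) \<or> I = {t0..}) \<and>
     abs_continuous_on I x \<and>
     x t0 = x0 \<and>
     (AE t in lebesgue_on I. \<exists>v w.
        v \<in> Filippov_reg f t (x t) \<and>
        w \<in> Aumann_integral {t0..t} (\<lambda>\<tau>. (\<lambda>z. \<Phi> (t, \<tau>) *v z) ` Filippov_reg f' \<tau> (x \<tau>)) \<and>
        (x has_vector_derivative (v + w)) (at t within I))"

end

theory Submission
  imports Defs
begin

text \<open>
The regularized right-hand side is one-sided Lipschitz, which yields uniqueness: for two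
solutions the squared distance has derivative at most a constant times the largest squared distance
attained so far, because the \<open>f\<close>-part contributes at most \<open>L \<bar>x - y\<bar>\<^sup>2\<close>
(\<open>Filippov_reg_one_sided_Lipschitz\<close>), while the regularization of the continuous
map \<open>f'\<close> is a singleton and the memory term is Lipschitz in the past of the
solution. A Gronwall inequality for absolutely continuous functions
(\<open>gronwall_memory\<close>) finishes the argument.

Existence uses the same estimate once more. The map \<open>f\<close> need not be continuous in the state, nor
measurable along a curve, so it is replaced by its averages over balls of
radius \<open>1/(n+1)\<close>. These are measurable along continuous curves, and they lie in the closed convex
hulls that define the regularization. The averaged equation is solved with the state
delayed by \<open>1/(n+1)\<close>, which needs no fixed-point theorem: the past determines the velocity
(\<open>delayed_integral_equation\<close>). The one-sided Lipschitz condition extends to convex hulls of values on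
small balls with an error that vanishes with the radius (\<open>one_sided_Lipschitz_hull\<close>). Hence two
approximations satisfy the same Gronwall inequality up to a small defect, and they converge uniformly
(\<open>X_close\<close>).

Two points remain. The averages of \<open>f\<close> along the approximations may oscillate and need not converge pointwise;
\<open>weak_limit_selection\<close> produces a weak limit of them that lies, at almost every time, in the closed convex
hulls of all tails of the sequence and therefore in the regularization. That the limit curve has the
resulting velocity almost everywhere is Lebesgue's differentiation theorem
(\<open>indefinite_integral_has_vector_derivative_AE\<close>). The integrable bound required throughout comes
from \<open>one_sided_Lipschitz_on_bound\<close>: for a one-sided Lipschitz map an almost-everywhere bound on a ball
implies a bound at every point of a smaller ball.
\<close>

section \<open>Absolute continuity\<close>

lemma integral_diff_interval:
  fixes f :: "real \<Rightarrow> 'b::euclidean_space"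
  assumes "f integrable_on {a..b}" "a \<le> u" "u \<le> v" "v \<le> b"
  shows "integral {a..v} f - integral {a..u} f = integral {u..v} f"
proof -
  have "f integrable_on {a..v}" using assms by (auto intro: integrable_on_subinterval)
  from Henstock_Kurzweil_Integration.integral_combine[OF assms(2,3) this] show ?thesis
    by (simp add: algebra_simps)
qed

definition nonoverlapping :: "real \<Rightarrow> real \<Rightarrow> (real \<times> real) set \<Rightarrow> bool" where
  "nonoverlapping a b D \<longleftrightarrow> finite D \<and> (\<forall>(u, v)\<in>D. a \<le> u \<and> u \<le> v \<and> v \<le> b) \<and>
     disjoint_family_on (\<lambda>(u, v). {u<..<v}) D"

lemma nonoverlappingD:
  assumes "nonoverlapping a b D"
  shows "finite D" "(u, v) \<in> D \<Longrightarrow> a \<le> u \<and> u \<le> v \<and> v \<le> b"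
    "disjoint_family_on (\<lambda>(u, v). {u<..<v}) D"
  using assms unfolding nonoverlapping_def by blast+

lemma nonoverlapping_singleton: "a \<le> u \<Longrightarrow> u \<le> v \<Longrightarrow> v \<le> b \<Longrightarrow> nonoverlapping a b {(u, v)}"
  by (simp add: nonoverlapping_def disjoint_family_on_def)

lemma nonoverlapping_mono: "nonoverlapping c d D \<Longrightarrow> a \<le> c \<Longrightarrow> d \<le> b \<Longrightarrow> nonoverlapping a b D"
  unfolding nonoverlapping_def by fastforce

text \<open>The \<open>\<epsilon>\<close>-\<open>\<delta>\<close> condition for maps into an arbitrary normed space, so that it also applies to scalar
quantities such as the squared distance of two curves.\<close>

definition abs_cont :: "real \<Rightarrow> real \<Rightarrow> (real \<Rightarrow> 'b::real_normed_vector) \<Rightarrow> bool" where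
  "abs_cont a b x \<longleftrightarrow> (\<forall>\<epsilon>>0. \<exists>\<delta>>0. \<forall>D. nonoverlapping a b D \<and> (\<Sum>(u, v)\<in>D. v - u) < \<delta>
     \<longrightarrow> (\<Sum>(u, v)\<in>D. norm (x v - x u)) < \<epsilon>)"

lemma abs_continuous_on_interval_iff: "abs_continuous_on_interval a b x \<longleftrightarrow> abs_cont a b x"
  unfolding abs_continuous_on_interval_def abs_cont_def nonoverlapping_def conj_assoc ..

lemma abs_contD:
  assumes "abs_cont a b x" "\<epsilon> > 0"
  obtains \<delta> where "\<delta> > 0" "\<And>D. nonoverlapping a b D \<Longrightarrow> (\<Sum>(u, v)\<in>D. v - u) < \<delta> \<Longrightarrow>
    (\<Sum>(u, v)\<in>D. norm (x v - x u)) < \<epsilon>"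
  using assms unfolding abs_cont_def by meson

lemma abs_contI:
  assumes "\<And>\<epsilon>::real. \<epsilon> > 0 \<Longrightarrow> \<exists>\<delta>>0. \<forall>D. nonoverlapping a b D \<longrightarrow> (\<Sum>(u, v)\<in>D. v - u) < \<delta> \<longrightarrow>
    (\<Sum>(u, v)\<in>D. norm (x v - x u)) < \<epsilon>"
  shows "abs_cont a b x"
  unfolding abs_cont_def using assms by meson

lemma abs_cont_subinterval: "abs_cont a b x \<Longrightarrow> a \<le> c \<Longrightarrow> d \<le> b \<Longrightarrow> abs_cont c d x"
  unfolding abs_cont_def by (meson nonoverlapping_mono)

lemma abs_cont_imp_continuous_on:
  assumes "abs_cont a b x"
  shows "continuous_on {a..b} x"
proof -
  have "\<exists>\<delta>>0. \<forall>s\<in>{a..b}. dist s t < \<delta> \<longrightarrow> dist (x s) (x t) < \<epsilon>"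
    if "\<epsilon> > 0" "t \<in> {a..b}" for t \<epsilon>
  proof -
    obtain \<delta> where d: "\<delta> > 0" "\<And>D. nonoverlapping a b D \<Longrightarrow> (\<Sum>(u, v)\<in>D. v - u) < \<delta> \<Longrightarrow>
        (\<Sum>(u, v)\<in>D. norm (x v - x u)) < \<epsilon>"
      using abs_contD[OF assms \<open>\<epsilon> > 0\<close>] by blast
    have "dist (x s) (x t) < \<epsilon>" if "s \<in> {a..b}" "dist s t < \<delta>" for s
      using d(2)[OF nonoverlapping_singleton, of s t] d(2)[OF nonoverlapping_singleton, of t s]
        that \<open>t \<in> {a..b}\<close>
      by (cases "s \<le> t") (simp_all add: dist_norm norm_minus_commute)
    with \<open>\<delta> > 0\<close> show ?thesis by blast
  qed
  then show ?thesis
    unfolding continuous_on_iff by blast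
qed

text \<open>This covers \<open>\<bar>e\<bar>\<^sup>2 - G\<close> for absolutely continuous \<open>e\<close> and \<open>G\<close>: on a bounded range the square
of the norm is Lipschitz, so its increments are controlled by those of \<open>e\<close>.\<close>

lemma abs_cont_dominated:
  assumes p: "abs_cont a b p" and q: "abs_cont a b q" and "K \<ge> 0"
    and *: "\<And>u v. a \<le> u \<Longrightarrow> u \<le> v \<Longrightarrow> v \<le> b \<Longrightarrow>
              norm (x v - x u) \<le> K * norm (p v - p u) + norm (q v - q u)"
  shows "abs_cont a b x"
proof (rule abs_contI)
  fix \<epsilon> :: real assume "\<epsilon> > 0"
  then have e: "\<epsilon> / (2 * (K + 1)) > 0" "\<epsilon> / 2 > 0"
    using \<open>K \<ge> 0\<close> by auto
  obtain \<delta>1 where d1: "\<delta>1 > 0" "\<And>D. nonoverlapping a b D \<Longrightarrow> (\<Sum>(u, v)\<in>D. v - u) < \<delta>1 \<Longrightarrow>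
      (\<Sum>(u, v)\<in>D. norm (p v - p u)) < \<epsilon> / (2 * (K + 1))"
    using abs_contD[OF p e(1)] by blast
  obtain \<delta>2 where d2: "\<delta>2 > 0" "\<And>D. nonoverlapping a b D \<Longrightarrow> (\<Sum>(u, v)\<in>D. v - u) < \<delta>2 \<Longrightarrow>
      (\<Sum>(u, v)\<in>D. norm (q v - q u)) < \<epsilon> / 2"
    using abs_contD[OF q e(2)] by blast
  have "(\<Sum>(u, v)\<in>D. norm (x v - x u)) < \<epsilon>"
    if D: "nonoverlapping a b D" and "(\<Sum>(u, v)\<in>D. v - u) < min \<delta>1 \<delta>2" for D
  proof -
    have "(\<Sum>(u, v)\<in>D. norm (x v - x u)) \<le> (\<Sum>(u, v)\<in>D. K * norm (p v - p u) + norm (q v - q u))"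
      using * nonoverlappingD(2)[OF D] by (intro sum_mono) auto
    also have "\<dots> = K * (\<Sum>(u, v)\<in>D. norm (p v - p u)) + (\<Sum>(u, v)\<in>D. norm (q v - q u))"
      by (simp add: sum.distrib sum_distrib_left split_def)
    also have "\<dots> < K * (\<epsilon> / (2 * (K + 1))) + \<epsilon> / 2"
      using d1(2)[OF D] d2(2)[OF D] that(2) \<open>K \<ge> 0\<close>
      by (intro add_le_less_mono mult_left_mono) auto
    also have "\<dots> \<le> \<epsilon> / 2 + \<epsilon> / 2"
      using \<open>K \<ge> 0\<close> \<open>\<epsilon> > 0\<close> by (auto simp: field_simps)
    finally show ?thesis by simp
  qed
  with d1(1) d2(1) show "\<exists>\<delta>>0. \<forall>D. nonoverlapping a b D \<longrightarrow> (\<Sum>(u, v)\<in>D. v - u) < \<delta> \<longrightarrow>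
      (\<Sum>(u, v)\<in>D. norm (x v - x u)) < \<epsilon>"
    by (intro exI[of _ "min \<delta>1 \<delta>2"]) auto
qed

lemma sum_disjoint_integrals_le:
  fixes q :: "real \<Rightarrow> real"
  assumes q: "q integrable_on {a..b}" "\<And>t. t \<in> {a..b} \<Longrightarrow> 0 \<le> q t"
    and "nonoverlapping a b D"
  shows "(\<Sum>(u, v)\<in>D. integral {u..v} q) \<le> integral {a..b} q"
proof -
  note D = nonoverlappingD[OF \<open>nonoverlapping a b D\<close>]
  have neg: "negligible ({u..v} \<inter> {u'..v'})" if "(u,v) \<in> D" "(u',v') \<in> D" "(u,v) \<noteq> (u',v')" for u v u' v' :: real
  proof -
    have "{u<..<v} \<inter> {u'<..<v'} = {}"
      using disjoint_family_onD[OF D(3) that(1,2)] that(3) by auto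
    moreover have "{u..v} \<inter> {u'..v'} \<subseteq> {u,v,u',v'} \<union> ({u<..<v} \<inter> {u'<..<v'})"
      by (auto simp: less_le)
    ultimately show ?thesis
      by (metis Un_empty_right finite.simps negligible_finite negligible_subset)
  qed
  have "(q has_integral (\<Sum>I\<in>D. integral {fst I..snd I} q)) (\<Union>I\<in>D. {fst I..snd I})"
  proof (rule has_integral_UN[OF D(1)])
    show "(q has_integral integral {fst i..snd i} q) {fst i..snd i}" if "i \<in> D" for i
      using D(2)[of "fst i" "snd i"] that
      by (intro integrable_integral integrable_on_subinterval[OF q(1)]) auto
    show "pairwise (\<lambda>i i'. negligible ({fst i..snd i} \<inter> {fst i'..snd i'})) D"
      unfolding pairwise_def using neg by (metis prod.collapse)
  qed
  then have "(\<Sum>I\<in>D. integral {fst I..snd I} q) \<le> integral {a..b} q"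
    by (rule has_integral_subset_le[rotated]) (use D(2) q in \<open>force simp: integrable_integral\<close>)+
  then show ?thesis by (simp add: split_def)
qed

text \<open>The integral of \<open>m\<close> over short intervals is small because \<open>m\<close> is the sum of the bounded function
\<open>min m N\<close> and a remainder whose integral over the whole interval is small for large \<open>N\<close>.\<close>

lemma abs_cont_if_integral_bound:
  fixes m :: "real \<Rightarrow> real"
  assumes m: "m integrable_on {a..b}" "\<And>t. t \<in> {a..b} \<Longrightarrow> 0 \<le> m t"
    and *: "\<And>u v. a \<le> u \<Longrightarrow> u \<le> v \<Longrightarrow> v \<le> b \<Longrightarrow> norm (x v - x u) \<le> integral {u..v} m"
  shows "abs_cont a b x"
proof (rule abs_contI)
  fix \<epsilon> :: real assume "\<epsilon> > 0"
  have mm: "(\<lambda>t. min (m t) (real N)) integrable_on {a..b}" for N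
  proof -
    have "m absolutely_integrable_on {a..b}"
      by (rule nonnegative_absolutely_integrable_1) (use m in auto)
    moreover have "(\<lambda>t. real N) absolutely_integrable_on {a..b}"
      by (rule absolutely_integrable_on_const) simp
    ultimately have "(\<lambda>t. min (m t) (real N)) absolutely_integrable_on {a..b}"
      by (rule absolutely_integrable_min_1)
    then show ?thesis
      by (rule set_lebesgue_integral_eq_integral(1))
  qed
  have "(\<lambda>N. integral {a..b} (\<lambda>t. min (m t) (real N))) \<longlonglongrightarrow> integral {a..b} m"
  proof (rule dominated_convergence(2)[OF mm m(1)])
    show "norm (min (m t) (real N)) \<le> m t" if "t \<in> {a..b}" for N t using m(2)[OF that] by auto
    show "(\<lambda>N. min (m t) (real N)) \<longlonglongrightarrow> m t" if "t \<in> {a..b}" for t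
    proof (rule tendsto_eventually)
      show "\<forall>\<^sub>F N in sequentially. min (m t) (real N) = m t"
        by (rule eventually_sequentiallyI[of "nat \<lceil>m t\<rceil>"]) linarith
    qed
  qed
  then obtain N where N: "norm (integral {a..b} (\<lambda>t. min (m t) (real N)) - integral {a..b} m) < \<epsilon>/2"
    using LIMSEQ_D[of _ _ "\<epsilon>/2"] \<open>\<epsilon> > 0\<close> by (metis half_gt_zero order_refl)
  define q where "q t = m t - min (m t) (real N)" for t
  have q: "q integrable_on {a..b}" "\<And>t. t \<in> {a..b} \<Longrightarrow> 0 \<le> q t"
    unfolding q_def using m mm by (auto intro: integrable_diff)
  have qe: "integral {a..b} q < \<epsilon>/2"
  proof -
    have "integral {a..b} q = integral {a..b} m - integral {a..b} (\<lambda>t. min (m t) (real N))"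
      unfolding q_def by (rule Henstock_Kurzweil_Integration.integral_diff[OF m(1) mm])
    with N show ?thesis unfolding real_norm_def by linarith
  qed
  have "(\<Sum>(u, v)\<in>D. norm (x v - x u)) < \<epsilon>"
    if D: "nonoverlapping a b D" and s: "(\<Sum>(u, v)\<in>D. v - u) < \<epsilon> / (2 * (real N + 1))" for D
  proof -
    have "norm (x v - x u) \<le> integral {u..v} q + (real N + 1) * (v - u)" if "(u,v) \<in> D" for u v
    proof -
      note uv = nonoverlappingD(2)[OF D that]
      have i: "q integrable_on {u..v}" "m integrable_on {u..v}"
        using uv q m by (auto intro: integrable_on_subinterval)
      have "norm (x v - x u) \<le> integral {u..v} m" using * uv by blast
      also have "\<dots> \<le> integral {u..v} (\<lambda>t. q t + (real N + 1))"
        by (rule integral_le) (use i in \<open>auto intro!: integrable_add\<close>, auto simp: q_def)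
      also have "\<dots> = integral {u..v} q + (real N + 1) * (v - u)"
        using i uv by (subst Henstock_Kurzweil_Integration.integral_add) (auto simp: algebra_simps)
      finally show ?thesis .
    qed
    then have "(\<Sum>(u, v)\<in>D. norm (x v - x u)) \<le> (\<Sum>(u, v)\<in>D. integral {u..v} q + (real N + 1) * (v - u))"
      by (intro sum_mono) auto
    also have "\<dots> = (\<Sum>(u, v)\<in>D. integral {u..v} q) + (real N + 1) * (\<Sum>(u, v)\<in>D. v - u)"
      by (simp add: sum.distrib sum_distrib_left split_def)
    also have "\<dots> < \<epsilon>/2 + (real N + 1) * (\<epsilon> / (2 * (real N + 1)))"
      using sum_disjoint_integrals_le[OF q D] s qe
      by (intro add_less_le_mono mult_left_mono) auto
    also have "\<dots> = \<epsilon>" by (simp add: field_simps)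
    finally show ?thesis .
  qed
  then show "\<exists>\<delta>>0. \<forall>D. nonoverlapping a b D \<longrightarrow> (\<Sum>(u, v)\<in>D. v - u) < \<delta> \<longrightarrow>
      (\<Sum>(u, v)\<in>D. norm (x v - x u)) < \<epsilon>"
    using \<open>\<epsilon> > 0\<close> by (intro exI[of _ "\<epsilon> / (2 * (real N + 1))"]) auto
qed

text \<open>A gauge argument. Enclose the exceptional null set \<open>N\<close> in an open set \<open>G\<close> of small measure, and take a
tagged division so fine that an interval tagged outside \<open>N\<close> sees the nonpositive derivative, up to
\<open>\<epsilon>\<close> times its length, while an interval tagged in \<open>N\<close> lies inside \<open>G\<close>. The latter have small total length,
so absolute continuity makes their total contribution small as well.\<close>

lemma abs_cont_nonincreasing:
  fixes \<psi> :: "real \<Rightarrow> real"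
  assumes ac: "abs_cont a b \<psi>" and "a \<le> b" and N: "negligible N"
    and deriv: "\<And>t. t \<in> {a..b} - N \<Longrightarrow> \<exists>d\<le>0. (\<psi> has_real_derivative d) (at t within {a..b})"
  shows "\<psi> b \<le> \<psi> a"
proof (rule field_le_epsilon)
  fix e :: real assume "e > 0"
  define \<epsilon> where "\<epsilon> = e / (b - a + 1)"
  have "\<epsilon> > 0" using \<open>e > 0\<close> \<open>a \<le> b\<close> by (simp add: \<epsilon>_def)
  obtain \<delta> where d: "\<delta> > 0" "\<And>D. nonoverlapping a b D \<Longrightarrow> (\<Sum>(u, v)\<in>D. v - u) < \<delta> \<Longrightarrow>
      (\<Sum>(u, v)\<in>D. norm (\<psi> v - \<psi> u)) < \<epsilon>"
    using abs_contD[OF ac \<open>\<epsilon> > 0\<close>] by blast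
  obtain G where G: "open G" "N \<subseteq> G" "G - N \<in> lmeasurable" "emeasure lebesgue (G - N) < ennreal \<delta>"
    using sets_lebesgue_outer_open[of N \<delta>] N d(1) negligible_imp_sets by metis
  have Gl: "G \<in> lmeasurable" "measure lebesgue G < \<delta>"
  proof -
    have "G = (G - N) \<union> N" using G by blast
    moreover have "N \<in> lmeasurable" "measure lebesgue N = 0"
      using N negligible_imp_measurable negligible_imp_measure0 by auto
    moreover have "measure lebesgue (G - N) < \<delta>"
      using G(3,4) d(1) by (simp add: emeasure_eq_measure2 ennreal_less_iff)
    ultimately show "G \<in> lmeasurable" "measure lebesgue G < \<delta>"
      using G(3) fmeasurable.Un[of "G - N" lebesgue N] measure_Un_le[of "G - N" lebesgue N]
      by (auto simp: fmeasurableD)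
  qed
  have "\<exists>r>0. \<forall>u v. a \<le> u \<and> u \<le> t \<and> t \<le> v \<and> v \<le> b \<and> {u..v} \<subseteq> ball t r \<longrightarrow> \<psi> v - \<psi> u \<le> \<epsilon> * (v - u)"
    if t: "t \<in> {a..b} - N" for t
  proof -
    from deriv[OF t] obtain d where "d \<le> 0" "(\<psi> has_real_derivative d) (at t within {a..b})" by blast
    then have "(\<psi> has_derivative (*) d) (at t within {a..b})"
      by (simp add: has_field_derivative_def)
    then obtain r where r: "r > 0"
      "\<And>y. y \<in> {a..b} \<Longrightarrow> norm (y - t) < r \<Longrightarrow> norm (\<psi> y - \<psi> t - d * (y - t)) \<le> \<epsilon> * norm (y - t)"
      unfolding has_derivative_within_alt using \<open>\<epsilon> > 0\<close> by metis
    have "\<psi> v - \<psi> u \<le> \<epsilon> * (v - u)" if "a \<le> u" "u \<le> t" "t \<le> v" "v \<le> b" "{u..v} \<subseteq> ball t r" for u v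
    proof -
      have "u \<in> {u..v}" "v \<in> {u..v}" using that by auto
      then have "u \<in> ball t r" "v \<in> ball t r" using that(5) by blast+
      then have "\<psi> v - \<psi> t - d * (v - t) \<le> \<epsilon> * (v - t)" "- (\<psi> u - \<psi> t - d * (u - t)) \<le> \<epsilon> * (t - u)"
        using r(2)[of v] r(2)[of u] that by (auto simp: dist_real_def)
      moreover have "d * (v - t) \<le> 0" "d * (u - t) \<ge> 0"
        using \<open>d \<le> 0\<close> that by (auto simp: mult_nonpos_nonneg mult_nonpos_nonpos)
      ultimately show ?thesis by (simp add: algebra_simps)
    qed
    with \<open>r > 0\<close> show ?thesis by blast
  qed
  then obtain r where r: "\<And>t. t \<in> {a..b} - N \<Longrightarrow> r t > 0"
    "\<And>t u v. t \<in> {a..b} - N \<Longrightarrow> a \<le> u \<Longrightarrow> u \<le> t \<Longrightarrow> t \<le> v \<Longrightarrow> v \<le> b \<Longrightarrow> {u..v} \<subseteq> ball t (r t) \<Longrightarrow> \<psi> v - \<psi> u \<le> \<epsilon> * (v - u)"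
    by metis
  define \<gamma> where "\<gamma> t = (if t \<in> N then G else if t \<in> {a..b} then ball t (r t) else ball t 1)" for t
  have "gauge \<gamma>"
    unfolding gauge_def \<gamma>_def using G r(1) by auto
  then obtain p where p: "p tagged_division_of {a..b}" "\<gamma> fine p"
    by (rule fine_division_exists_real)
  have K: "\<exists>u v. K = {u..v} \<and> u \<le> t \<and> t \<le> v \<and> a \<le> u \<and> v \<le> b \<and> K \<subseteq> \<gamma> t" if tK: "(t, K) \<in> p" for t K
  proof -
    from tagged_division_ofD(4)[OF p(1) tK] obtain u v where "K = {u..v}" by (auto simp: box_real)
    with tagged_division_ofD(2,3)[OF p(1) tK] p(2) tK show ?thesis
      by (intro exI[of _ u] exI[of _ v]) (auto simp: fine_def)
  qed
  have fp: "finite p" using p by auto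
  define pN where "pN = {i \<in> p. fst i \<in> N}"
  define D where "D = (\<lambda>(t,K). (Inf K, Sup K)) ` {i \<in> pN. Inf (snd i) < Sup (snd i)}"
  have int_disj: "{u<..<v} \<inter> {u'<..<v'} = {}"
    if "(t, {u..v}) \<in> p" "(t', {u'..v'}) \<in> p" "(t, {u..v}) \<noteq> (t', {u'..v'})" for t t' u v u' v'
    using tagged_division_ofD(5)[OF p(1) that] by simp
  \<comment> \<open>Degenerate intervals are discarded first: they may share their end points with others, but they
    contribute nothing.\<close>
  have inj: "inj_on (\<lambda>(t,K). (Inf K, Sup K)) {i \<in> pN. Inf (snd i) < Sup (snd i)}"
  proof (rule inj_onI, clarsimp simp: pN_def)
    fix t K t' K' assume *: "(t, K) \<in> p" "(t', K') \<in> p" "Inf K' < Sup K'" "Inf K = Inf K'" "Sup K = Sup K'"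
    from K[OF *(1)] K[OF *(2)] obtain u v u' v' where uv: "K = {u..v}" "u \<le> v" "K' = {u'..v'}" "u' \<le> v'" by force
    with * have "u = u'" "v = v'" "u < v" by auto
    with int_disj[of t u v t' u' v'] * uv show "t = t' \<and> K = K'"
      by auto
  qed
  have sumD: "(\<Sum>(u,v)\<in>D. h u v) = (\<Sum>(t,K)\<in>{i \<in> pN. Inf (snd i) < Sup (snd i)}. h (Inf K) (Sup K))" for h :: "real \<Rightarrow> real \<Rightarrow> real"
    unfolding D_def by (subst sum.reindex[OF inj]) (auto simp: split_def intro!: sum.cong)
  have finD: "finite D" using fp by (auto simp: D_def pN_def)
  have D2: "a \<le> u \<and> u \<le> v \<and> v \<le> b \<and> {u..v} \<subseteq> G \<and> (\<exists>t. (t, {u..v}) \<in> p)" if "(u, v) \<in> D" for u v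
  proof -
    from that obtain t K where tK: "(t,K) \<in> p" "t \<in> N" "u = Inf K" "v = Sup K"
      by (auto simp: D_def pN_def)
    from K[OF tK(1)] obtain u' v' where "K = {u'..v'}" "u' \<le> t \<and> t \<le> v' \<and> a \<le> u' \<and> v' \<le> b \<and> K \<subseteq> \<gamma> t" by blast
    with tK show ?thesis by (auto simp: \<gamma>_def)
  qed
  have D3: "disjoint_family_on (\<lambda>(u, v). {u<..<v}) D"
    unfolding disjoint_family_on_def
  proof (intro ballI impI)
    fix i j assume ij: "i \<in> D" "j \<in> D" "i \<noteq> j"
    obtain u v u' v' where i: "i = (u, v)" "j = (u', v')" by fastforce
    with ij have *: "(u, v) \<in> D" "(u', v') \<in> D" "(u,v) \<noteq> (u',v')" by auto
    from D2[OF *(1)] D2[OF *(2)] obtain t t' where 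
      **: "u \<le> v" "u' \<le> v'" "(t, {u..v}) \<in> p" "(t', {u'..v'}) \<in> p" by blast
    then have "{u..v} \<noteq> {u'..v'}" using *(3) by (auto simp: Icc_eq_Icc)
    then show "(case i of (u, v) \<Rightarrow> {u<..<v}) \<inter> (case j of (u, v) \<Rightarrow> {u<..<v}) = {}"
      using int_disj ** i by simp
  qed
  have Dlen: "(\<Sum>(u, v)\<in>D. v - u) < \<delta>"
  proof -
    have "measure lebesgue (\<Union>I\<in>D. {fst I<..<snd I}) = (\<Sum>I\<in>D. measure lebesgue {fst I<..<snd I})"
    proof (rule measure_finite_Union[OF finD])
      show "disjoint_family_on (\<lambda>I. {fst I<..<snd I}) D"
        using D3 by (simp add: split_def)
      show "emeasure lebesgue {fst I<..<snd I} \<noteq> \<infinity>" for I :: "real \<times> real"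
        by (cases "fst I \<le> snd I") auto
    qed auto
    also have "\<dots> = (\<Sum>(u, v)\<in>D. v - u)"
      using D2 by (intro sum.cong) auto
    finally have "(\<Sum>(u, v)\<in>D. v - u) = measure lebesgue (\<Union>I\<in>D. {fst I<..<snd I})" by simp
    also have "\<dots> \<le> measure lebesgue G"
      using D2 Gl finD by (intro measure_mono_fmeasurable) (force intro!: sets.finite_UN)+
    finally show ?thesis using Gl by simp
  qed
  have "\<psi> b - \<psi> a = (\<Sum>(t,K)\<in>p. \<psi> (Sup K) - \<psi> (Inf K))"
    using additive_tagged_division_1[OF \<open>a \<le> b\<close> p(1)] by metis
  also have "\<dots> = (\<Sum>(t,K)\<in>p - pN. \<psi> (Sup K) - \<psi> (Inf K)) + (\<Sum>(t,K)\<in>pN. \<psi> (Sup K) - \<psi> (Inf K))"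
    by (rule sum.subset_diff[OF _ fp]) (auto simp: pN_def)
  also have "(\<Sum>(t,K)\<in>pN. \<psi> (Sup K) - \<psi> (Inf K)) 
      = (\<Sum>(t,K)\<in>{i \<in> pN. Inf (snd i) < Sup (snd i)}. \<psi> (Sup K) - \<psi> (Inf K))"
  proof (rule sum.mono_neutral_right)
    show "finite pN" using fp by (auto simp: pN_def)
    show "\<forall>i\<in>pN - {i \<in> pN. Inf (snd i) < Sup (snd i)}. (case i of (t, K) \<Rightarrow> \<psi> (Sup K) - \<psi> (Inf K)) = 0"
    proof (intro ballI)
      fix i assume i: "i \<in> pN - {i \<in> pN. Inf (snd i) < Sup (snd i)}"
      obtain t K where tK: "i = (t, K)" by fastforce
      with i have "(t,K) \<in> p" by (auto simp: pN_def)
      from K[OF this] obtain u v where "K = {u..v}" "u \<le> v" by force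
      with i tK show "(case i of (t, K) \<Rightarrow> \<psi> (Sup K) - \<psi> (Inf K)) = 0" by auto
    qed
  qed auto
  also have "\<dots> = (\<Sum>(u,v)\<in>D. \<psi> v - \<psi> u)"
    by (subst sumD) simp
  also have "\<dots> \<le> (\<Sum>(u,v)\<in>D. norm (\<psi> v - \<psi> u))"
    by (intro sum_mono) auto
  also have "\<dots> \<le> \<epsilon>"
    using d(2)[OF _ Dlen] finD D2 D3 by (fastforce simp: nonoverlapping_def)
  also have "(\<Sum>(t,K)\<in>p - pN. \<psi> (Sup K) - \<psi> (Inf K)) \<le> (\<Sum>(t,K)\<in>p - pN. \<epsilon> * (Sup K - Inf K))"
  proof (rule sum_mono)
    fix i assume "i \<in> p - pN"
    then obtain t K where i: "i = (t, K)" and *: "(t, K) \<in> p" "(t, K) \<notin> pN" by (cases i) auto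
    from K[OF *(1)] obtain u v where "K = {u..v}" "u \<le> t \<and> t \<le> v \<and> a \<le> u \<and> v \<le> b \<and> K \<subseteq> \<gamma> t" by blast
    with * r(2)[of t u v] i
    show "(case i of (t, K) \<Rightarrow> \<psi> (Sup K) - \<psi> (Inf K)) \<le> (case i of (t, K) \<Rightarrow> \<epsilon> * (Sup K - Inf K))"
      by (auto simp: pN_def \<gamma>_def)
  qed
  also have "\<dots> \<le> (\<Sum>(t,K)\<in>p. \<epsilon> * (Sup K - Inf K))"
    using fp K \<open>\<epsilon> > 0\<close> by (intro sum_mono2) force+
  also have "\<dots> = \<epsilon> * (b - a)"
    using additive_tagged_division_1[OF \<open>a \<le> b\<close> p(1), of "\<lambda>x. x"] 
    by (simp add: split_def flip: sum_distrib_left)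
  finally have "\<psi> b - \<psi> a \<le> \<epsilon> * (b - a) + \<epsilon>" by simp
  also have "\<dots> = (b - a + 1) * \<epsilon>" by (simp add: algebra_simps)
  also have "\<dots> = e" using \<open>a \<le> b\<close> by (simp add: \<epsilon>_def)
  finally show "\<psi> b \<le> \<psi> a + e" by simp
qed

section \<open>Differentiation of the indefinite integral\<close>

text \<open>Lebesgue's differentiation theorem on the line. Around each point where the difference quotients miss
\<open>f t\<close> by more than \<open>\<epsilon>\<close> there are arbitrarily short intervals with that defect. By Vitali's covering lemma
disjoint ones can be chosen whose fivefold enlargements still cover all such points. They form a fine partial
tagged division, so Henstock's lemma bounds the sum of their defects, hence their total
length, by an arbitrarily small number.\<close>

lemma indefinite_integral_has_vector_derivative_AE:
  fixes f :: "real \<Rightarrow> 'b::euclidean_space"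
  assumes f: "f integrable_on {a..b}"
  obtains N where "negligible N"
    "\<And>t. t \<in> {a..b} - N \<Longrightarrow>
       ((\<lambda>s. integral {a..s} f) has_vector_derivative f t) (at t within {a..b})"
proof -
  define bad where "bad \<epsilon> t u v \<longleftrightarrow> a \<le> u \<and> u < v \<and> v \<le> b \<and> (t = u \<or> t = v) \<and>
      norm (integral {u..v} f - (v - u) *\<^sub>R f t) > \<epsilon> * (v - u)" for \<epsilon> t u v
  define E where "E \<epsilon> = {t. \<forall>d>0. \<exists>u v. bad \<epsilon> t u v \<and> v - u < d}" for \<epsilon>
  have negE: "negligible (E \<epsilon>)" if "\<epsilon> > 0" for \<epsilon>
    unfolding negligible_outer_le
  proof (intro allI impI)
    fix \<eta> :: real assume "\<eta> > 0"
    then have e: "\<epsilon> * \<eta> / 5 > 0" using \<open>\<epsilon> > 0\<close> by simp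
    obtain \<gamma> where \<gamma>: "gauge \<gamma>"
      "\<And>p. \<lbrakk>p tagged_partial_division_of (cbox a b); \<gamma> fine p\<rbrakk> \<Longrightarrow>
             (\<Sum>(x,k)\<in>p. norm (measure lborel k *\<^sub>R f x - integral k f)) < \<epsilon> * \<eta> / 5"
      using Henstock_lemma[OF f[folded box_real(2)] e] by blast
    have "\<exists>u v. bad \<epsilon> t u v \<and> v - u < 1 \<and> {u..v} \<subseteq> \<gamma> t" if "t \<in> E \<epsilon>" for t
    proof -
      from \<gamma>(1) have "open (\<gamma> t)" "t \<in> \<gamma> t" by (auto simp: gauge_def)
      then obtain r where r: "r > 0" "ball t r \<subseteq> \<gamma> t" by (meson openE)
      from \<open>t \<in> E \<epsilon>\<close> \<open>r > 0\<close> obtain u v where uv: "bad \<epsilon> t u v" "v - u < min r 1"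
        unfolding E_def by (auto dest!: spec[of _ "min r 1"])
      then have "{u..v} \<subseteq> ball t r" by (auto simp: bad_def dist_real_def)
      with r uv show ?thesis by (intro exI[of _ u] exI[of _ v]) auto
    qed
    then obtain u v where uv: "\<And>t. t \<in> E \<epsilon> \<Longrightarrow> bad \<epsilon> t (u t) (v t)" "\<And>t. t \<in> E \<epsilon> \<Longrightarrow> v t - u t < 1"
      "\<And>t. t \<in> E \<epsilon> \<Longrightarrow> {u t..v t} \<subseteq> \<gamma> t"
      by metis
    define c where "c t = (u t + v t) / 2" for t
    define r where "r t = (v t - u t) / 2" for t
    have cr: "cball (c t) (r t) = {u t..v t}" for t
      unfolding cball_eq_atLeastAtMost c_def r_def by (simp add: field_simps)
    have tuv: "t \<in> {u t..v t}" "a \<le> u t" "u t < v t" "v t \<le> b" "r t > 0" if "t \<in> E \<epsilon>" for t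
      using uv(1)[OF that] by (auto simp: bad_def r_def)
    obtain C where C: "countable C" "C \<subseteq> E \<epsilon>"
      "pairwise (\<lambda>i j. disjnt (cball (c i) (r i)) (cball (c j) (r j))) C"
      "E \<epsilon> \<subseteq> (\<Union>i\<in>C. cball (c i) (5 * r i))"
    proof (rule Vitali_covering_lemma_cballs[where S = "E \<epsilon>" and K = "E \<epsilon>" and a = c and r = r and B = 1])
      show "E \<epsilon> \<subseteq> (\<Union>i\<in>E \<epsilon>. cball (c i) (r i))" using tuv(1) by (auto simp: cr)
      show "0 < r i \<and> r i \<le> 1" if "i \<in> E \<epsilon>" for i
        using tuv[OF that] uv(2)[OF that] by (auto simp: r_def)
    qed blast
    have fin: "(\<Sum>t\<in>F. v t - u t) \<le> \<eta> / 5" if F: "finite F" "F \<subseteq> C" for F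
    proof -
      let ?p = "(\<lambda>t. (t, {u t..v t})) ` F"
      have "?p tagged_partial_division_of (cbox a b)"
        unfolding tagged_partial_division_of_def
      proof (intro conjI allI impI)
        show "finite ?p" using F by simp
        fix x K assume "(x, K) \<in> ?p"
        then have xK: "K = {u x..v x}" "x \<in> E \<epsilon>" using F(2) C(2) by auto
        show "x \<in> K" "K \<subseteq> cbox a b" "\<exists>a b. K = cbox a b"
          using tuv[OF xK(2)] xK(1) by (auto simp flip: box_real)
      next
        show "interior K1 \<inter> interior K2 = {}"
          if "(x1, K1) \<in> ?p \<and> (x2, K2) \<in> ?p \<and> (x1, K1) \<noteq> (x2, K2)" for x1 K1 x2 K2
        proof -
          from that have *: "(x1, K1) \<in> ?p" "(x2, K2) \<in> ?p" "(x1, K1) \<noteq> (x2, K2)" by auto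
          have "x1 \<noteq> x2" "x1 \<in> C" "x2 \<in> C" "K1 = cball (c x1) (r x1)" "K2 = cball (c x2) (r x2)"
            using * F(2) by (auto simp: cr)
          with C(3) have "disjnt K1 K2" by (simp add: pairwise_def)
          then show ?thesis using interior_subset by (fastforce simp: disjnt_def)
        qed
      qed
      moreover have "\<gamma> fine ?p"
        using uv(3) F C(2) by (auto simp: fine_def)
      ultimately have "(\<Sum>(x,k)\<in>?p. norm (measure lborel k *\<^sub>R f x - integral k f)) < \<epsilon> * \<eta> / 5"
        by (rule \<gamma>(2))
      moreover have "(\<Sum>(x,k)\<in>?p. norm (measure lborel k *\<^sub>R f x - integral k f))
          = (\<Sum>t\<in>F. norm (measure lborel {u t..v t} *\<^sub>R f t - integral {u t..v t} f))"
        by (subst sum.reindex) (auto intro: inj_onI)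
      moreover have "(\<Sum>t\<in>F. \<epsilon> * (v t - u t)) \<le> (\<Sum>t\<in>F. norm (measure lborel {u t..v t} *\<^sub>R f t - integral {u t..v t} f))"
      proof (rule sum_mono)
        fix t assume "t \<in> F"
        then have "t \<in> E \<epsilon>" using F C by auto
        from uv(1)[OF this] tuv[OF this]
        show "\<epsilon> * (v t - u t) \<le> norm (measure lborel {u t..v t} *\<^sub>R f t - integral {u t..v t} f)"
          by (auto simp: bad_def norm_minus_commute)
      qed
      ultimately have "\<epsilon> * (\<Sum>t\<in>F. v t - u t) \<le> \<epsilon> * (\<eta> / 5)"
        by (simp add: sum_distrib_left)
      then show ?thesis using \<open>\<epsilon> > 0\<close> by simp
    qed
    let ?T = "\<Union>i\<in>C. cball (c i) (5 * r i)"
    have "?T \<in> lmeasurable \<and> measure lebesgue ?T \<le> \<eta>"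
    proof -
      have 1: "measure lebesgue (\<Union>i\<in>F. cball (c i) (5 * r i)) \<le> \<eta>" if F: "F \<subseteq> C" "finite F" for F
      proof -
        have "measure lebesgue (\<Union>i\<in>F. cball (c i) (5 * r i)) \<le> (\<Sum>i\<in>F. measure lebesgue (cball (c i) (5 * r i)))"
          by (rule measure_UNION_le[OF F(2)]) simp
        also have "\<dots> = (\<Sum>i\<in>F. 5 * (v i - u i))"
        proof (rule sum.cong[OF refl])
          fix i assume "i \<in> F"
          then have "r i > 0" using F C tuv by blast
          then show "measure lebesgue (cball (c i) (5 * r i)) = 5 * (v i - u i)"
            unfolding r_def by (simp add: cball_eq_atLeastAtMost field_simps)
        qed
        also have "\<dots> \<le> \<eta>"
          using fin[OF F(2,1)] unfolding sum_distrib_left[symmetric] by simp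
        finally show ?thesis .
      qed
      show ?thesis
        by (intro conjI fmeasurable_UN_bound[OF C(1)] measure_UN_bound[OF C(1)]) (use 1 in auto)
    qed
    with C(4) show "\<exists>T. E \<epsilon> \<subseteq> T \<and> T \<in> lmeasurable \<and> measure lebesgue T \<le> \<eta>" by blast
  qed
  define N where "N = (\<Union>n::nat. E (1 / real (Suc n)))"
  show thesis
  proof (rule that[of N])
    show "negligible N"
      unfolding N_def by (rule negligible_Union_nat, rule negE) simp
    fix t assume t: "t \<in> {a..b} - N"
    show "((\<lambda>s. integral {a..s} f) has_vector_derivative f t) (at t within {a..b})"
      unfolding has_vector_derivative_def has_derivative_within_alt
    proof (intro conjI allI impI)
      show "bounded_linear (\<lambda>x. x *\<^sub>R f t)" by (rule bounded_linear_scaleR_left)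
      fix e :: real assume "e > 0"
      then obtain n where n: "1 / real (Suc n) < e" using nat_approx_posE by blast
      from t have "t \<notin> E (1 / real (Suc n))" by (auto simp: N_def)
      then obtain d where d: "d > 0" "\<And>u v. bad (1 / real (Suc n)) t u v \<Longrightarrow> \<not> (v - u < d)"
        unfolding E_def by blast
      have diff: "integral {a..v} f - integral {a..u} f = integral {u..v} f" if "a \<le> u" "u \<le> v" "v \<le> b" for u v
        using integral_diff_interval[OF f that] .
      show "\<exists>d>0. \<forall>y\<in>{a..b}. norm (y - t) < d \<longrightarrow>
             norm (integral {a..y} f - integral {a..t} f - (y - t) *\<^sub>R f t) \<le> e * norm (y - t)"
      proof (intro exI[of _ d] conjI ballI impI d(1))
        fix y assume y: "y \<in> {a..b}" "norm (y - t) < d"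
        have mono: "1 / real (Suc n) * z \<le> e * z" if "z \<ge> 0" for z
          using n that by (intro mult_right_mono) auto
        consider "y = t" | "t < y" | "y < t" by linarith
        then show "norm (integral {a..y} f - integral {a..t} f - (y - t) *\<^sub>R f t) \<le> e * norm (y - t)"
        proof cases
          case 2
          have "norm (integral {t..y} f - (y - t) *\<^sub>R f t) \<le> 1 / real (Suc n) * (y - t)"
            by (rule leI, rule notI) (use d(2)[of t y] y t 2 in \<open>auto simp: bad_def\<close>)
          also have "\<dots> \<le> e * (y - t)" using 2 mono by simp
          finally show ?thesis using 2 diff[of t y] y t by simp
        next
          case 3
          have "norm (integral {y..t} f - (t - y) *\<^sub>R f t) \<le> 1 / real (Suc n) * (t - y)"
            by (rule leI, rule notI) (use d(2)[of y t] y t 3 in \<open>auto simp: bad_def\<close>)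
          also have "\<dots> \<le> e * (t - y)" using 3 mono by simp
          finally have "norm (integral {y..t} f - (t - y) *\<^sub>R f t) \<le> e * (t - y)" .
          moreover have "integral {a..y} f - integral {a..t} f - (y - t) *\<^sub>R f t = - (integral {y..t} f - (t - y) *\<^sub>R f t)"
            using 3 diff[of y t] y t by (simp add: algebra_simps)
          ultimately show ?thesis using 3 by (metis norm_minus_cancel norm_minus_commute real_norm_def abs_of_pos diff_gt_0_iff_gt)
        qed simp
      qed
    qed
  qed
qed

section \<open>A Gronwall inequality with memory\<close>

text \<open>The derivative of \<open>\<bar>e\<bar>\<^sup>2\<close> at time \<open>t\<close> is controlled by the supremum of \<open>\<bar>e\<bar>\<close> over the whole past, which is
what a Volterra memory term produces. With \<open>M\<close> the maximum of \<open>\<bar>e t\<bar>\<^sup>2 exp (- 4 C (t - a))\<close>, the past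
of \<open>t\<close> satisfies \<open>\<bar>e\<bar>\<^sup>2 \<le> M exp (4 C (t - a))\<close>. Integrating the resulting
bound on the derivative returns the same estimate with \<open>M / 2\<close> in place of \<open>M\<close>, up to the defect term,
and therefore \<open>M \<le> 4 \<eta> (integral of m)\<close>. Uniqueness is the case \<open>\<eta> = 0\<close>.\<close>

lemma gronwall_memory:
  fixes e :: "real \<Rightarrow> 'b::euclidean_space" and m :: "real \<Rightarrow> real"
  assumes "a \<le> b" and ac: "abs_cont a b e" and "e a = 0"
    and m: "m integrable_on {a..b}" "\<And>t. t \<in> {a..b} \<Longrightarrow> 0 \<le> m t"
    and "C > 0" "\<eta> \<ge> 0" and N: "negligible N"
    and deriv: "\<And>t. t \<in> {a..b} - N \<Longrightarrow> \<exists>d. (e has_vector_derivative d) (at t within {a..b}) \<and>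
       (\<forall>R. (\<forall>s\<in>{a..t}. norm (e s) \<le> R) \<longrightarrow> e t \<bullet> d \<le> C * R\<^sup>2 + \<eta> * m t)"
    and "t \<in> {a..b}"
  shows "(norm (e t))\<^sup>2 \<le> 4 * \<eta> * integral {a..b} m * exp (4 * C * (b - a))"
proof -
  have cont: "continuous_on {a..b} e"
    using ac by (rule abs_cont_imp_continuous_on)
  have cont2: "continuous_on {a..b} (\<lambda>t. (norm (e t))\<^sup>2 * exp (- 4 * C * (t - a)))"
    by (intro continuous_intros cont)
  obtain T where T: "T \<in> {a..b}" "\<And>s. s \<in> {a..b} \<Longrightarrow>
      (norm (e s))\<^sup>2 * exp (- 4 * C * (s - a)) \<le> (norm (e T))\<^sup>2 * exp (- 4 * C * (T - a))"
    using continuous_attains_sup[OF _ _ cont2] \<open>a \<le> b\<close> by (auto simp del: mult_minus_left)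
  \<comment> \<open>\<open>M\<close> is the maximum of the exponentially weighted square; its exponent is twice the
    growth rate \<open>2 C\<close> of \<open>\<bar>e\<bar>\<^sup>2\<close>, which yields the factor \<open>1/2\<close> below.\<close>
  define M where "M = (norm (e T))\<^sup>2 * exp (- 4 * C * (T - a))"
  have "M \<ge> 0" by (simp add: M_def)
  have M: "(norm (e s))\<^sup>2 \<le> M * exp (4 * C * (s - a))" if "s \<in> {a..b}" for s
  proof -
    have "(norm (e s))\<^sup>2 = (norm (e s))\<^sup>2 * exp (- 4 * C * (s - a)) * exp (4 * C * (s - a))"
      by (simp add: mult.assoc flip: exp_add)
    also have "\<dots> \<le> M * exp (4 * C * (s - a))"
      using T(2)[OF that] unfolding M_def by (rule mult_right_mono) simp
    finally show ?thesis .
  qed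
  define g where "g s = 2 * C * M * exp (4 * C * (s - a)) + 2 * \<eta> * m s" for s
  have int_exp: "((\<lambda>s. 2 * C * M * exp (4 * C * (s - a))) has_integral (M / 2 * exp (4 * C * (t - a)) - M / 2)) {a..t}"
    if "a \<le> t" for t
  proof -
    have "((\<lambda>s. 2 * C * M * exp (4 * C * (s - a))) has_integral 
        (M / 2 * exp (4 * C * (t - a)) - M / 2 * exp (4 * C * (a - a)))) {a..t}"
      by (rule fundamental_theorem_of_calculus[OF that])
         (auto intro!: derivative_eq_intros simp flip: has_real_derivative_iff_has_vector_derivative)
    then show ?thesis by simp
  qed
  have g_int: "g integrable_on {a..b}"
    unfolding g_def
    by (rule integrable_add[OF has_integral_integrable[OF int_exp[OF \<open>a \<le> b\<close>]] integrable_on_mult_right[OF m(1)]])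
  have g_nn: "0 \<le> g s" if "s \<in> {a..b}" for s
    unfolding g_def using m(2)[OF that] \<open>C > 0\<close> \<open>\<eta> \<ge> 0\<close> \<open>M \<ge> 0\<close> by simp
  obtain N' where N': "negligible N'"
    "\<And>t. t \<in> {a..b} - N' \<Longrightarrow> ((\<lambda>s. integral {a..s} g) has_vector_derivative g t) (at t within {a..b})"
    using indefinite_integral_has_vector_derivative_AE[OF g_int] by blast
  define G where "G s = integral {a..s} g" for s
  have Gdiff: "G v - G u = integral {u..v} g" if "a \<le> u" "u \<le> v" "v \<le> b" for u v
    unfolding G_def by (rule integral_diff_interval[OF g_int that])
  have acG: "abs_cont a b G"
  proof (rule abs_cont_if_integral_bound[OF g_int g_nn])
    fix u v assume uv: "a \<le> u" "u \<le> v" "v \<le> b"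
    then have "integral {u..v} g \<ge> 0"
      using g_nn g_int by (intro integral_nonneg) (auto intro: integrable_on_subinterval)
    with Gdiff[OF uv] show "norm (G v - G u) \<le> integral {u..v} g" by simp
  qed
  obtain B where B: "\<And>s. s \<in> {a..b} \<Longrightarrow> norm (e s) \<le> B" "B > 0"
    using compact_continuous_image[OF cont] by (metis bounded_pos compact_Icc compact_imp_bounded image_eqI)
  define \<psi> where "\<psi> s = (norm (e s))\<^sup>2 - G s" for s
  have ac\<psi>: "abs_cont a b \<psi>"
  proof (rule abs_cont_dominated[OF ac acG])
    show "0 \<le> 2 * B" using B by simp
    fix u v assume uv: "a \<le> u" "u \<le> v" "v \<le> b"
    have "\<bar>(norm (e v))\<^sup>2 - (norm (e u))\<^sup>2\<bar> = \<bar>norm (e v) - norm (e u)\<bar> * (norm (e v) + norm (e u))"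
      by (simp add: power2_eq_square square_diff_square_factored abs_mult mult.commute)
    also have "\<dots> \<le> norm (e v - e u) * (2 * B)"
      using B(1)[of u] B(1)[of v] uv norm_triangle_ineq3[of "e v" "e u"] by (intro mult_mono) auto
    finally show "norm (\<psi> v - \<psi> u) \<le> 2 * B * norm (e v - e u) + norm (G v - G u)"
      unfolding \<psi>_def by (simp add: algebra_simps)
  qed
  have d\<psi>: "\<exists>d\<le>0. (\<psi> has_real_derivative d) (at s within {a..t})" if "t \<le> b" "s \<in> {a..t} - (N \<union> N')" for s t
  proof -
    have s: "s \<in> {a..b} - N" "s \<in> {a..b} - N'" using that by auto
    from deriv[OF s(1)] obtain d where d: "(e has_vector_derivative d) (at s within {a..b})"
      "\<And>R. \<forall>r\<in>{a..s}. norm (e r) \<le> R \<Longrightarrow> e s \<bullet> d \<le> C * R\<^sup>2 + \<eta> * m s" by blast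
    have "((\<lambda>s. e s \<bullet> e s) has_derivative (\<lambda>h. e s \<bullet> (h *\<^sub>R d) + (h *\<^sub>R d) \<bullet> e s)) (at s within {a..b})"
      using d(1) unfolding has_vector_derivative_def by (intro has_derivative_inner)
    then have "((\<lambda>s. (norm (e s))\<^sup>2) has_real_derivative 2 * (e s \<bullet> d)) (at s within {a..b})"
      unfolding has_field_derivative_def power2_norm_eq_inner
      by (rule has_derivative_eq_rhs) (auto simp: fun_eq_iff inner_commute)
    moreover have "(G has_real_derivative g s) (at s within {a..b})"
      using N'(2)[OF s(2)] by (simp add: G_def[abs_def] has_real_derivative_iff_has_vector_derivative)
    ultimately have "(\<psi> has_real_derivative (2 * (e s \<bullet> d) - g s)) (at s within {a..b})"
      unfolding \<psi>_def[abs_def] by (rule DERIV_diff)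
    then have "(\<psi> has_real_derivative (2 * (e s \<bullet> d) - g s)) (at s within {a..t})"
      by (rule DERIV_subset) (use that in auto)
    moreover have "2 * (e s \<bullet> d) - g s \<le> 0"
    proof -
      have "e s \<bullet> d \<le> C * (sqrt (M * exp (4 * C * (s - a))))\<^sup>2 + \<eta> * m s"
      proof (rule d(2), rule ballI)
        fix r assume r: "r \<in> {a..s}"
        then have "(norm (e r))\<^sup>2 \<le> M * exp (4 * C * (r - a))" using s by (intro M) auto
        also have "\<dots> \<le> M * exp (4 * C * (s - a))"
          using r \<open>C > 0\<close> \<open>M \<ge> 0\<close> by (intro mult_left_mono) auto
        finally show "norm (e r) \<le> sqrt (M * exp (4 * C * (s - a)))"
          by (rule real_le_rsqrt)
      qed
      then show ?thesis using \<open>M \<ge> 0\<close> by (simp add: g_def)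
    qed
    ultimately show ?thesis by blast
  qed
  have est: "(norm (e s))\<^sup>2 \<le> M / 2 * exp (4 * C * (s - a)) + 2 * \<eta> * integral {a..b} m" if s: "s \<in> {a..b}" for s
  proof -
    have "\<psi> s \<le> \<psi> a"
      by (rule abs_cont_nonincreasing[of a s \<psi> "N \<union> N'"])
         (use s d\<psi> N N' in \<open>auto intro!: abs_cont_subinterval[OF ac\<psi>]\<close>)
    moreover have "G a = 0" by (simp add: G_def)
    moreover have "G s = M / 2 * exp (4 * C * (s - a)) - M / 2 + 2 * \<eta> * integral {a..s} m"
    proof -
      have "(m has_integral integral {a..s} m) {a..s}"
        using m s by (intro integrable_integral) (auto intro: integrable_on_subinterval)
      with int_exp[of s] s have "(g has_integral (M / 2 * exp (4 * C * (s - a)) - M / 2 + 2 * \<eta> * integral {a..s} m)) {a..s}"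
        unfolding g_def by (intro has_integral_add has_integral_mult_right) auto
      then show ?thesis unfolding G_def by (rule integral_unique)
    qed
    moreover have "2 * \<eta> * integral {a..s} m \<le> 2 * \<eta> * integral {a..b} m"
      using m s \<open>\<eta> \<ge> 0\<close> by (intro mult_left_mono integral_subset_le) (auto intro: integrable_on_subinterval)
    ultimately show ?thesis using \<open>M \<ge> 0\<close> \<open>e a = 0\<close> by (simp add: \<psi>_def)
  qed
  have int_nn: "0 \<le> integral {a..b} m" using m by (intro integral_nonneg) auto
  have "M \<le> (M / 2 * exp (4 * C * (T - a)) + 2 * \<eta> * integral {a..b} m) * exp (- 4 * C * (T - a))"
    unfolding M_def by (rule mult_right_mono[OF est[OF T(1), unfolded M_def]]) simp
  also have "\<dots> = M / 2 + 2 * \<eta> * integral {a..b} m * exp (- 4 * C * (T - a))"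
    by (simp add: algebra_simps flip: exp_add)
  also have "\<dots> \<le> M / 2 + 2 * \<eta> * integral {a..b} m * 1"
    using int_nn \<open>\<eta> \<ge> 0\<close> \<open>C > 0\<close> T(1) by (intro add_left_mono mult_left_mono) auto
  finally have Mle: "M \<le> 4 * \<eta> * integral {a..b} m" by simp
  have "(norm (e t))\<^sup>2 \<le> M * exp (4 * C * (t - a))" using M assms by blast
  also have "\<dots> \<le> (4 * \<eta> * integral {a..b} m) * exp (4 * C * (b - a))"
    using Mle \<open>t \<in> _\<close> \<open>C > 0\<close> \<open>\<eta> \<ge> 0\<close> int_nn by (intro mult_mono) auto
  finally show ?thesis .
qed

section \<open>Weak limits of dominated sequences\<close>

lemma convex_half_sum:
  fixes x y :: "'a::real_vector"
  assumes "convex C" "x \<in> C" "y \<in> C"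
  shows "(1/2) *\<^sub>R (x + y) \<in> C"
  using convexD[OF assms, of "1/2" "1/2"] by (simp add: scaleR_add_right)

lemma summable_AE_if_integrals_summable:
  fixes s :: "nat \<Rightarrow> 's \<Rightarrow> real"
  assumes int: "\<And>n. integrable M (s n)" and nn: "\<And>n. AE t in M. 0 \<le> s n t"
    and sum: "summable (\<lambda>n. integral\<^sup>L M (s n))"
  shows "AE t in M. summable (\<lambda>n. s n t)"
proof -
  have "(\<integral>\<^sup>+t. (\<Sum>n. ennreal (s n t)) \<partial>M) = (\<Sum>n. \<integral>\<^sup>+t. ennreal (s n t) \<partial>M)"
    using int by (intro nn_integral_suminf) auto
  also have "\<dots> = (\<Sum>n. ennreal (integral\<^sup>L M (s n)))"
    using int nn by (intro suminf_cong nn_integral_eq_integral) auto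
  also have "\<dots> < \<infinity>"
    using sum nn by (subst suminf_ennreal2) (auto intro: integral_nonneg_AE)
  finally have "(\<integral>\<^sup>+t. (\<Sum>n. ennreal (s n t)) \<partial>M) \<noteq> \<infinity>" by simp
  moreover have "(\<lambda>t. \<Sum>n. ennreal (s n t)) \<in> borel_measurable M"
    using int by measurable
  ultimately have "AE t in M. (\<Sum>n. ennreal (s n t)) \<noteq> \<infinity>"
    by (intro nn_integral_noteq_infinite)
  moreover have "AE t in M. \<forall>n. 0 \<le> s n t"
    using nn by (simp add: AE_all_countable)
  ultimately show ?thesis
    by eventually_elim (auto intro: summable_suminf_not_top)
qed

text \<open>A substitute for weak compactness. The measurable functions that are dominated by \<open>m\<close>, have values in the closed
convex hull of the \<open>k\<close>-th tail of \<open>v\<close> and have their integrals in the hull of the \<open>k\<close>-th tail of the integrals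
form decreasing convex sets \<open>C k\<close>. Minimize the energy \<open>J\<close>, the integral of \<open>\<bar>u\<bar>\<^sup>2 / m\<close>, on each of them up to
\<open>1/(k+1)\<close>. The minimal energies increase and are bounded, so the parallelogram law
makes the near-minimizers a Cauchy sequence in energy, and a fast subsequence converges almost everywhere.
Its limit belongs to every \<open>C k\<close>. The weight \<open>1/m\<close> makes the energy finite although \<open>m\<close> is only integrable.\<close>

lemma weak_limit_selection:
  fixes M :: "'s measure" and v :: "nat \<Rightarrow> 's \<Rightarrow> 'b::euclidean_space"
  assumes m: "integrable M m" "\<And>t. m t > 0"
    and v: "\<And>k. v k \<in> borel_measurable M" "\<And>k. AE t in M. norm (v k t) \<le> m t"
    and S: "\<And>S. S \<in> \<S> \<Longrightarrow> S \<in> sets M"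
      "\<And>S. S \<in> \<S> \<Longrightarrow> (\<lambda>k. \<integral>t\<in>S. v k t \<partial>M) \<longlonglongrightarrow> z S"
  obtains u where "u \<in> borel_measurable M" "AE t in M. norm (u t) \<le> m t"
    "AE t in M. \<forall>k. u t \<in> closure (convex hull ((\<lambda>j. v j t) ` {k..}))"
    "\<And>S. S \<in> \<S> \<Longrightarrow> (\<integral>t\<in>S. u t \<partial>M) = z S"
proof -
  define A where "A k t = closure (convex hull ((\<lambda>j. v j t) ` {k..}))" for k t
  define Z where "Z k S = closure (convex hull ((\<lambda>j. \<integral>t\<in>S. v j t \<partial>M) ` {k..}))" for k S
  have A: "closed (A k t)" "convex (A k t)" "j \<ge> k \<Longrightarrow> v j t \<in> A k t" for j k t
    unfolding A_def by (auto simp: convex_closure intro!: subsetD[OF closure_subset] subsetD[OF hull_subset])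
  have Z: "closed (Z k S)" "convex (Z k S)" "j \<ge> k \<Longrightarrow> (\<integral>t\<in>S. v j t \<partial>M) \<in> Z k S" for j k S
    unfolding Z_def by (auto simp: convex_closure intro!: subsetD[OF closure_subset] subsetD[OF hull_subset])
  have A_anti: "A j t \<subseteq> A k t" if "k \<le> j" for j k t
    unfolding A_def using that by (intro closure_mono hull_mono image_mono) auto
  have Z_anti: "Z j S \<subseteq> Z k S" if "k \<le> j" for j k S
    unfolding Z_def using that by (intro closure_mono hull_mono image_mono) auto
  define C where "C k = {u. u \<in> borel_measurable M \<and> (AE t in M. norm (u t) \<le> m t) \<and>
      (AE t in M. u t \<in> A k t) \<and> (\<forall>S\<in>\<S>. (\<integral>t\<in>S. u t \<partial>M) \<in> Z k S)}" for k
  have Cv: "v k \<in> C k" for k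
    unfolding C_def using v A(3) Z(3) by auto
  have C_anti: "C j \<subseteq> C k" if "k \<le> j" for j k
  proof
    fix u assume "u \<in> C j"
    then have u: "u \<in> borel_measurable M" "AE t in M. norm (u t) \<le> m t" "AE t in M. u t \<in> A j t"
      "\<forall>S\<in>\<S>. (\<integral>t\<in>S. u t \<partial>M) \<in> Z j S" by (auto simp: C_def)
    from u(3) have "AE t in M. u t \<in> A k t"
      by eventually_elim (use A_anti[OF that] in blast)
    with u show "u \<in> C k" unfolding C_def using Z_anti[OF that] by blast
  qed
  have int: "integrable M u" if "u \<in> C k" for u k
    using that m(1) unfolding C_def
    by (auto intro!: Bochner_Integration.integrable_bound[OF m(1)] elim!: eventually_mono)
  have setint: "set_integrable M S u" if "u \<in> C k" "S \<in> \<S>" for u k S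
    unfolding set_integrable_def using int[OF that(1)] S(1)[OF that(2)] by (intro integrable_mult_indicator)
  have C_half: "(\<lambda>t. (1/2) *\<^sub>R (u t + w t)) \<in> C k" if u: "u \<in> C k" and w: "w \<in> C k" for u w k
  proof -
    have "AE t in M. norm ((1/2) *\<^sub>R (u t + w t)) \<le> m t"
    proof -
      have "AE t in M. norm (u t) \<le> m t" "AE t in M. norm (w t) \<le> m t" using u w by (auto simp: C_def)
      then show ?thesis
      proof eventually_elim
        case (elim t)
        then show ?case using norm_triangle_ineq[of "u t" "w t"] by simp
      qed
    qed
    moreover have "AE t in M. (1/2) *\<^sub>R (u t + w t) \<in> A k t"
    proof -
      have "AE t in M. u t \<in> A k t" "AE t in M. w t \<in> A k t" using u w by (auto simp: C_def)
      then show ?thesis by eventually_elim (rule convex_half_sum[OF A(2)])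
    qed
    moreover have "(\<integral>t\<in>S. (1/2) *\<^sub>R (u t + w t) \<partial>M) \<in> Z k S" if "S \<in> \<S>" for S
    proof -
      have "(\<integral>t\<in>S. (1/2) *\<^sub>R (u t + w t) \<partial>M) = (1/2) *\<^sub>R ((\<integral>t\<in>S. u t \<partial>M) + (\<integral>t\<in>S. w t \<partial>M))"
        using set_integral_add[OF setint[OF u that] setint[OF w that]] by simp
      also have "\<dots> \<in> Z k S"
        using u w that by (intro convex_half_sum Z(2)) (auto simp: C_def)
      finally show ?thesis .
    qed
    ultimately show ?thesis using u w unfolding C_def by auto
  qed
  define q where "q u t = (norm (u t))\<^sup>2 / m t" for u :: "'s \<Rightarrow> 'b" and t
  define J where "J u = (\<integral>t. q u t \<partial>M)" for u
  have q_int: "integrable M (q u)" if "u \<in> borel_measurable M" "AE t in M. norm (u t) \<le> c * m t" "c \<ge> 0" for u c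
  proof (rule Bochner_Integration.integrable_bound[OF integrable_mult_right[OF m(1), of "c\<^sup>2"]])
    show "q u \<in> borel_measurable M"
      unfolding q_def using that(1) m(1) by measurable
    show "AE t in M. norm (q u t) \<le> norm (c\<^sup>2 * m t)"
      using that(2)
    proof eventually_elim
      case (elim t)
      have "(norm (u t))\<^sup>2 \<le> (c * m t)\<^sup>2"
        using elim by (intro power_mono) auto
      also have "\<dots> = c\<^sup>2 * m t * m t"
        by (simp add: power_mult_distrib power2_eq_square)
      finally have "q u t \<le> c\<^sup>2 * m t"
        using m(2)[of t] by (simp add: q_def pos_divide_le_eq)
      moreover have "0 \<le> q u t" using m(2)[of t] by (simp add: q_def)
      ultimately show ?case by (metis abs_ge_self abs_of_nonneg order_trans real_norm_def)
    qed
  qed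
  have q_int_C: "integrable M (q u)" if "u \<in> C k" for u k
    using q_int[of u 1] that by (auto simp: C_def)
  have q_nn: "0 \<le> q u t" for u t
    unfolding q_def using m(2)[of t] by simp
  have J_nn: "0 \<le> J u" for u
    unfolding J_def using q_nn by (intro Bochner_Integration.integral_nonneg) auto
  have J_le: "J u \<le> integral\<^sup>L M m" if "u \<in> C k" for u k
    unfolding J_def
  proof (rule integral_mono_AE[OF q_int_C[OF that] m(1)])
    have "AE t in M. norm (u t) \<le> m t" using that by (simp add: C_def)
    then show "AE t in M. q u t \<le> m t"
    proof eventually_elim
      case (elim t)
      then have "(norm (u t))\<^sup>2 \<le> (m t)\<^sup>2" by (intro power_mono) auto
      then show ?case using m(2)[of t] by (simp add: q_def pos_divide_le_eq power2_eq_square)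
    qed
  qed
  define I where "I k = Inf (J ` C k)" for k
  have bdd: "bdd_below (J ` C k)" for k
    using J_nn by (intro bdd_belowI[of _ 0]) auto
  have I_le: "I k \<le> J u" if "u \<in> C k" for u k
    unfolding I_def by (rule cInf_lower) (use that bdd in auto)
  have I_mono: "I k \<le> I j" if "k \<le> j" for j k
    unfolding I_def[of j]
  proof (rule cInf_greatest)
    show "J ` C j \<noteq> {}" using Cv[of j] by blast
  qed (use C_anti[OF that] I_le in auto)
  have I_bd: "I k \<le> integral\<^sup>L M m" for k
    using I_le[OF Cv] J_le[OF Cv] by (rule order_trans)
  obtain L where L: "I \<longlonglongrightarrow> L" "\<And>k. I k \<le> L"
    using incseq_convergent[of I "integral\<^sup>L M m"] I_mono I_bd by (auto simp: incseq_def)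
  have "\<exists>u\<in>C k. J u < I k + 1 / real (Suc k)" for k
  proof -
    have "Inf (J ` C k) < I k + 1 / real (Suc k)" by (simp add: I_def)
    then show ?thesis using cInf_lessD[of "J ` C k"] Cv by blast
  qed
  then obtain w where w: "\<And>k. w k \<in> C k" "\<And>k. J (w k) < I k + 1 / real (Suc k)" by metis
  have w_meas: "w k \<in> borel_measurable M" for k using w(1)[of k] by (simp add: C_def)
  \<comment> \<open>The parallelogram law bounds the energy of the difference of two near-minimizers by \<open>\<rho> k\<close>.\<close>
  define \<rho> where "\<rho> k = 2 * (L - I k) + 4 / real (Suc k)" for k
  have para: "J (\<lambda>t. w k t - w j t) \<le> \<rho> k" if "k \<le> j" for j k
  proof -
    have wj: "w j \<in> C k" using w(1) C_anti[OF that] by blast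
    let ?h = "\<lambda>t. (1/2) *\<^sub>R (w k t + w j t)"
    have qq: "q (\<lambda>t. w k t - w j t) t = 2 * q (w k) t + 2 * q (w j) t - 4 * q ?h t" for t
    proof -
      have "(norm (w k t - w j t))\<^sup>2 = 2 * (norm (w k t))\<^sup>2 + 2 * (norm (w j t))\<^sup>2 - (norm (w k t + w j t))\<^sup>2"
        by (simp add: power2_norm_eq_inner algebra_simps inner_commute)
      moreover have "(norm (w k t + w j t))\<^sup>2 = 4 * (norm (?h t))\<^sup>2"
        by (simp add: power_mult_distrib power2_eq_square)
      ultimately show ?thesis by (simp add: q_def diff_divide_distrib add_divide_distrib)
    qed
    have "J (\<lambda>t. w k t - w j t) = 2 * J (w k) + 2 * J (w j) - 4 * J ?h"
      unfolding J_def qq using q_int_C[OF w(1)[of k]] q_int_C[OF wj] q_int_C[OF C_half[OF w(1) wj]] by simp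
    also have "\<dots> \<le> 2 * (I k + 1 / real (Suc k)) + 2 * (L + 1 / real (Suc j)) - 4 * I k"
    proof -
      have "2 * x + 2 * y - 4 * h \<le> 2 * (ik + e) + 2 * (l + e') - 4 * ik"
        if "x < ik + e" "y < ij + e'" "ij \<le> l" "ik \<le> h" for x y h ik ij l e e' :: real
        using that by (simp add: algebra_simps)
      then show ?thesis using w(2)[of k] w(2)[of j] L(2)[of j] I_le[OF C_half[OF w(1) wj]] by blast
    qed
    also have "\<dots> \<le> \<rho> k"
    proof -
      have "1 / real (Suc j) \<le> 1 / real (Suc k)" using that by (intro divide_left_mono) auto
      then show ?thesis unfolding \<rho>_def by (simp add: algebra_simps)
    qed
    finally show ?thesis .
  qed
  have "\<rho> \<longlonglongrightarrow> 2 * (L - L) + 4 * 0"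
    unfolding \<rho>_def divide_inverse by (intro tendsto_intros L LIMSEQ_inverse_real_of_nat)
  then have \<rho>0: "\<rho> \<longlonglongrightarrow> 0" by simp
  have "\<exists>k. \<forall>i\<ge>k. \<rho> i < (1/8) ^ n" for n
    using order_tendstoD(2)[OF \<rho>0, of "(1/8)^n"] by (auto simp: eventually_sequentially)
  then obtain K where K: "\<And>n i. i \<ge> K n \<Longrightarrow> \<rho> i < (1/8) ^ n" by metis
  \<comment> \<open>A nondecreasing choice of indices beyond both \<open>K n\<close> and \<open>n\<close>.\<close>
  define r where "r n = n + (\<Sum>i\<le>n. K i)" for n
  have r: "K n \<le> r n" "n \<le> r n" "r n \<le> r (Suc n)" for n
    unfolding r_def by (auto intro!: trans_le_add2 member_le_sum)
  define D where "D n t = w (r n) t - w (r (Suc n)) t" for n t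
  \<comment> \<open>\<open>s n\<close> dominates the norm of \<open>D n\<close> by the inequality of arithmetic and geometric means, and its
    integral is summable since the energy of \<open>D n\<close> is at most \<open>(1/8)^n\<close>.\<close>
  define s where "s n t = (1/2)^n * m t + 2^n * q (D n) t" for n t
  have JD: "J (D n) \<le> (1/8)^n" for n
    using para[OF r(3)[of n]] K[OF r(1)[of n]] by (simp add: D_def[abs_def])
  have D_meas: "D n \<in> borel_measurable M" for n
    unfolding D_def[abs_def] by (intro borel_measurable_diff w_meas)
  have qD: "integrable M (q (D n))" for n
  proof (rule q_int[OF D_meas, of _ 2])
    have "AE t in M. norm (w (r n) t) \<le> m t" "AE t in M. norm (w (r (Suc n)) t) \<le> m t"
      using w(1) by (auto simp: C_def)
    then show "AE t in M. norm (D n t) \<le> 2 * m t"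
    proof eventually_elim
      case (elim t)
      then show ?case
        using norm_triangle_ineq4[of "w (r n) t" "w (r (Suc n)) t"] by (simp add: D_def)
    qed
  qed simp
  have s_int: "integrable M (s n)" for n
    unfolding s_def[abs_def] using m(1) qD by auto
  have Ds: "norm (D n t) \<le> s n t" for n t
  proof -
    have "0 \<le> ((1/2)^n * m t - norm (D n t))\<^sup>2" by simp
    also have "\<dots> = ((1/2)^n * m t)\<^sup>2 - 2 * norm (D n t) * ((1/2)^n * m t) + (norm (D n t))\<^sup>2"
      by (simp add: power2_diff)
    also have "\<dots> \<le> ((1/2)^n * m t)\<^sup>2 - norm (D n t) * ((1/2)^n * m t) + (norm (D n t))\<^sup>2"
      using m(2)[of t] by simp
    finally have "norm (D n t) * ((1/2)^n * m t) \<le> ((1/2)^n * m t)\<^sup>2 + (norm (D n t))\<^sup>2" by simp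
    also have "\<dots> = s n t * ((1/2)^n * m t)"
      using m(2)[of t] by (simp add: s_def q_def field_simps power2_eq_square)
    finally show ?thesis
      using m(2)[of t] by simp
  qed
  have "AE t in M. summable (\<lambda>n. s n t)"
  proof (rule summable_AE_if_integrals_summable[OF s_int])
    show "AE t in M. 0 \<le> s n t" for n
      using order_trans[OF norm_ge_zero Ds] by simp
    have eq: "integral\<^sup>L M (s n) = (1/2)^n * integral\<^sup>L M m + 2^n * J (D n)" for n
      unfolding s_def[abs_def] J_def using m(1) qD by simp
    show "summable (\<lambda>n. integral\<^sup>L M (s n))"
    proof (rule summable_comparison_test')
      show "summable (\<lambda>n. (1/2)^n * integral\<^sup>L M m + (1/4::real)^n)"
        by (intro summable_add summable_mult2 summable_geometric) auto
      fix n :: nat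
      have "2^n * J (D n) \<le> 2^n * (1/8)^n" using JD by (intro mult_left_mono) auto
      also have "\<dots> = (1/4)^n" by (simp flip: power_mult_distrib)
      finally show "norm (integral\<^sup>L M (s n)) \<le> (1/2)^n * integral\<^sup>L M m + (1/4::real)^n"
        unfolding eq using J_nn[of "D n"] I_bd[of 0] J_nn[of "w 0"] J_le[OF w(1), of 0] by simp
    qed
  qed
  then have conv: "AE t in M. convergent (\<lambda>n. w (r n) t)"
  proof eventually_elim
    case (elim t)
    then have "summable (\<lambda>n. D n t)"
      by (rule summable_comparison_test'[where N = 0]) (use Ds in auto)
    then have "convergent (\<lambda>n. \<Sum>i<n. D i t)" by (simp add: summable_iff_convergent)
    moreover have "(\<Sum>i<n. D i t) = w (r 0) t - w (r n) t" for n
      by (induction n) (auto simp: D_def)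
    ultimately have "convergent (\<lambda>n. w (r 0) t - w (r n) t)" by simp
    then obtain l where "(\<lambda>n. w (r 0) t - w (r n) t) \<longlonglongrightarrow> l"
      by (auto simp: convergent_def)
    then have "(\<lambda>n. w (r 0) t - (w (r 0) t - w (r n) t)) \<longlonglongrightarrow> w (r 0) t - l"
      by (intro tendsto_diff tendsto_const)
    then show ?case by (auto simp: convergent_def)
  qed
  define u where "u t = lim (\<lambda>n. w (r n) t)" for t
  have u_meas: "u \<in> borel_measurable M"
    unfolding u_def[abs_def] by (rule borel_measurable_lim_metric[OF w_meas])
  have lim: "AE t in M. (\<lambda>n. w (r n) t) \<longlonglongrightarrow> u t"
    using conv by eventually_elim (simp add: u_def convergent_LIMSEQ_iff)
  have w_bd: "AE t in M. \<forall>n. norm (w (r n) t) \<le> m t"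
    using w(1) by (auto simp: C_def AE_all_countable)
  have u_bd: "AE t in M. norm (u t) \<le> m t"
    using lim w_bd
  proof eventually_elim
    case (elim t)
    show ?case by (rule Lim_bounded[OF tendsto_norm[OF elim(1)]]) (use elim(2) in auto)
  qed
  have wA: "AE t in M. \<forall>k. w k t \<in> A k t"
    using w(1) by (auto simp: C_def AE_all_countable)
  have uA: "AE t in M. \<forall>k. u t \<in> A k t"
    using lim wA
  proof eventually_elim
    case (elim t)
    show ?case
    proof
      fix k
      have ev: "\<forall>n\<ge>k. w (r n) t \<in> A k t"
        using elim(2) A_anti r(2) by (meson le_trans subsetD)
      show "u t \<in> A k t"
        by (rule Lim_in_closed_set[OF A(1) _ sequentially_bot elim(1)])
           (use ev eventually_sequentially in auto)
    qed
  qed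
  have uZ: "(\<integral>t\<in>S. u t \<partial>M) = z S" if "S \<in> \<S>" for S
  proof -
    have lim_S: "(\<lambda>n. \<integral>t\<in>S. w (r n) t \<partial>M) \<longlonglongrightarrow> (\<integral>t\<in>S. u t \<partial>M)"
      unfolding set_lebesgue_integral_def
    proof (rule integral_dominated_convergence[where w = m])
      show "AE t in M. (\<lambda>n. indicat_real S t *\<^sub>R w (r n) t) \<longlonglongrightarrow> indicat_real S t *\<^sub>R u t"
        using lim by eventually_elim (intro tendsto_intros)
      show "AE t in M. norm (indicat_real S t *\<^sub>R w (r n) t) \<le> m t" for n
        using w_bd by eventually_elim (auto simp: indicator_def intro: less_imp_le m(2))
    qed (use u_meas w_meas S(1)[OF that] m(1) in auto)
    have inZ: "(\<integral>t\<in>S. u t \<partial>M) \<in> Z k S" for k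
    proof -
      have ev: "\<forall>n\<ge>k. (\<integral>t\<in>S. w (r n) t \<partial>M) \<in> Z k S"
        using w(1) that Z_anti r(2) unfolding C_def by (smt (verit) le_trans mem_Collect_eq subsetD)
      show ?thesis
        by (rule Lim_in_closed_set[OF Z(1) _ sequentially_bot lim_S])
           (use ev eventually_sequentially in auto)
    qed
    have "dist (\<integral>t\<in>S. u t \<partial>M) (z S) \<le> 0 + e" if "e > 0" for e
    proof -
      from LIMSEQ_D[OF S(2)[OF \<open>S \<in> \<S>\<close>] that] obtain k where
        k: "\<And>j. j \<ge> k \<Longrightarrow> norm ((\<integral>t\<in>S. v j t \<partial>M) - z S) < e" by blast
      have "convex hull ((\<lambda>j. \<integral>t\<in>S. v j t \<partial>M) ` {k..}) \<subseteq> cball (z S) e"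
        by (rule hull_minimal) (use less_imp_le[OF k] in \<open>auto simp: dist_norm norm_minus_commute\<close>)
      then have "Z k S \<subseteq> cball (z S) e"
        unfolding Z_def by (rule closure_minimal) simp
      with inZ[of k] show ?thesis by (auto simp: dist_commute)
    qed
    then have "dist (\<integral>t\<in>S. u t \<partial>M) (z S) \<le> 0" by (rule field_le_epsilon)
    then show ?thesis by simp
  qed
  from that[OF u_meas u_bd uA[unfolded A_def] uZ] show thesis .
qed

section \<open>One-sided Lipschitz maps and Filippov regularization\<close>

definition one_sided_Lipschitz_on :: "real \<Rightarrow> 'a::real_inner set \<Rightarrow> ('a \<Rightarrow> 'a) \<Rightarrow> bool" where
  "one_sided_Lipschitz_on L X g \<longleftrightarrow> (\<forall>x\<in>X. \<forall>y\<in>X. (x - y) \<bullet> (g x - g y) \<le> L * (norm (x - y))\<^sup>2)"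

text \<open>For \<open>g y \<noteq> 0\<close> compare \<open>y\<close> with a point \<open>z\<close> close to \<open>y - u\<close>, where \<open>u\<close> has length \<open>1/2\<close> and the direction of \<open>g y\<close>.
The one-sided condition at \<open>y\<close> and \<open>z\<close> bounds the component of \<open>g y\<close> along \<open>y - z\<close>, which is comparable to
its norm, by \<open>L\<close> and the norm of \<open>g z\<close>. A ball around \<open>y - u\<close> has positive measure, so \<open>z\<close> can be taken
where the almost-everywhere bound holds.\<close>

lemma one_sided_Lipschitz_on_bound:
  fixes g :: "'a::euclidean_space \<Rightarrow> 'a"
  assumes osl: "one_sided_Lipschitz_on L (cball 0 (r + 1)) g" and "L \<ge> 0"
    and bd: "AE x in lebesgue. x \<in> ball 0 (r + 1) \<longrightarrow> norm (g x) \<le> m"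
    and y: "y \<in> cball 0 r"
  shows "norm (g y) \<le> 4 * (L + m)"
proof -
  obtain N where N: "N \<in> null_sets lebesgue" "\<And>x. x \<in> ball 0 (r + 1) \<Longrightarrow> x \<notin> N \<Longrightarrow> norm (g x) \<le> m"
    using bd by (auto elim!: AE_E3)
  define u where "u = (1/2) *\<^sub>R sgn (g y)"
  have nu: "norm u \<le> 1/2" by (simp add: u_def norm_sgn)
  have "\<exists>z\<in>ball (y - u) (1/4). z \<notin> N"
  proof (rule ccontr)
    assume "\<not> ?thesis"
    then have "negligible (ball (y - u) (1/4))"
      using N(1) by (meson negligible_iff_null_sets negligible_subset subsetI)
    then show False
      using open_not_negligible[of "ball (y - u) (1/4)"] by simp
  qed
  then obtain z where z: "z \<in> ball (y - u) (1/4)" "z \<notin> N" by blast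
  define w where "w = y - z"
  have wu: "norm (w - u) \<le> 1/4"
    using z(1) by (simp add: w_def dist_norm algebra_simps)
  have nw: "norm w \<le> 3/4"
    using norm_triangle_ineq[of "w - u" u] wu nu by simp
  have "norm z \<le> r + 3/4"
    using norm_triangle_ineq4[of y w] nw y by (simp add: w_def)
  then have zz: "z \<in> ball 0 (r + 1)" "z \<in> cball 0 (r + 1)" "y \<in> cball 0 (r + 1)" using y by auto
  have gz: "norm (g z) \<le> m" using N(2) zz z by blast
  then have "m \<ge> 0" using norm_ge_zero order_trans by blast
  have "norm (g y) / 2 = u \<bullet> g y"
    by (cases "g y = 0") (auto simp: u_def sgn_div_norm power2_norm_eq_inner[symmetric] power2_eq_square)
  also have "\<dots> = w \<bullet> (g y - g z) + w \<bullet> g z - (w - u) \<bullet> g y"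
    by (simp add: algebra_simps)
  also have "\<dots> \<le> L * (norm w)\<^sup>2 + norm w * norm (g z) + norm (w - u) * norm (g y)"
    using osl[unfolded one_sided_Lipschitz_on_def, rule_format, OF zz(3,2)]
      norm_cauchy_schwarz[of w "g z"] norm_cauchy_schwarz[of "-(w - u)" "g y"]
    unfolding w_def by (simp add: algebra_simps norm_minus_commute)
  also have "\<dots> \<le> L * 1 + 1 * m + 1/4 * norm (g y)"
    using nw wu gz \<open>L \<ge> 0\<close> \<open>m \<ge> 0\<close> by (intro add_mono mult_mono power_le_one) auto
  finally show ?thesis by simp
qed

lemma closure_convex_hull_induct:
  assumes "v \<in> closure (convex hull S)" "S \<subseteq> C" "closed C" "convex C"
  shows "v \<in> C"
proof -
  have "convex hull S \<subseteq> C" using assms(2,4) by (rule hull_minimal)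
  then have "closure (convex hull S) \<subseteq> C" using assms(3) by (rule closure_minimal)
  then show ?thesis using assms(1) by (rule subsetD)
qed

text \<open>Replacing the points at which \<open>g\<close> is evaluated by the centres \<open>p\<close> and \<open>q\<close> costs at most the radii times the bound
of \<open>g\<close>. The resulting inequality is affine in each of the two values, so it passes to closed convex hulls.\<close>

lemma one_sided_Lipschitz_hull:
  fixes g :: "'a::euclidean_space \<Rightarrow> 'a"
  assumes osl: "one_sided_Lipschitz_on L X g" and "L \<ge> 0"
    and bd: "\<And>y. y \<in> X \<Longrightarrow> norm (g y) \<le> B"
    and sub: "ball p \<delta> \<subseteq> X" "ball q \<delta>' \<subseteq> X" and "\<delta> > 0" "\<delta>' > 0"
    and v: "v \<in> closure (convex hull (g ` ball p \<delta>))" and w: "w \<in> closure (convex hull (g ` ball q \<delta>'))"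
  shows "(p - q) \<bullet> (v - w) \<le> L * (norm (p - q) + (\<delta> + \<delta>'))\<^sup>2 + 2 * B * (\<delta> + \<delta>')"
proof -
  let ?R = "L * (norm (p - q) + (\<delta> + \<delta>'))\<^sup>2 + 2 * B * (\<delta> + \<delta>')"
  have base: "(p - q) \<bullet> (g y - g z) \<le> ?R" if "y \<in> ball p \<delta>" "z \<in> ball q \<delta>'" for y z
  proof -
    have yz: "y \<in> X" "z \<in> X" using that sub by auto
    have n1: "norm ((p - q) - (y - z)) \<le> \<delta> + \<delta>'"
    proof -
      have eq: "(p - q) - (y - z) = (p - y) - (q - z)" by simp
      have "norm (p - y) < \<delta>" "norm (q - z) < \<delta>'" using that by (auto simp: dist_norm)
      then show ?thesis unfolding eq using norm_triangle_ineq4[of "p - y" "q - z"] by linarith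
    qed
    have n2: "norm (y - z) \<le> norm (p - q) + (\<delta> + \<delta>')"
      using norm_triangle_ineq4[of "p - q" "(p - q) - (y - z)"] n1 by simp
    have 1: "(p - q) \<bullet> (g y - g z) = (y - z) \<bullet> (g y - g z) + ((p - q) - (y - z)) \<bullet> (g y - g z)"
      by (simp add: inner_diff_left)
    have 2: "(y - z) \<bullet> (g y - g z) \<le> L * (norm (p - q) + (\<delta> + \<delta>'))\<^sup>2"
    proof -
      have "(y - z) \<bullet> (g y - g z) \<le> L * (norm (y - z))\<^sup>2"
        using osl yz unfolding one_sided_Lipschitz_on_def by blast
      also have "\<dots> \<le> L * (norm (p - q) + (\<delta> + \<delta>'))\<^sup>2"
        by (rule mult_left_mono[OF power_mono[OF n2 norm_ge_zero] \<open>L \<ge> 0\<close>])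
      finally show ?thesis .
    qed
    have 3: "((p - q) - (y - z)) \<bullet> (g y - g z) \<le> (\<delta> + \<delta>') * (2 * B)"
    proof -
      have "norm (g y - g z) \<le> 2 * B"
        using norm_triangle_ineq4[of "g y" "g z"] bd[OF yz(1)] bd[OF yz(2)] by linarith
      with n1 have "norm ((p - q) - (y - z)) * norm (g y - g z) \<le> (\<delta> + \<delta>') * (2 * B)"
        by (rule mult_mono) (use \<open>\<delta> > 0\<close> \<open>\<delta>' > 0\<close> in auto)
      then show ?thesis using norm_cauchy_schwarz order_trans by blast
    qed
    have "2 * B * (\<delta> + \<delta>') = (\<delta> + \<delta>') * (2 * B)" by (simp add: mult.commute)
    with 1 2 3 show ?thesis by linarith
  qed
  have conv1: "closed {v. (p - q) \<bullet> (v - c) \<le> ?R} \<and> convex {v. (p - q) \<bullet> (v - c) \<le> ?R}" for c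
  proof -
    have "{v. (p - q) \<bullet> (v - c) \<le> ?R} = {v. (p - q) \<bullet> v \<le> ?R + (p - q) \<bullet> c}"
      by (auto simp: inner_diff_right)
    then show ?thesis by (simp add: closed_halfspace_le convex_halfspace_le)
  qed
  have conv2: "closed {w. (p - q) \<bullet> (c - w) \<le> ?R} \<and> convex {w. (p - q) \<bullet> (c - w) \<le> ?R}" for c
  proof -
    have "{w. (p - q) \<bullet> (c - w) \<le> ?R} = {w. (p - q) \<bullet> w \<ge> (p - q) \<bullet> c - ?R}"
      by (auto simp: inner_diff_right)
    then show ?thesis by (simp add: closed_halfspace_ge convex_halfspace_ge)
  qed
  have vz: "(p - q) \<bullet> (v - g z) \<le> ?R" if z: "z \<in> ball q \<delta>'" for z
  proof -
    have "g ` ball p \<delta> \<subseteq> {v. (p - q) \<bullet> (v - g z) \<le> ?R}"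
      using base[OF _ z] by (simp add: image_subset_iff)
    with closure_convex_hull_induct[OF v] conv1[of "g z"]
    have "v \<in> {v. (p - q) \<bullet> (v - g z) \<le> ?R}" by metis
    then show ?thesis by simp
  qed
  have "g ` ball q \<delta>' \<subseteq> {w. (p - q) \<bullet> (v - w) \<le> ?R}"
    using vz by (simp add: image_subset_iff)
  with closure_convex_hull_induct[OF w] conv2[of v]
  have "w \<in> {w. (p - q) \<bullet> (v - w) \<le> ?R}" by metis
  then show ?thesis by simp
qed

lemma Filippov_reg_subset:
  fixes g :: "real \<times> (real^'b) \<Rightarrow> real^'b"
  assumes "\<delta> > 0" "M \<in> null_sets lebesgue"
  shows "Filippov_reg g t x \<subseteq> closure (convex hull ((\<lambda>y. g (t, y)) ` (ball x \<delta> - M)))"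
proof
  fix v assume "v \<in> Filippov_reg g t x"
  then have "\<forall>\<delta>\<in>{0<..}. \<forall>M\<in>null_sets lebesgue. v \<in> closure (convex hull ((\<lambda>y. g (t, y)) ` (ball x \<delta> - M)))"
    unfolding Filippov_reg_def by (simp only: INT_iff)
  with assms show "v \<in> closure (convex hull ((\<lambda>y. g (t, y)) ` (ball x \<delta> - M)))"
    by (simp only: greaterThan_iff Ball_def)
qed

text \<open>The regularization inherits the constant \<open>L\<close>: the hull estimate holds for every radius, and its error
vanishes with the radius because \<open>g (t, _)\<close> is bounded near \<open>x\<close> and \<open>y\<close>.\<close>

lemma Filippov_reg_one_sided_Lipschitz:
  assumes osl: "one_sided_Lipschitz_on L (cball 0 r) (\<lambda>y. g (t, y))" and "L \<ge> 0"
    and bd: "\<And>y. y \<in> cball 0 r \<Longrightarrow> norm (g (t, y)) \<le> B"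
    and x: "x \<in> ball 0 r" and y: "y \<in> ball 0 r"
    and v: "v \<in> Filippov_reg g t x" and w: "w \<in> Filippov_reg g t y"
  shows "(x - y) \<bullet> (v - w) \<le> L * (norm (x - y))\<^sup>2"
proof -
  define d where "d n = inverse (real (Suc n))" for n
  have dpos: "d n > 0" for n by (simp add: d_def)
  have d0: "d \<longlonglongrightarrow> 0" unfolding d_def by (rule LIMSEQ_inverse_real_of_nat)
  from openE[OF open_ball x] obtain rx where rx: "rx > 0" "ball x rx \<subseteq> ball 0 r" by blast
  from openE[OF open_ball y] obtain ry where ry: "ry > 0" "ball y ry \<subseteq> ball 0 r" by blast
  have "\<forall>\<^sub>F n in sequentially. d n < min rx ry"
    by (rule order_tendstoD(2)[OF d0]) (use rx ry in simp)
  then have ev: "\<forall>\<^sub>F n in sequentially. (x - y) \<bullet> (v - w) \<le> L * (norm (x - y) + (d n + d n))\<^sup>2 + 2 * B * (d n + d n)"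
  proof eventually_elim
    case (elim n)
    have "ball x (d n) \<subseteq> cball 0 r" "ball y (d n) \<subseteq> cball 0 r"
      using elim rx ry ball_subset_cball subset_ball[of "d n" rx x] subset_ball[of "d n" ry y]
      by (meson dual_order.trans less_imp_le min_less_iff_conj)+
    moreover have "v \<in> closure (convex hull ((\<lambda>y. g (t, y)) ` ball x (d n)))"
      using Filippov_reg_subset[OF dpos[of n], of "{}" g t x] v by auto
    moreover have "w \<in> closure (convex hull ((\<lambda>y. g (t, y)) ` ball y (d n)))"
      using Filippov_reg_subset[OF dpos[of n], of "{}" g t y] w by auto
    ultimately show ?case
      using one_sided_Lipschitz_hull[OF osl \<open>L \<ge> 0\<close> bd] dpos[of n] by metis
  qed
  have lim: "(\<lambda>n. L * (norm (x - y) + (d n + d n))\<^sup>2 + 2 * B * (d n + d n)) \<longlonglongrightarrow> 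
      L * (norm (x - y) + (0 + 0))\<^sup>2 + 2 * B * (0 + 0)"
    by (intro tendsto_intros d0)
  from tendsto_lowerbound[OF lim ev] show ?thesis by simp
qed

text \<open>Continuity squeezes the hulls to the value at \<open>x\<close>. Conversely that value survives the removal of a null
set, because the complement of a null set is dense.\<close>

lemma Filippov_reg_continuous:
  fixes g :: "real \<times> (real^'b) \<Rightarrow> real^'b"
  assumes cont: "isCont (\<lambda>y. g (t, y)) x"
  shows "Filippov_reg g t x = {g (t, x)}"
proof -
  have near: "\<exists>d>0. \<forall>y. norm (y - x) < d \<longrightarrow> norm (g (t, y) - g (t, x)) < e" if "e > 0" for e
  proof -
    have e: "e > 0" by (rule that)
    have 1: "(\<lambda>y. g (t, y)) \<midarrow>x\<rightarrow> g (t, x)" using isContD[OF cont] .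
    have 2: "\<exists>s>0. \<forall>y. y \<noteq> x \<and> norm (y - x) < s \<longrightarrow> norm (g (t, y) - g (t, x)) < e"
      using LIM_D[OF 1 e] .
    then obtain d where d:
        "d > 0" "\<forall>y. y \<noteq> x \<and> norm (y - x) < d \<longrightarrow> norm (g (t, y) - g (t, x)) < e" by (elim exE conjE)
    have 3: "norm (g (t, x) - g (t, x)) < e" using e by simp
    have "norm (g (t, y) - g (t, x)) < e" if "norm (y - x) < d" for y
      by (cases "y = x") (use d 3 that in blast)+
    with d(1) show ?thesis by blast
  qed
  show ?thesis
  proof (intro equalityI subsetI)
    fix v assume v: "v \<in> Filippov_reg g t x"
    have "norm (v - g (t, x)) \<le> 0 + e" if "e > 0" for e
    proof -
      from cont that obtain d where d: "d > 0" "\<And>y. norm (y - x) < d \<Longrightarrow> norm (g (t, y) - g (t, x)) < e"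
        using near by blast
      have "v \<in> cball (g (t, x)) e"
      proof (rule closure_convex_hull_induct)
        show "v \<in> closure (convex hull ((\<lambda>y. g (t, y)) ` (ball x d - {})))"
          using Filippov_reg_subset[OF d(1), of "{}"] v by auto
        show "(\<lambda>y. g (t, y)) ` (ball x d - {}) \<subseteq> cball (g (t, x)) e"
          using less_imp_le[OF d(2)] by (auto simp: dist_norm norm_minus_commute)
      qed auto
      then show ?thesis by (simp add: dist_norm norm_minus_commute)
    qed
    then have "norm (v - g (t, x)) \<le> 0" by (rule field_le_epsilon)
    then show "v \<in> {g (t, x)}" by simp
  next
    fix v assume v: "v \<in> {g (t, x)}"
    show "v \<in> Filippov_reg g t x"
      unfolding Filippov_reg_def
    proof (intro INT_I)
      fix d and M :: "(real^'b) set" assume d: "d \<in> {0::real<..}" and M: "M \<in> null_sets lebesgue"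
      have "g (t, x) \<in> closure ((\<lambda>y. g (t, y)) ` (ball x d - M))"
        unfolding closure_approachable
      proof (intro allI impI)
        fix e :: real assume "e > 0"
        with cont obtain d' where d': "d' > 0" "\<And>y. norm (y - x) < d' \<Longrightarrow> norm (g (t, y) - g (t, x)) < e"
          using near by blast
        have "\<exists>y\<in>ball x (min d d'). y \<notin> M"
        proof (rule ccontr)
          assume "\<not> ?thesis"
          then have "negligible (ball x (min d d'))"
            using M by (meson negligible_iff_null_sets negligible_subset subsetI)
          then show False
            using open_not_negligible[of "ball x (min d d')"] d d'(1) by (simp add: min_def split: if_splits)
        qed
        then obtain y where y: "y \<in> ball x (min d d')" "y \<notin> M" by blast
        with d'(2)[of y] show "\<exists>z\<in>(\<lambda>y. g (t, y)) ` (ball x d - M). dist z (g (t, x)) < e"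
          by (auto simp: dist_norm norm_minus_commute)
      qed
      then show "v \<in> closure (convex hull ((\<lambda>y. g (t, y)) ` (ball x d - M)))"
        using v subsetD[OF closure_mono[OF hull_subset]] by (metis singletonD)
    qed
  qed
qed

section \<open>Borel versions and ball averages\<close>

text \<open>Sections and compositions of a Lebesgue measurable function need not be measurable, but those of a Borel
function are. Measurability is therefore always derived from a Borel version.\<close>

lemma lebesgue_measurable_ex_borel:
  fixes f :: "'a::euclidean_space \<Rightarrow> 'b::euclidean_space"
  assumes "f \<in> borel_measurable lebesgue"
  obtains g where "g \<in> borel_measurable borel" "AE x in lborel. f x = g x"
proof -
  have "\<exists>h\<in>borel_measurable lborel. AE x in lborel. f x \<bullet> b = h x" for b
    by (rule completion_ex_borel_measurable_real) (use assms in measurable)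
  then obtain h where h: "\<And>b. h b \<in> borel_measurable lborel" "\<And>b. AE x in lborel. f x \<bullet> b = h b x"
    by metis
  define g where "g x = (\<Sum>b\<in>Basis. h b x *\<^sub>R b)" for x
  have "g \<in> borel_measurable borel"
    unfolding g_def using h(1) by measurable
  moreover have "AE x in lborel. \<forall>b\<in>Basis. f x \<bullet> b = h b x"
    using h(2) by (intro AE_finite_allI) auto
  then have "AE x in lborel. f x = g x"
  proof eventually_elim
    case (elim x)
    have "f x = (\<Sum>b\<in>Basis. (f x \<bullet> b) *\<^sub>R b)" by (simp add: euclidean_representation)
    with elim show ?case by (simp add: g_def)
  qed
  ultimately show thesis by (rule that)
qed

lemma AE_lborel_iterated:
  fixes P :: "'a::euclidean_space \<times> 'b::euclidean_space \<Rightarrow> bool"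
  assumes "AE z in lborel. P z"
  shows "AE x in lborel. AE y in lborel. P (x, y)"
  using assms unfolding lborel_prod[symmetric] by (rule lborel_pair.AE_pair)

text \<open>Averaging in the state variable turns a function of time and state that is defined only up to null sets into
one that can be evaluated along a curve.\<close>

definition ball_average :: "('a::euclidean_space \<Rightarrow> 'b::{banach,second_countable_topology}) \<Rightarrow> 'a \<Rightarrow> real \<Rightarrow> 'b" where
  "ball_average g p h = (\<integral>y. indicator (ball p h) y *\<^sub>R g y \<partial>lborel) /\<^sub>R measure lborel (ball p h)"

lemma borel_measurable_ball_average:
  fixes g :: "'c::euclidean_space \<times> 'a::euclidean_space \<Rightarrow> 'b::{banach,second_countable_topology}"
  assumes g[measurable]: "g \<in> borel_measurable borel" and p[measurable]: "p \<in> borel_measurable borel"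
  shows "(\<lambda>s. ball_average (\<lambda>y. g (s, y)) (p s) h) \<in> borel_measurable borel"
proof -
  have [measurable]: "g \<in> borel_measurable (borel \<Otimes>\<^sub>M borel)"
    using g by (simp add: borel_prod)
  have "(\<lambda>s. \<integral>y. indicator {0..<h} (dist (p s) y) *\<^sub>R g (s, y) \<partial>lborel) \<in> borel_measurable borel"
    by (rule lborel.borel_measurable_lebesgue_integral) measurable
  moreover have "indicator {0..<h} (dist (p s) y) = (indicator (ball (p s) h) y :: real)" for s y
    by (auto simp: indicator_def)
  moreover have "measure lborel (ball (p s) h) = measure lborel (ball (0::'a) h)" for s
    by (cases "h \<ge> 0") (auto simp: content_ball ball_empty)
  ultimately show ?thesis
    unfolding ball_average_def by simp
qed

text \<open>A hyperplane that strictly separated the average from \<open>C\<close> would also separate it from almost all averaged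
values, which is impossible after integration.\<close>

lemma ball_average_mem:
  fixes g :: "'a::euclidean_space \<Rightarrow> 'b::euclidean_space"
  assumes g: "g \<in> borel_measurable borel" and "h > 0"
    and C: "closed C" "convex C"
    and bd: "AE y in lborel. y \<in> ball p h \<longrightarrow> norm (g y) \<le> B"
    and mem: "AE y in lborel. y \<in> ball p h \<longrightarrow> g y \<in> C"
  shows "ball_average g p h \<in> C"
proof (rule ccontr)
  let ?V = "measure lborel (ball p h)" and ?\<phi> = "\<lambda>y. indicator (ball p h) y *\<^sub>R g y"
  have V: "?V > 0" using \<open>h > 0\<close> by (simp add: content_ball unit_ball_vol_pos)
  have ib: "integrable lborel (\<lambda>y. indicator (ball p h) y * c :: real)" for c
    by (intro integrable_mult_left integrable_real_indicator emeasure_lborel_ball_finite) simp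
  have int: "integrable lborel ?\<phi>"
  proof (rule Bochner_Integration.integrable_bound[OF ib[of B]])
    show "AE y in lborel. norm (?\<phi> y) \<le> norm (indicator (ball p h) y * B)"
      using bd by eventually_elim (auto simp: indicator_def)
    show "?\<phi> \<in> borel_measurable lborel"
      using g by (intro borel_measurable_scaleR borel_measurable_indicator) auto
  qed
  assume "ball_average g p h \<notin> C"
  from separating_hyperplane_closed_point[OF C(2,1) this]
  obtain a b where ab: "a \<bullet> ball_average g p h < b" "\<And>x. x \<in> C \<Longrightarrow> a \<bullet> x > b" by blast
  have "b * ?V = (\<integral>y. indicator (ball p h) y * b \<partial>lborel)"
    by (simp add: emeasure_lborel_ball_finite)
  also have "\<dots> \<le> (\<integral>y. a \<bullet> ?\<phi> y \<partial>lborel)"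
  proof (rule integral_mono_AE[OF ib])
    show "integrable lborel (\<lambda>y. a \<bullet> ?\<phi> y)" by (rule integrable_inner_right) (rule int)
    show "AE y in lborel. indicator (ball p h) y * b \<le> a \<bullet> ?\<phi> y"
      using mem by eventually_elim (use ab(2) in \<open>auto simp: indicator_def intro: less_imp_le\<close>)
  qed
  also have "\<dots> = a \<bullet> (\<integral>y. ?\<phi> y \<partial>lborel)" by (rule integral_inner_right) (rule int)
  also have "\<dots> = (a \<bullet> ball_average g p h) * ?V"
    using V by (simp add: ball_average_def)
  finally show False using ab(1) V by (simp add: mult_less_cancel_right)
qed

text \<open>At almost every time \<open>g (t, _)\<close> agrees almost everywhere with its Borel version, so continuity makes
\<open>g (t, z t)\<close> the limit of the averages of that version over shrinking balls around \<open>z t\<close>; these averages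
are measurable in \<open>t\<close>.\<close>

lemma lebesgue_measurable_composition:
  fixes g :: "real \<times> 'a::euclidean_space \<Rightarrow> 'a" and z :: "real \<Rightarrow> 'a"
  assumes g: "g \<in> borel_measurable lebesgue" and z: "z \<in> borel_measurable borel"
    and cont: "\<And>t. isCont (\<lambda>y. g (t, y)) (z t)"
  shows "(\<lambda>t. g (t, z t)) \<in> borel_measurable lebesgue"
proof -
  obtain gB where gB: "gB \<in> borel_measurable borel" "AE x in lborel. g x = gB x"
    using lebesgue_measurable_ex_borel[OF g] by blast
  have ae: "AE t in lborel. AE y in lborel. g (t, y) = gB (t, y)"
    using AE_lborel_iterated[OF gB(2)] .
  define d where "d n = inverse (real (Suc n))" for n
  have dpos: "d n > 0" for n by (simp add: d_def)
  have d0: "d \<longlonglongrightarrow> 0" unfolding d_def by (rule LIMSEQ_inverse_real_of_nat)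
  define A where "A n t = ball_average (\<lambda>y. gB (t, y)) (z t) (d n)" for n t
  have Am: "A n \<in> borel_measurable borel" for n
    unfolding A_def using borel_measurable_ball_average[OF gB(1) z] .
  have lim: "AE t in lborel. (\<lambda>n. A n t) \<longlonglongrightarrow> g (t, z t)"
    using ae
  proof eventually_elim
    case (elim t)
    have m: "(\<lambda>y. gB (t, y)) \<in> borel_measurable borel"
      using gB(1) by measurable
    show ?case
    proof (rule LIMSEQ_I)
      fix e :: real assume "e > 0"
      then have "e / 2 > 0" by simp
      from LIM_D[OF isContD[OF cont[of t]] this] obtain r where r: "r > 0"
        "\<forall>y. y \<noteq> z t \<and> norm (y - z t) < r \<longrightarrow> norm (g (t, y) - g (t, z t)) < e / 2" by blast
      obtain n0 where n0: "\<And>n. n \<ge> n0 \<Longrightarrow> d n < r"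
        using order_tendstoD(2)[OF d0 r(1)] by (auto simp: eventually_sequentially)
      have "norm (A n t - g (t, z t)) < e" if "n \<ge> n0" for n
      proof -
        have mem: "g (t, y) \<in> cball (g (t, z t)) (e / 2)" if "y \<in> ball (z t) (d n)" for y
          using r(2)[rule_format, of y] n0[OF \<open>n \<ge> n0\<close>] that \<open>e > 0\<close>
          by (cases "y = z t") (auto simp: dist_norm norm_minus_commute)
        have "A n t \<in> cball (g (t, z t)) (e / 2)"
          unfolding A_def
        proof (rule ball_average_mem[OF m dpos])
          show "AE y in lborel. y \<in> ball (z t) (d n) \<longrightarrow> gB (t, y) \<in> cball (g (t, z t)) (e / 2)"
            using elim by eventually_elim (metis mem)
          then show "AE y in lborel. y \<in> ball (z t) (d n) \<longrightarrow> norm (gB (t, y)) \<le> norm (g (t, z t)) + e / 2"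
          proof eventually_elim
            case (elim y)
            then show ?case
              using norm_triangle_ineq2[of "gB (t, y)" "g (t, z t)"]
              unfolding norm_minus_commute[of "gB (t, y)"] by (auto simp: dist_norm)
          qed
        qed auto
        then show ?thesis using \<open>e > 0\<close> by (simp add: dist_norm norm_minus_commute)
      qed
      then show "\<exists>n0. \<forall>n\<ge>n0. norm (A n t - g (t, z t)) < e" by blast
    qed
  qed
  define G where "G t = lim (\<lambda>n. A n t)" for t
  have "G \<in> borel_measurable borel"
    unfolding G_def by (rule borel_measurable_lim_metric[OF Am])
  then have "G \<in> borel_measurable lebesgue"
    by (simp add: measurable_completion)
  moreover have "AE t in lebesgue. G t = g (t, z t)"
    by (rule AE_completion) (use lim in eventually_elim, simp add: G_def limI)
  ultimately show ?thesis by (rule borel_measurable_AE)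
qed

section \<open>The memory term\<close>

lemma norm_matrix_vector_mult_le:
  fixes A :: "real^'n^'m"
  shows "norm (A *v x) \<le> norm A * norm x"
proof -
  have "norm (A *v x) = L2_set (\<lambda>i. norm (A $ i \<bullet> x)) UNIV"
    by (simp add: norm_vec_def matrix_vector_mul_component)
  also have "\<dots> \<le> L2_set (\<lambda>i. norm (A $ i) * norm x) UNIV"
    by (rule L2_set_mono) (simp_all add: Cauchy_Schwarz_ineq2)
  also have "\<dots> = norm A * norm x"
    by (simp add: norm_vec_def L2_set_left_distrib)
  finally show ?thesis .
qed

lemma bounded_bilinear_matrix_vector_mult:
  "bounded_bilinear (\<lambda>(A :: real^'n^'m) x. A *v x)"
proof
  show "\<exists>K. \<forall>(A :: real^'n^'m) x. norm (A *v x) \<le> norm A * norm x * K"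
    using norm_matrix_vector_mult_le by (intro exI[of _ 1]) auto
qed (auto simp: matrix_vector_mult_add_rdistrib matrix_vector_right_distrib scaleR_matrix_vector_assoc
    matrix_vector_mult_scaleR)

lemma borel_measurable_matrix_vector_mult [measurable (raw)]:
  fixes A :: "'a \<Rightarrow> real^'n^'m" and x :: "'a \<Rightarrow> real^'n"
  assumes "A \<in> borel_measurable M" "x \<in> borel_measurable M"
  shows "(\<lambda>t. A t *v x t) \<in> borel_measurable M"
  using assms
  by (rule borel_measurable_continuous_Pair)
     (intro bounded_bilinear.continuous_on[OF bounded_bilinear_matrix_vector_mult] continuous_intros)

text \<open>The essential supremum is \<open>-\<infinity>\<close> if \<open>C\<close> is a null set, which is why the bound is enlarged to a nonnegative one.\<close>

lemma locally_ess_bounded_on_AE: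
  assumes "locally_ess_bounded_on S g" "compact C" "C \<subseteq> S"
  obtains c where "c \<ge> 0" "AE z in lebesgue_on C. norm (g z) \<le> c"
proof -
  let ?e = "esssup (lebesgue_on C) (\<lambda>z. ereal (norm (g z)))"
  have "?e < \<infinity>" using assms by (simp add: locally_ess_bounded_on_def)
  then obtain r where "?e \<le> ereal r" by (cases ?e) auto
  then have "?e \<le> ereal (max r 0)" by (rule order_trans) simp
  then obtain c where c: "?e \<le> ereal c" "c \<ge> 0" by (metis max.cobounded2)
  have "AE z in lebesgue_on C. norm (g z) \<le> c"
    using esssup_AE[of "\<lambda>z. ereal (norm (g z))" "lebesgue_on C"]
  proof eventually_elim
    case (elim z)
    then have "ereal (norm (g z)) \<le> ereal c" using c(1) by (rule order_trans)
    then show ?case by simp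
  qed
  with c(2) show thesis by (rule that)
qed

lemma AE_lebesgue_on_iff:
  "S \<in> sets lebesgue \<Longrightarrow> (AE t in lebesgue_on S. P t) \<longleftrightarrow> (AE t in lebesgue. t \<in> S \<longrightarrow> P t)"
  by (rule AE_restrict_space_iff) simp

lemma AE_lebesgue_on_subset:
  assumes "AE t in lebesgue_on S. P t" "T \<subseteq> S" "S \<in> sets lebesgue" "T \<in> sets lebesgue"
  shows "AE t in lebesgue_on T. P t"
  using assms by (auto simp: AE_lebesgue_on_iff elim: eventually_mono)

lemma integrable_lebesgue_on_subset:
  fixes f :: "'a::euclidean_space \<Rightarrow> 'b::{banach,second_countable_topology}"
  assumes "integrable (lebesgue_on S) f" "T \<subseteq> S" "S \<in> sets lebesgue" "T \<in> sets lebesgue"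
  shows "integrable (lebesgue_on T) f"
proof -
  have "set_integrable lebesgue S f"
    using assms by (simp add: set_integrable_def integrable_restrict_space)
  then have "set_integrable lebesgue T f"
    by (rule set_integrable_subset) (use assms in auto)
  then show ?thesis
    using assms by (simp add: set_integrable_def integrable_restrict_space)
qed

lemma AE_lebesgue_on_negligibleE:
  assumes "AE t in lebesgue_on {a..b::real}. P t"
  obtains N where "negligible N" "\<And>t. t \<in> {a..b} - N \<Longrightarrow> P t"
proof -
  have "AE t in lebesgue. t \<in> {a..b} \<longrightarrow> P t" using assms by (simp add: AE_lebesgue_on_iff)
  then obtain N where "N \<in> null_sets lebesgue" "\<And>t. t \<notin> N \<Longrightarrow> t \<in> {a..b} \<longrightarrow> P t"
    by (auto elim!: AE_E3)
  then show thesis by (intro that[of N]) (auto simp: negligible_iff_null_sets)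
qed

lemma compact_triangle: "compact {(t, \<tau>). a \<le> \<tau> \<and> \<tau> \<le> t \<and> t \<le> (b::real)}"
proof -
  have "closed {z :: real \<times> real. a \<le> snd z \<and> snd z \<le> fst z \<and> fst z \<le> b}"
    by (intro closed_Collect_conj closed_Collect_le continuous_intros)
  moreover have "{z :: real \<times> real. a \<le> snd z \<and> snd z \<le> fst z \<and> fst z \<le> b} \<subseteq> cbox (a, a) (b, b)"
    by (auto simp: cbox_Pair_eq)
  ultimately have "compact {z :: real \<times> real. a \<le> snd z \<and> snd z \<le> fst z \<and> fst z \<le> b}"
    using compact_cbox closed_subset bounded_subset[OF bounded_cbox] compact_eq_bounded_closed by blast
  then show ?thesis by (simp add: split_def)
qed

text \<open>On the compact triangle of pairs \<open>a \<le> \<tau> \<le> t \<le> b\<close> the kernel agrees almost everywhere with an everywhere bounded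
Borel function. Iterating the almost-everywhere statement makes it usable for the integral over \<open>\<tau>\<close> at fixed \<open>t\<close>.\<close>

lemma kernel_borel_version:
  fixes \<Phi> :: "real \<times> real \<Rightarrow> 'b::euclidean_space"
  assumes \<Delta>: "\<Delta> = {(t, \<tau>). t \<ge> \<tau>}"
    and meas: "\<Phi> \<in> borel_measurable (lebesgue_on \<Delta>)" and bd: "locally_ess_bounded_on \<Delta> \<Phi>"
  obtains \<Psi> c where "\<Psi> \<in> borel_measurable borel" "\<And>z. norm (\<Psi> z) \<le> c" "c \<ge> 0"
    "AE t in lebesgue. AE \<tau> in lebesgue. a \<le> \<tau> \<and> \<tau> \<le> t \<and> t \<le> b \<longrightarrow> \<Phi> (t, \<tau>) = \<Psi> (t, \<tau>)"
proof -
  define T where "T = {(t, \<tau>). a \<le> \<tau> \<and> \<tau> \<le> t \<and> t \<le> b}"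
  have T: "compact T" "T \<subseteq> \<Delta>" unfolding T_def \<Delta> by (auto intro: compact_triangle)
  then have Tl: "T \<in> sets lebesgue" by (simp add: lmeasurable_compact fmeasurableD)
  obtain c where c: "c \<ge> 0" "AE z in lebesgue_on T. norm (\<Phi> z) \<le> c"
    using locally_ess_bounded_on_AE[OF bd T] by blast
  have "\<Phi> \<in> borel_measurable (lebesgue_on T)"
    using measurable_restrict_mono[OF meas T(2)] .
  then have "(\<lambda>z. if z \<in> T then \<Phi> z else 0) \<in> borel_measurable lebesgue"
    using borel_measurable_if[OF Tl] by blast
  then obtain g where g: "g \<in> borel_measurable borel" "AE z in lborel. (if z \<in> T then \<Phi> z else 0) = g z"
    by (rule lebesgue_measurable_ex_borel)
  define \<Psi> where "\<Psi> z = (if norm (g z) \<le> c then g z else 0)" for z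
  have "AE z in lebesgue. z \<in> T \<longrightarrow> norm (\<Phi> z) \<le> c"
    using c(2) Tl by (simp add: AE_lebesgue_on_iff)
  then have "AE z in lborel. z \<in> T \<longrightarrow> norm (\<Phi> z) \<le> c"
    by (simp add: AE_completion_iff)
  with g(2) have "AE z in lborel. z \<in> T \<longrightarrow> \<Phi> z = \<Psi> z"
    by eventually_elim (auto simp: \<Psi>_def split: if_splits)
  from AE_lborel_iterated[OF this]
  have "AE t in lborel. AE \<tau> in lborel. a \<le> \<tau> \<and> \<tau> \<le> t \<and> t \<le> b \<longrightarrow> \<Phi> (t, \<tau>) = \<Psi> (t, \<tau>)"
    by (simp add: T_def)
  moreover have "\<Psi> \<in> borel_measurable borel" unfolding \<Psi>_def using g(1) by measurable
  moreover have "norm (\<Psi> z) \<le> c" for z using c(1) by (simp add: \<Psi>_def)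
  ultimately show thesis using c(1) by (intro that[of \<Psi> c]) (simp_all add: AE_completion_iff)
qed

definition memory :: "(real \<times> real \<Rightarrow> real^'n^'n) \<Rightarrow> real \<Rightarrow> (real \<Rightarrow> real^'n) \<Rightarrow> real \<Rightarrow> real^'n" where
  "memory \<Psi> a \<phi> t = integral\<^sup>L (lebesgue_on {a..t}) (\<lambda>\<tau>. \<Psi> (t, \<tau>) *v \<phi> \<tau>)"

lemma memory_integrable:
  fixes \<Psi> :: "real \<times> real \<Rightarrow> real^'n^'n"
  assumes \<Psi>: "\<Psi> \<in> borel_measurable borel" "\<And>z. norm (\<Psi> z) \<le> c"
    and \<phi>: "integrable (lebesgue_on {a..b}) \<phi>" and "t \<le> b"
  shows "integrable (lebesgue_on {a..t}) (\<lambda>\<tau>. \<Psi> (t, \<tau>) *v \<phi> \<tau>)"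
proof -
  have \<phi>t: "integrable (lebesgue_on {a..t}) \<phi>"
    by (rule integrable_lebesgue_on_subset[OF \<phi>]) (use \<open>t \<le> b\<close> in auto)
  have "c \<ge> 0" using \<Psi>(2) norm_ge_zero order_trans by blast
  have "(\<lambda>\<tau>. \<Psi> (t, \<tau>)) \<in> borel_measurable borel"
    using \<Psi>(1) by measurable
  then have "(\<lambda>\<tau>. \<Psi> (t, \<tau>)) \<in> borel_measurable (lebesgue_on {a..t})"
    by (intro measurable_restrict_space1 measurable_completion) simp
  then have meas: "(\<lambda>\<tau>. \<Psi> (t, \<tau>) *v \<phi> \<tau>) \<in> borel_measurable (lebesgue_on {a..t})"
    using \<phi>t by (intro borel_measurable_matrix_vector_mult) auto
  show ?thesis
  proof (rule Bochner_Integration.integrable_bound[OF integrable_mult_right[OF integrable_norm[OF \<phi>t], of c] meas], rule AE_I2)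
    fix \<tau>
    have "norm (\<Psi> (t, \<tau>) *v \<phi> \<tau>) \<le> norm (\<Psi> (t, \<tau>)) * norm (\<phi> \<tau>)"
      by (rule norm_matrix_vector_mult_le)
    also have "\<dots> \<le> c * norm (\<phi> \<tau>)" by (rule mult_right_mono[OF \<Psi>(2)]) simp
    finally show "norm (\<Psi> (t, \<tau>) *v \<phi> \<tau>) \<le> norm (c * norm (\<phi> \<tau>))" using \<open>c \<ge> 0\<close> by simp
  qed
qed

lemma memory_diff_le:
  fixes \<Psi> :: "real \<times> real \<Rightarrow> real^'n^'n"
  assumes \<Psi>: "\<Psi> \<in> borel_measurable borel" "\<And>z. norm (\<Psi> z) \<le> c"
    and \<phi>: "integrable (lebesgue_on {a..b}) \<phi>" "integrable (lebesgue_on {a..b}) \<phi>'"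
    and t: "t \<in> {a..b}" and d: "AE \<tau> in lebesgue_on {a..t}. norm (\<phi> \<tau> - \<phi>' \<tau>) \<le> d \<tau>"
      "integrable (lebesgue_on {a..t}) d"
  shows "norm (memory \<Psi> a \<phi> t - memory \<Psi> a \<phi>' t) \<le> c * integral\<^sup>L (lebesgue_on {a..t}) d"
proof -
  have "c \<ge> 0" using \<Psi>(2) norm_ge_zero order_trans by blast
  note i = memory_integrable[OF \<Psi> \<phi>(1)] memory_integrable[OF \<Psi> \<phi>(2)]
  have "memory \<Psi> a \<phi> t - memory \<Psi> a \<phi>' t
      = integral\<^sup>L (lebesgue_on {a..t}) (\<lambda>\<tau>. \<Psi> (t, \<tau>) *v \<phi> \<tau> - \<Psi> (t, \<tau>) *v \<phi>' \<tau>)"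
    unfolding memory_def using i t by (intro Bochner_Integration.integral_diff[symmetric]) auto
  also have "norm \<dots> \<le> integral\<^sup>L (lebesgue_on {a..t}) (\<lambda>\<tau>. norm (\<Psi> (t, \<tau>) *v \<phi> \<tau> - \<Psi> (t, \<tau>) *v \<phi>' \<tau>))"
    by (rule integral_norm_bound)
  also have "\<dots> \<le> integral\<^sup>L (lebesgue_on {a..t}) (\<lambda>\<tau>. c * d \<tau>)"
  proof (rule integral_mono_AE)
    show "AE \<tau> in lebesgue_on {a..t}. norm (\<Psi> (t, \<tau>) *v \<phi> \<tau> - \<Psi> (t, \<tau>) *v \<phi>' \<tau>) \<le> c * d \<tau>"
      using d(1)
    proof eventually_elim
      case (elim \<tau>)
      have "norm (\<Psi> (t, \<tau>) *v (\<phi> \<tau> - \<phi>' \<tau>)) \<le> norm (\<Psi> (t, \<tau>)) * norm (\<phi> \<tau> - \<phi>' \<tau>)"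
        by (rule norm_matrix_vector_mult_le)
      also have "\<dots> \<le> c * d \<tau>" using \<Psi>(2) elim \<open>c \<ge> 0\<close> by (intro mult_mono) auto
      finally show ?case by (simp add: matrix_vector_mult_diff_distrib)
    qed
  qed (use i t d in auto)
  also have "\<dots> = c * integral\<^sup>L (lebesgue_on {a..t}) d" by simp
  finally show ?thesis .
qed

text \<open>Replacing \<open>\<phi>\<close> by a Borel version leaves the integral unchanged for every \<open>t\<close>; the parametrized
integral is then measurable by Fubini's theorem.\<close>

lemma memory_measurable:
  fixes \<Psi> :: "real \<times> real \<Rightarrow> real^'n^'n"
  assumes \<Psi>: "\<Psi> \<in> borel_measurable borel"
    and \<phi>: "\<phi> \<in> borel_measurable lebesgue"
  shows "memory \<Psi> a \<phi> \<in> borel_measurable lebesgue"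
proof -
  obtain g where g: "g \<in> borel_measurable borel" "AE x in lborel. \<phi> x = g x"
    using lebesgue_measurable_ex_borel[OF \<phi>] .
  have eq: "memory \<Psi> a \<phi> t = (\<integral>\<tau>. indicator {a..t} \<tau> *\<^sub>R (\<Psi> (t, \<tau>) *v g \<tau>) \<partial>lborel)" for t
  proof -
    have m[measurable]: "(\<lambda>\<tau>. \<Psi> (t, \<tau>)) \<in> borel_measurable borel" using \<Psi> by measurable
    have [measurable]: "(\<lambda>\<tau>. indicator {a..t} \<tau> *\<^sub>R (\<Psi> (t, \<tau>) *v g \<tau>)) \<in> borel_measurable borel"
      using g(1) by measurable
    have "memory \<Psi> a \<phi> t = (\<integral>\<tau>. indicator {a..t} \<tau> *\<^sub>R (\<Psi> (t, \<tau>) *v \<phi> \<tau>) \<partial>lebesgue)"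
      unfolding memory_def by (rule integral_restrict_space) simp
    also have "\<dots> = (\<integral>\<tau>. indicator {a..t} \<tau> *\<^sub>R (\<Psi> (t, \<tau>) *v g \<tau>) \<partial>lebesgue)"
    proof (rule integral_cong_AE)
      have "(\<lambda>\<tau>. \<Psi> (t, \<tau>)) \<in> borel_measurable lebesgue"
        using m by (intro measurable_completion) simp
      then show "(\<lambda>\<tau>. indicator {a..t} \<tau> *\<^sub>R (\<Psi> (t, \<tau>) *v \<phi> \<tau>)) \<in> borel_measurable lebesgue"
        using \<phi> by (intro borel_measurable_scaleR borel_measurable_matrix_vector_mult borel_measurable_indicator) auto
      show "(\<lambda>\<tau>. indicator {a..t} \<tau> *\<^sub>R (\<Psi> (t, \<tau>) *v g \<tau>)) \<in> borel_measurable lebesgue"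
        by (intro measurable_completion) simp
      show "AE \<tau> in lebesgue. indicator {a..t} \<tau> *\<^sub>R (\<Psi> (t, \<tau>) *v \<phi> \<tau>) = indicator {a..t} \<tau> *\<^sub>R (\<Psi> (t, \<tau>) *v g \<tau>)"
        by (rule AE_completion) (use g(2) in eventually_elim, simp)
    qed
    also have "\<dots> = (\<integral>\<tau>. indicator {a..t} \<tau> *\<^sub>R (\<Psi> (t, \<tau>) *v g \<tau>) \<partial>lborel)"
      by (rule integral_completion) simp
    finally show ?thesis .
  qed
  have [measurable]: "\<Psi> \<in> borel_measurable (borel \<Otimes>\<^sub>M borel)"
    using \<Psi> by (simp add: borel_prod)
  note g(1)[measurable]
  have "(\<lambda>t. \<integral>\<tau>. (if a \<le> \<tau> \<and> \<tau> \<le> t then 1 else 0) *\<^sub>R (\<Psi> (t, \<tau>) *v g \<tau>) \<partial>lborel) \<in> borel_measurable borel"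
    by (rule lborel.borel_measurable_lebesgue_integral) measurable
  moreover have "indicator {a..t} \<tau> = (if a \<le> \<tau> \<and> \<tau> \<le> t then 1 else 0 :: real)" for t \<tau>
    by (simp add: indicator_def)
  ultimately have "memory \<Psi> a \<phi> \<in> borel_measurable borel"
    unfolding eq[abs_def] by simp
  then show ?thesis by (intro measurable_completion) simp
qed

text \<open>The right-hand side of the differential inclusion.\<close>

definition admissible_velocities ::
    "(real \<times> real \<Rightarrow> real^'n^'n) \<Rightarrow> (real \<times> (real^'n) \<Rightarrow> real^'n) \<Rightarrow> (real \<times> (real^'n) \<Rightarrow> real^'n)
     \<Rightarrow> real \<Rightarrow> (real \<Rightarrow> real^'n) \<Rightarrow> real \<Rightarrow> (real^'n) set" where
  "admissible_velocities \<Phi> f f' t0 x t = {v + w | v w. v \<in> Filippov_reg f t (x t) \<and>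
     w \<in> Aumann_integral {t0..t} (\<lambda>\<tau>. (\<lambda>z. \<Phi> (t, \<tau>) *v z) ` Filippov_reg f' \<tau> (x \<tau>))}"

lemma Filippov_solution_iff:
  "Filippov_solution \<Phi> f f' t0 x0 I x \<longleftrightarrow>
     ((\<exists>\<alpha>>0. I = {t0..<t0 + \<alpha>}) \<or> I = {t0..}) \<and> abs_continuous_on I x \<and> x t0 = x0 \<and>
     (AE t in lebesgue_on I. \<exists>d\<in>admissible_velocities \<Phi> f f' t0 x t. (x has_vector_derivative d) (at t within I))"
proof -
  have "(\<exists>d\<in>{v + w | v w. P v \<and> Q w}. R d) \<longleftrightarrow> (\<exists>v w. P v \<and> Q w \<and> R (v + w))"
    for P Q R :: "real^'a \<Rightarrow> bool" by blast
  then show ?thesis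
    unfolding Filippov_solution_def admissible_velocities_def by simp
qed

section \<open>Bounds that hold at almost every time\<close>

lemma Linf_loc_AE_le:
  assumes "Linf_loc l"
  obtains c where "c \<ge> 0" "AE t in lebesgue_on {a..b}. l t \<le> c"
proof -
  from assms have "locally_ess_bounded_on UNIV l" by (simp add: Linf_loc_def)
  from locally_ess_bounded_on_AE[OF this, of "{a..b}"] obtain c where
    "c \<ge> 0" "AE t in lebesgue_on {a..b}. norm (l t) \<le> c" by auto
  then show thesis by (intro that[of c]) (auto elim: eventually_mono)
qed

lemma locally_one_sided_Lipschitz_AE:
  assumes "locally_one_sided_Lipschitz g" "compact X"
  obtains L where "L \<ge> 0" "AE t in lebesgue_on {a..b}. one_sided_Lipschitz_on L X (\<lambda>y. g (t, y))"
proof -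
  from assms obtain l where l: "Linf_loc l"
    "\<And>t x y. x \<in> X \<Longrightarrow> y \<in> X \<Longrightarrow> (x - y) \<bullet> (g (t, x) - g (t, y)) \<le> l t * (norm (x - y))\<^sup>2"
    unfolding locally_one_sided_Lipschitz_def by metis
  obtain L where L: "L \<ge> 0" "AE t in lebesgue_on {a..b}. l t \<le> L"
    using Linf_loc_AE_le[OF l(1)] by blast
  from L(2) have "AE t in lebesgue_on {a..b}. one_sided_Lipschitz_on L X (\<lambda>y. g (t, y))"
  proof eventually_elim
    case (elim t)
    show ?case
      unfolding one_sided_Lipschitz_on_def
    proof (intro ballI)
      fix x y assume "x \<in> X" "y \<in> X"
      then have "(x - y) \<bullet> (g (t, x) - g (t, y)) \<le> l t * (norm (x - y))\<^sup>2" by (rule l(2))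
      also have "\<dots> \<le> L * (norm (x - y))\<^sup>2" using elim by (rule mult_right_mono) simp
      finally show "(x - y) \<bullet> (g (t, x) - g (t, y)) \<le> L * (norm (x - y))\<^sup>2" .
    qed
  qed
  with L(1) show thesis by (rule that)
qed

lemma locally_Lipschitz_AE:
  assumes "locally_Lipschitz g" "compact X"
  obtains K where "K \<ge> 0"
    "AE t in lebesgue_on {a..b}. \<forall>x\<in>X. \<forall>y\<in>X. norm (g (t, x) - g (t, y)) \<le> K * norm (x - y)"
proof -
  from assms obtain l where l: "Linf_loc l"
    "\<And>t x y. x \<in> X \<Longrightarrow> y \<in> X \<Longrightarrow> norm (g (t, x) - g (t, y)) \<le> l t * norm (x - y)"
    unfolding locally_Lipschitz_def by metis
  obtain K where K: "K \<ge> 0" "AE t in lebesgue_on {a..b}. l t \<le> K"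
    using Linf_loc_AE_le[OF l(1)] by blast
  from K(2) have "AE t in lebesgue_on {a..b}. \<forall>x\<in>X. \<forall>y\<in>X. norm (g (t, x) - g (t, y)) \<le> K * norm (x - y)"
  proof eventually_elim
    case (elim t)
    show ?case
    proof (intro ballI)
      fix x y assume "x \<in> X" "y \<in> X"
      then have "norm (g (t, x) - g (t, y)) \<le> l t * norm (x - y)" by (rule l(2))
      also have "\<dots> \<le> K * norm (x - y)" using elim by (rule mult_right_mono) simp
      finally show "norm (g (t, x) - g (t, y)) \<le> K * norm (x - y)" .
    qed
  qed
  with K(1) show thesis by (rule that)
qed

lemma locally_Lipschitz_imp_one_sided:
  assumes "locally_Lipschitz g"
  shows "locally_one_sided_Lipschitz g"
  unfolding locally_one_sided_Lipschitz_def
proof (intro conjI allI impI)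
  show "g \<in> borel_measurable lebesgue" using assms by (simp add: locally_Lipschitz_def)
  fix X :: "(real^'a) set" assume "compact X"
  then obtain l where l: "Linf_loc l"
    "\<And>t x y. x \<in> X \<Longrightarrow> y \<in> X \<Longrightarrow> norm (g (t, x) - g (t, y)) \<le> l t * norm (x - y)"
    using assms unfolding locally_Lipschitz_def by metis
  have "(x - y) \<bullet> (g (t, x) - g (t, y)) \<le> l t * (norm (x - y))\<^sup>2" if "x \<in> X" "y \<in> X" for t x y
  proof -
    have "(x - y) \<bullet> (g (t, x) - g (t, y)) \<le> norm (x - y) * norm (g (t, x) - g (t, y))"
      by (rule norm_cauchy_schwarz)
    also have "\<dots> \<le> norm (x - y) * (l t * norm (x - y))"
      by (rule mult_left_mono[OF l(2)[OF that]]) simp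
    finally show ?thesis by (simp add: power2_eq_square mult_ac)
  qed
  with l(1) show "\<exists>l. Linf_loc l \<and>
        (\<forall>t. \<forall>x\<in>X. \<forall>y\<in>X. (x - y) \<bullet> (g (t, x) - g (t, y)) \<le> l t * (norm (x - y))\<^sup>2)" by blast
qed

text \<open>Where the Lipschitz factor \<open>l t\<close> is negative, the map is constant on the ball.\<close>

lemma locally_Lipschitz_isCont:
  assumes "locally_Lipschitz g"
  shows "isCont (\<lambda>y. g (t, y)) x"
proof -
  have "compact (cball x 1)" by simp
  with assms obtain l where l: "\<And>t y z. y \<in> cball x 1 \<Longrightarrow> z \<in> cball x 1 \<Longrightarrow>
      norm (g (t, y) - g (t, z)) \<le> l t * norm (y - z)"
    unfolding locally_Lipschitz_def by metis
  have "(l t)-lipschitz_on (cball x 1) (\<lambda>y. g (t, y))" if "l t \<ge> 0"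
    using l that by (auto simp: lipschitz_on_def dist_norm)
  moreover have "(0::real)-lipschitz_on (cball x 1) (\<lambda>y. g (t, y))" if "l t \<le> 0"
    unfolding lipschitz_on_def
  proof (intro conjI ballI)
    fix y z assume "y \<in> cball x 1" "z \<in> cball x 1"
    from l[OF this, of t] have "norm (g (t, y) - g (t, z)) \<le> 0"
      using that mult_nonpos_nonneg[OF that norm_ge_zero[of "y - z"]] by linarith
    then show "dist (g (t, y)) (g (t, z)) \<le> 0 * dist y z" by (simp add: dist_norm)
  qed simp
  ultimately have "continuous_on (cball x 1) (\<lambda>y. g (t, y))"
    by (meson lipschitz_on_continuous_on linear)
  then have "continuous_on (ball x 1) (\<lambda>y. g (t, y))"
    by (rule continuous_on_subset) (rule ball_subset_cball)
  then show ?thesis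
    by (simp add: continuous_on_eq_continuous_at)
qed

text \<open>The Filippov condition bounds \<open>g (t, _)\<close> only almost everywhere on a ball, whereas the estimates along
solutions need every point.\<close>

lemma Filippov_one_sided_bound:
  assumes F: "Filippov_condition g" and osl: "locally_one_sided_Lipschitz g" and "r > 0"
  obtains m where "integrable (lebesgue_on {a..b}) m" "\<And>t. 0 \<le> m t"
    "AE t in lebesgue_on {a..b}. \<forall>y\<in>cball 0 r. norm (g (t, y)) \<le> m t"
proof -
  define \<alpha> where "\<alpha> = max \<bar>a\<bar> \<bar>b\<bar> + 1"
  have "\<alpha> > 0" "r + 1 > 0" using \<open>r > 0\<close> by (auto simp: \<alpha>_def)
  with F obtain m0 where m0: "integrable (lebesgue_on {-\<alpha><..<\<alpha>}) m0"
    "AE t in lebesgue_on {-\<alpha><..<\<alpha>}. AE x in lebesgue_on (ball 0 (r + 1)). norm (g (t, x)) \<le> m0 t"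
    unfolding Filippov_condition_def by meson
  have sub: "{a..b} \<subseteq> {-\<alpha><..<\<alpha>}" by (auto simp: \<alpha>_def)
  have m0': "integrable (lebesgue_on {a..b}) m0"
    by (rule integrable_lebesgue_on_subset[OF m0(1) sub]) auto
  have ae: "AE t in lebesgue_on {a..b}. AE x in lebesgue_on (ball 0 (r + 1)). norm (g (t, x)) \<le> m0 t"
    by (rule AE_lebesgue_on_subset[OF m0(2) sub]) auto
  obtain L where L: "L \<ge> 0"
    "AE t in lebesgue_on {a..b}. one_sided_Lipschitz_on L (cball 0 (r + 1)) (\<lambda>y. g (t, y))"
    using locally_one_sided_Lipschitz_AE[OF osl compact_cball] by blast
  show thesis
  proof (rule that[of "\<lambda>t. 4 * (L + \<bar>m0 t\<bar>)"])
    show "integrable (lebesgue_on {a..b}) (\<lambda>t. 4 * (L + \<bar>m0 t\<bar>))"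
      by (intro integrable_mult_right Bochner_Integration.integrable_add integrable_abs m0' finite_measure.integrable_const
            finite_measure_lebesgue_on) simp
    show "0 \<le> 4 * (L + \<bar>m0 t\<bar>)" for t using L(1) by simp
    show "AE t in lebesgue_on {a..b}. \<forall>y\<in>cball 0 r. norm (g (t, y)) \<le> 4 * (L + \<bar>m0 t\<bar>)"
      using ae L(2)
    proof eventually_elim
      case (elim t)
      have "AE x in lebesgue. x \<in> ball 0 (r + 1) \<longrightarrow> norm (g (t, x)) \<le> m0 t"
        using elim(1) by (simp add: AE_lebesgue_on_iff)
      then have "AE x in lebesgue. x \<in> ball 0 (r + 1) \<longrightarrow> norm (g (t, x)) \<le> \<bar>m0 t\<bar>"
        by eventually_elim auto
      then show ?case
        using one_sided_Lipschitz_on_bound[OF elim(2) L(1)] by blast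
    qed
  qed
qed

section \<open>Integral equations with delay\<close>

text \<open>Iterating the right-hand side from the constant \<open>\<xi>\<close>, the \<open>n\<close>-th and the next iterate agree up to time
\<open>a + n h\<close>, because the velocity at time \<open>s\<close> depends on the iterate only up to \<open>s - h\<close>. After finitely many steps the
iterates agree on all of \<open>[a, b]\<close>. Clamping the upper limit of integration to \<open>[a, b]\<close> makes the iterates
continuous on the whole line.\<close>

lemma delayed_integral_equation:
  fixes G :: "(real \<Rightarrow> 'b::euclidean_space) \<Rightarrow> real \<Rightarrow> 'b"
  assumes "a \<le> b" "h > 0"
    and int: "\<And>z. continuous_on UNIV z \<Longrightarrow> G z integrable_on {a..b}"
    and causal: "\<And>z z' s. continuous_on UNIV z \<Longrightarrow> continuous_on UNIV z' \<Longrightarrow> s \<in> {a..b} \<Longrightarrow>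
        (\<And>r. r \<le> s \<Longrightarrow> z r = z' r) \<Longrightarrow> G z s = G z' s"
  obtains x where "continuous_on UNIV x" "\<And>t. t \<le> a \<Longrightarrow> x t = \<xi>"
    "\<And>t. t \<in> {a..b} \<Longrightarrow> x t = \<xi> + integral {a..t} (G (\<lambda>s. x (s - h)))"
proof -
  define F where "F x t = \<xi> + integral {a..max a (min t b)} (G (\<lambda>s. x (s - h)))" for x t
  define X where "X n = (F ^^ n) (\<lambda>_. \<xi>)" for n
  have X_Suc: "X (Suc n) = F (X n)" for n by (simp add: X_def)
  have shift: "continuous_on UNIV (\<lambda>s. x (s - h))" if "continuous_on UNIV x" for x :: "real \<Rightarrow> 'b"
    by (rule continuous_on_compose2[OF that]) (auto intro!: continuous_intros)
  have contF: "continuous_on UNIV (F x)" if "continuous_on UNIV x" for x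
  proof -
    have "continuous_on {a..b} (\<lambda>t. integral {a..t} (G (\<lambda>s. x (s - h))))"
      by (rule indefinite_integral_continuous_1[OF int[OF shift[OF that]]])
    then have "continuous_on UNIV (\<lambda>t. integral {a..max a (min t b)} (G (\<lambda>s. x (s - h))))"
      by (rule continuous_on_compose2) (use \<open>a \<le> b\<close> in \<open>auto intro!: continuous_intros\<close>)
    then show ?thesis unfolding F_def by (intro continuous_intros)
  qed
  have contX: "continuous_on UNIV (X n)" for n
  proof (induction n)
    case 0 then show ?case by (simp add: X_def)
  next
    case (Suc n) then show ?case unfolding X_Suc by (rule contF)
  qed
  have stable: "X (Suc n) t = X n t" if "t \<le> a + real n * h" for n t
    using that
  proof (induction n arbitrary: t)
    case 0
    then show ?case by (simp add: X_def F_def max_absorb1 min_le_iff_disj)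
  next
    case (Suc n)
    have "G (\<lambda>s. X (Suc n) (s - h)) s = G (\<lambda>s. X n (s - h)) s" if s: "s \<in> {a..max a (min t b)}" for s
    proof (rule causal)
      show "s \<in> {a..b}" using s \<open>a \<le> b\<close> by auto
      fix r assume "r \<le> s"
      have "s \<le> a + real (Suc n) * h"
        using s Suc.prems \<open>h > 0\<close> by (auto simp: max_def min_def split: if_splits)
      with \<open>r \<le> s\<close> have "r - h \<le> a + real n * h" by (simp add: algebra_simps)
      then show "X (Suc n) (r - h) = X n (r - h)" by (rule Suc.IH)
    qed (intro shift contX)+
    then show ?case
      unfolding X_Suc[of "Suc n"] X_Suc[of n] F_def
      by (metis (no_types, lifting) Henstock_Kurzweil_Integration.integral_cong X_Suc F_def)
  qed
  obtain n where n: "(b - a) / h < real n" using reals_Archimedean2 by blast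
  then have n: "b \<le> a + real n * h" using \<open>h > 0\<close> by (simp add: field_simps)
  show thesis
  proof (rule that[of "X n"])
    show "continuous_on UNIV (X n)" by (rule contX)
    have eq: "X n t = F (X n) t" if "t \<le> b" for t
      using stable[of t n] that n by (simp add: X_Suc)
    show "X n t = \<xi>" if "t \<le> a" for t
      using eq[of t] that \<open>a \<le> b\<close> by (simp add: F_def max_absorb1 min_le_iff_disj)
    show "X n t = \<xi> + integral {a..t} (G (\<lambda>s. X n (s - h)))" if "t \<in> {a..b}" for t
      using eq[of t] that by (simp add: F_def max_absorb2 min_absorb1)
  qed
qed

section \<open>The normalized problem\<close>

lemma set_integral_lebesgue_on_interval:
  fixes f :: "real \<Rightarrow> 'b::euclidean_space"
  assumes f: "integrable (lebesgue_on {a..b}) f" and "t \<le> b"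
  shows "(\<integral>\<tau>\<in>{a..t}. f \<tau> \<partial>lebesgue_on {a..b}) = integral {a..t} f"
proof -
  have sub: "{a..t} \<subseteq> {a..b}" using \<open>t \<le> b\<close> by auto
  have i: "integrable (lebesgue_on {a..t}) f"
    by (rule integrable_lebesgue_on_subset[OF f sub]) auto
  have "(\<integral>\<tau>\<in>{a..t}. f \<tau> \<partial>lebesgue_on {a..b}) = (\<integral>\<tau>. indicator {a..b} \<tau> *\<^sub>R indicator {a..t} \<tau> *\<^sub>R f \<tau> \<partial>lebesgue)"
    unfolding set_lebesgue_integral_def by (rule integral_restrict_space) simp
  also have "\<dots> = (\<integral>\<tau>. indicator {a..t} \<tau> *\<^sub>R f \<tau> \<partial>lebesgue)"
    using sub by (intro Bochner_Integration.integral_cong) (auto simp: indicator_def)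
  also have "\<dots> = integral\<^sup>L (lebesgue_on {a..t}) f"
    by (rule integral_restrict_space[symmetric]) simp
  also have "\<dots> = integral {a..t} f"
    by (rule lebesgue_integral_eq_integral[OF i]) simp
  finally show ?thesis .
qed

lemma norm_integral_le_AE:
  fixes f :: "real \<Rightarrow> 'b::euclidean_space"
  assumes f: "integrable (lebesgue_on {a..b}) f" and g: "integrable (lebesgue_on {a..b}) g"
    and le: "AE t in lebesgue_on {a..b}. norm (f t) \<le> g t" and uv: "a \<le> u" "v \<le> b"
  shows "norm (integral {u..v} f) \<le> integral {u..v} g"
proof -
  have sub: "{u..v} \<subseteq> {a..b}" using uv by auto
  have i: "integrable (lebesgue_on {u..v}) f" "integrable (lebesgue_on {u..v}) g"
    by (rule integrable_lebesgue_on_subset[OF f sub] integrable_lebesgue_on_subset[OF g sub]; simp)+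
  have "norm (integral\<^sup>L (lebesgue_on {u..v}) f) \<le> integral\<^sup>L (lebesgue_on {u..v}) (\<lambda>t. norm (f t))"
    by (rule integral_norm_bound)
  also have "\<dots> \<le> integral\<^sup>L (lebesgue_on {u..v}) g"
    by (rule integral_mono_AE[OF integrable_norm[OF i(1)] i(2)])
       (rule AE_lebesgue_on_subset[OF le sub], auto)
  finally show ?thesis
    using i by (simp add: lebesgue_integral_eq_integral)
qed

text \<open>The hypotheses in the form in which the construction uses them on the unit time interval after \<open>t0\<close>: the
essentially bounded functions are replaced by constants, \<open>f\<close> and \<open>f'\<close> are bounded by integrable functions of time at
every point near \<open>x0\<close>, and \<open>fB\<close> and \<open>\<Psi>\<close> are Borel versions of \<open>f\<close> and \<open>\<Phi>\<close>. The data of \<open>f\<close> are required on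
the ball of radius 2 around \<open>x0\<close>, since the averages reach at most distance 1 from points of the unit ball.\<close>

locale normalized_ivp =
  fixes f f' fB :: "real \<times> (real^'n) \<Rightarrow> real^'n" and \<Phi> \<Psi> :: "real \<times> real \<Rightarrow> real^'n^'n"
    and t0 :: real and x0 :: "real^'n" and L K c :: real and m m' :: "real \<Rightarrow> real"
  assumes L: "L \<ge> 0" and K: "K \<ge> 0" and c: "c \<ge> 0"
    and m: "integrable (lebesgue_on {t0..t0 + 1}) m" "\<And>t. 0 \<le> m t"
    and m': "integrable (lebesgue_on {t0..t0 + 1}) m'" "\<And>t. 0 \<le> m' t"
    and f_osl: "AE t in lebesgue_on {t0..t0 + 1}. one_sided_Lipschitz_on L (cball x0 2) (\<lambda>y. f (t, y))"
    and f_bound: "AE t in lebesgue_on {t0..t0 + 1}. \<forall>y\<in>cball x0 2. norm (f (t, y)) \<le> m t"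
    and f'_meas: "f' \<in> borel_measurable lebesgue"
    and f'_cont: "\<And>t y. isCont (\<lambda>y. f' (t, y)) y"
    and f'_bound: "AE t in lebesgue_on {t0..t0 + 1}. \<forall>y\<in>cball x0 1. norm (f' (t, y)) \<le> m' t"
    and f'_Lip: "AE t in lebesgue_on {t0..t0 + 1}. \<forall>y\<in>cball x0 1. \<forall>z\<in>cball x0 1.
        norm (f' (t, y) - f' (t, z)) \<le> K * norm (y - z)"
    and fB: "fB \<in> borel_measurable borel" "AE t in lborel. AE y in lborel. f (t, y) = fB (t, y)"
    and \<Psi>: "\<Psi> \<in> borel_measurable borel" "\<And>z. norm (\<Psi> z) \<le> c"
    and \<Phi>\<Psi>: "AE t in lebesgue. AE \<tau> in lebesgue. t0 \<le> \<tau> \<and> \<tau> \<le> t \<and> t \<le> t0 + 1 \<longrightarrow> \<Phi> (t, \<tau>) = \<Psi> (t, \<tau>)"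
begin

abbreviation "J \<equiv> lebesgue_on {t0..t0 + 1}"

text \<open>Projecting the state to the unit ball around \<open>x0\<close> makes the right-hand side bounded along every curve, so that
the approximations exist on the whole unit interval. On a short interval they stay in that ball, where the
projection has no effect.\<close>

definition proj :: "real^'n \<Rightarrow> real^'n" where "proj = closest_point (cball x0 1)"

lemma proj_in: "proj y \<in> cball x0 1"
  unfolding proj_def by (rule closest_point_in_set) auto

lemma proj_id: "y \<in> cball x0 1 \<Longrightarrow> proj y = y"
  unfolding proj_def by (rule closest_point_self)

lemma continuous_proj: "continuous_on UNIV z \<Longrightarrow> continuous_on UNIV (\<lambda>t. proj (z t))"
  unfolding proj_def
  by (rule continuous_on_compose2[OF continuous_on_closest_point]) auto

lemma measurable_proj: "continuous_on UNIV z \<Longrightarrow> (\<lambda>t. proj (z t)) \<in> borel_measurable borel"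
  by (intro borel_measurable_continuous_onI continuous_proj)

definition step :: "nat \<Rightarrow> real" where "step n = inverse (real (Suc n))"

lemma step_pos: "step n > 0" and step_le: "step n \<le> 1"
  by (simp_all add: step_def inverse_eq_divide)

lemma step_tendsto: "step \<longlonglongrightarrow> 0"
  unfolding step_def by (rule LIMSEQ_inverse_real_of_nat)

text \<open>The right-hand side along a curve \<open>z\<close>: \<open>V\<close> is the contribution of \<open>f\<close>, \<open>W\<close> that of the memory
term with integrand \<open>Q\<close>. The curve enters only through its projection to the unit ball.\<close>

definition V :: "nat \<Rightarrow> (real \<Rightarrow> real^'n) \<Rightarrow> real \<Rightarrow> real^'n" where
  "V n z s = ball_average (\<lambda>y. fB (s, y)) (proj (z s)) (step n)"

definition Q :: "(real \<Rightarrow> real^'n) \<Rightarrow> real \<Rightarrow> real^'n" where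
  "Q z \<tau> = f' (\<tau>, proj (z \<tau>))"

definition W :: "(real \<Rightarrow> real^'n) \<Rightarrow> real \<Rightarrow> real^'n" where
  "W z = memory \<Psi> t0 (Q z)"

lemma integrable_J_const [simp]: "integrable J (\<lambda>_. k :: real)"
  by (intro finite_measure.integrable_const finite_measure_lebesgue_on) simp

lemma borel_measurable_J: "g \<in> borel_measurable borel \<Longrightarrow> g \<in> borel_measurable J"
  by (intro measurable_restrict_space1 measurable_completion) simp

lemma V_measurable: "continuous_on UNIV z \<Longrightarrow> V n z \<in> borel_measurable J"
  unfolding V_def[abs_def]
  by (intro borel_measurable_J borel_measurable_ball_average fB measurable_proj)

text \<open>The set of regular times depends neither on the index \<open>n\<close>, nor on the curve, nor on a removed
null set \<open>M\<close>. This is what permits the passage to the limit in \<open>n\<close> and the intersection over all \<open>M\<close>.\<close>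

definition regular_time :: "real \<Rightarrow> bool" where
  "regular_time t \<longleftrightarrow> one_sided_Lipschitz_on L (cball x0 2) (\<lambda>y. f (t, y)) \<and>
     (\<forall>y\<in>cball x0 2. norm (f (t, y)) \<le> m t) \<and> (AE y in lborel. f (t, y) = fB (t, y))"

lemma AE_regular_time: "AE t in J. regular_time t"
proof -
  have "AE t in J. AE y in lborel. f (t, y) = fB (t, y)"
    using AE_completion[OF fB(2)] by (subst AE_lebesgue_on_iff) (auto elim: eventually_mono)
  with f_osl f_bound show ?thesis unfolding regular_time_def by eventually_elim blast
qed

lemma regular_timeD:
  assumes t: "regular_time t"
  shows "one_sided_Lipschitz_on L (cball x0 2) (\<lambda>y. f (t, y))"
    and "y \<in> cball x0 2 \<Longrightarrow> norm (f (t, y)) \<le> m t"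
    and "M \<in> null_sets lebesgue \<Longrightarrow>
      V n z t \<in> closure (convex hull ((\<lambda>y. f (t, y)) ` (ball (proj (z t)) (step n) - M)))"
    and "norm (V n z t) \<le> m t"
proof -
  have bdd: "\<And>y. y \<in> cball x0 2 \<Longrightarrow> norm (f (t, y)) \<le> m t"
    and eq: "AE y in lborel. f (t, y) = fB (t, y)"
    using t by (simp_all add: regular_time_def)
  show "one_sided_Lipschitz_on L (cball x0 2) (\<lambda>y. f (t, y))"
    using t by (simp add: regular_time_def)
  show "norm (f (t, y)) \<le> m t" if "y \<in> cball x0 2" using that by (rule bdd)
  let ?B = "ball (proj (z t)) (step n)"
  have sub: "?B \<subseteq> cball x0 2"
  proof
    fix y assume "y \<in> ?B"
    then show "y \<in> cball x0 2"
      using proj_in[of "z t"] step_le[of n] dist_triangle[of x0 y "proj (z t)"] by auto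
  qed
  have meas: "(\<lambda>y. fB (t, y)) \<in> borel_measurable borel" using fB(1) by measurable
  have bd: "AE y in lborel. y \<in> ?B \<longrightarrow> norm (fB (t, y)) \<le> m t"
    using eq by eventually_elim (metis bdd sub subsetD)
  have "V n z t \<in> cball 0 (m t)"
    unfolding V_def by (rule ball_average_mem[OF meas step_pos _ _ bd]) (use bd in auto)
  then show "norm (V n z t) \<le> m t" by simp
  assume M: "M \<in> null_sets lebesgue"
  have "AE y in lborel. y \<notin> M"
    using AE_not_in[OF M] by (simp add: AE_completion_iff)
  with eq have mem: "AE y in lborel. y \<in> ?B \<longrightarrow>
      fB (t, y) \<in> closure (convex hull ((\<lambda>y. f (t, y)) ` (?B - M)))"
  proof eventually_elim
    case (elim y)
    show ?case
    proof
      assume "y \<in> ?B"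
      with elim have "fB (t, y) \<in> (\<lambda>y. f (t, y)) ` (?B - M)" by (metis DiffI image_eqI)
      then show "fB (t, y) \<in> closure (convex hull ((\<lambda>y. f (t, y)) ` (?B - M)))"
        by (intro subsetD[OF closure_subset] subsetD[OF hull_subset])
    qed
  qed
  show "V n z t \<in> closure (convex hull ((\<lambda>y. f (t, y)) ` (?B - M)))"
    unfolding V_def
    by (rule ball_average_mem[OF meas step_pos _ _ bd mem]) (simp_all add: convex_closure)
qed

lemma V_bound: "AE s in J. norm (V n z s) \<le> m s"
  using AE_regular_time by eventually_elim (rule regular_timeD(4))

lemma V_integrable: "continuous_on UNIV z \<Longrightarrow> integrable J (V n z)"
  by (rule Bochner_Integration.integrable_bound[OF m(1) V_measurable])
     (use V_bound[of n z] m(2) in \<open>auto elim: eventually_mono\<close>)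

lemma Q_measurable: "continuous_on UNIV z \<Longrightarrow> Q z \<in> borel_measurable lebesgue"
  unfolding Q_def[abs_def]
  by (rule lebesgue_measurable_composition[OF f'_meas measurable_proj f'_cont])

lemma Q_bound: "AE s in J. norm (Q z s) \<le> m' s"
  using f'_bound by eventually_elim (use proj_in in \<open>auto simp only: Q_def\<close>)

lemma Q_integrable: "continuous_on UNIV z \<Longrightarrow> integrable J (Q z)"
  by (rule Bochner_Integration.integrable_bound[OF m'(1)])
     (use Q_bound[of z] m'(2) Q_measurable in \<open>auto elim: eventually_mono intro: measurable_restrict_space1\<close>)

lemma W_measurable: "continuous_on UNIV z \<Longrightarrow> W z \<in> borel_measurable J"
  unfolding W_def by (intro measurable_restrict_space1 memory_measurable \<Psi> Q_measurable)

definition W_max :: real where "W_max = c * integral\<^sup>L J m'"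

lemma W_max_nonneg: "W_max \<ge> 0"
  unfolding W_max_def using c m'(2) by (intro mult_nonneg_nonneg Bochner_Integration.integral_nonneg) auto

lemma W_bound:
  assumes z: "continuous_on UNIV z" and t: "t \<in> {t0..t0 + 1}"
  shows "norm (W z t) \<le> W_max"
proof -
  have sub: "{t0..t} \<subseteq> {t0..t0 + 1}" using t by auto
  have mt: "integrable (lebesgue_on {t0..t}) m'"
    by (rule integrable_lebesgue_on_subset[OF m'(1) sub]) auto
  have "norm (memory \<Psi> t0 (Q z) t - memory \<Psi> t0 (\<lambda>_. 0) t) \<le> c * integral\<^sup>L (lebesgue_on {t0..t}) m'"
    by (rule memory_diff_le[OF \<Psi> Q_integrable[OF z] _ t _ mt])
       (use AE_lebesgue_on_subset[OF Q_bound[of z] sub] in auto)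
  also have "\<dots> \<le> W_max"
    unfolding W_max_def
  proof (rule mult_left_mono[OF _ c])
    have "integral {t0..t} m' \<le> integral {t0..t0 + 1} m'"
      using m' mt sub by (intro integral_subset_le integrable_on_lebesgue_on) auto
    then show "integral\<^sup>L (lebesgue_on {t0..t}) m' \<le> integral\<^sup>L J m'"
      using m' mt by (simp add: lebesgue_integral_eq_integral)
  qed
  finally show ?thesis by (simp add: W_def memory_def)
qed

lemma W_integrable: "continuous_on UNIV z \<Longrightarrow> integrable J (W z)"
  by (rule Bochner_Integration.integrable_bound[OF integrable_J_const[of W_max] W_measurable])
     (use W_bound W_max_nonneg in \<open>auto intro!: AE_I2\<close>)

text \<open>The memory term is Lipschitz in the past of the curve, with a constant that does not depend on time because the interval has
length at most 1.\<close>

lemma W_diff: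
  assumes z: "continuous_on UNIV z" "continuous_on UNIV z'" and t: "t \<in> {t0..t0 + 1}"
    and d: "\<And>\<tau>. \<tau> \<in> {t0..t} \<Longrightarrow> norm (proj (z \<tau>) - proj (z' \<tau>)) \<le> d" "d \<ge> 0"
  shows "norm (W z t - W z' t) \<le> c * K * d"
proof -
  have sub: "{t0..t} \<subseteq> {t0..t0 + 1}" using t by auto
  have "AE \<tau> in lebesgue_on {t0..t}. \<tau> \<in> {t0..t}"
    by (rule AE_I2) simp
  moreover have "AE \<tau> in lebesgue_on {t0..t}. \<forall>y\<in>cball x0 1. \<forall>z\<in>cball x0 1.
        norm (f' (\<tau>, y) - f' (\<tau>, z)) \<le> K * norm (y - z)"
    by (rule AE_lebesgue_on_subset[OF f'_Lip sub]) auto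
  ultimately have "AE \<tau> in lebesgue_on {t0..t}. norm (Q z \<tau> - Q z' \<tau>) \<le> K * d"
  proof eventually_elim
    case (elim \<tau>)
    have "norm (Q z \<tau> - Q z' \<tau>) \<le> K * norm (proj (z \<tau>) - proj (z' \<tau>))"
      unfolding Q_def using elim(2) proj_in by blast
    also have "\<dots> \<le> K * d" using d(1)[OF elim(1)] K by (rule mult_left_mono)
    finally show ?case .
  qed
  then have "norm (W z t - W z' t) \<le> c * integral\<^sup>L (lebesgue_on {t0..t}) (\<lambda>_. K * d)"
    unfolding W_def
    by (intro memory_diff_le[OF \<Psi> Q_integrable[OF z(1)] Q_integrable[OF z(2)] t])
       (auto intro!: finite_measure.integrable_const finite_measure_lebesgue_on)
  also have "integral\<^sup>L (lebesgue_on {t0..t}) (\<lambda>_. K * d) = (t - t0) * (K * d)"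
    using t by (simp add: measure_restrict_space)
  also have "c * \<dots> \<le> c * (1 * (K * d))"
    using t c K d(2) by (intro mult_left_mono mult_right_mono) auto
  finally show ?thesis by (simp add: mult.assoc)
qed

section \<open>Delayed approximations and their convergence\<close>

definition G :: "nat \<Rightarrow> (real \<Rightarrow> real^'n) \<Rightarrow> real \<Rightarrow> real^'n" where
  "G n z s = V n z s + W z s"

definition speed :: "real \<Rightarrow> real" where "speed s = m s + W_max"

lemma G_integrable: "continuous_on UNIV z \<Longrightarrow> integrable J (G n z)"
  unfolding G_def[abs_def] by (intro Bochner_Integration.integrable_add V_integrable W_integrable)

lemma G_integrable_on: "continuous_on UNIV z \<Longrightarrow> G n z integrable_on {t0..t0 + 1}"
  by (rule integrable_on_lebesgue_on[OF G_integrable]) auto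

lemma G_bound:
  assumes "continuous_on UNIV z"
  shows "AE s in J. norm (G n z s) \<le> speed s"
proof -
  have "AE s in J. s \<in> {t0..t0 + 1}" by (rule AE_I2) simp
  with V_bound[of n z] show ?thesis
  proof eventually_elim
    case (elim s)
    show ?case
      unfolding G_def speed_def
      by (rule norm_triangle_le[OF add_mono[OF elim(1) W_bound[OF assms elim(2)]]])
  qed
qed

lemma speed_integrable: "integrable J speed"
  unfolding speed_def[abs_def] using m(1) by simp

lemma speed_integrable_on: "speed integrable_on {t0..t0 + 1}"
  by (rule integrable_on_lebesgue_on[OF speed_integrable]) simp

lemma speed_nonneg: "0 \<le> speed s"
  unfolding speed_def using m(2)[of s] W_max_nonneg by simp

lemma G_causal:
  assumes "s \<in> {t0..t0 + 1}" and eq: "\<And>r. r \<le> s \<Longrightarrow> z r = z' r"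
  shows "G n z s = G n z' s"
proof -
  have "V n z s = V n z' s" unfolding V_def using eq by simp
  moreover have "W z s = W z' s"
    unfolding W_def memory_def
    by (rule Bochner_Integration.integral_cong[OF refl]) (use eq in \<open>auto simp: Q_def\<close>)
  ultimately show ?thesis by (simp add: G_def)
qed

definition is_approx :: "nat \<Rightarrow> (real \<Rightarrow> real^'n) \<Rightarrow> bool" where
  "is_approx n x \<longleftrightarrow> continuous_on UNIV x \<and> (\<forall>t\<le>t0. x t = x0) \<and>
     (\<forall>t\<in>{t0..t0 + 1}. x t = x0 + integral {t0..t} (G n (\<lambda>s. x (s - step n))))"

text \<open>The delayed Tonelli approximation: the averaging radius and the delay both equal \<open>step n\<close>.\<close>

definition X :: "nat \<Rightarrow> real \<Rightarrow> real^'n" where "X n = (SOME x. is_approx n x)"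

definition Y :: "nat \<Rightarrow> real \<Rightarrow> real^'n" where "Y n s = X n (s - step n)"

lemma X_approx: "is_approx n (X n)"
proof -
  obtain x where "continuous_on UNIV x" "\<And>t. t \<le> t0 \<Longrightarrow> x t = x0"
    "\<And>t. t \<in> {t0..t0 + 1} \<Longrightarrow> x t = x0 + integral {t0..t} (G n (\<lambda>s. x (s - step n)))"
  proof (rule delayed_integral_equation[where G = "G n" and h = "step n" and a = t0 and b = "t0 + 1" and \<xi> = x0])
    show "G n z integrable_on {t0..t0 + 1}" if "continuous_on UNIV z" for z
      using that by (rule G_integrable_on)
    show "G n z s = G n z' s" if "s \<in> {t0..t0 + 1}" "\<And>r. r \<le> s \<Longrightarrow> z r = z' r" for z z' s
      using that by (rule G_causal)
  qed (use step_pos in auto)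
  then have "is_approx n x" unfolding is_approx_def by blast
  then show ?thesis unfolding X_def by (rule someI[of "is_approx n" x])
qed

lemma X_continuous: "continuous_on UNIV (X n)"
  and X_before: "t \<le> t0 \<Longrightarrow> X n t = x0"
  and X_eq: "t \<in> {t0..t0 + 1} \<Longrightarrow> X n t = x0 + integral {t0..t} (G n (Y n))"
  using X_approx[of n] unfolding is_approx_def Y_def[abs_def] by blast+

lemma Y_continuous: "continuous_on UNIV (Y n)"
  unfolding Y_def[abs_def]
  by (rule continuous_on_compose2[OF X_continuous]) (auto intro!: continuous_intros)

lemma X_diff:
  assumes "t0 \<le> u" "u \<le> v" "v \<le> t0 + 1"
  shows "X n v - X n u = integral {u..v} (G n (Y n))"
    and "norm (X n v - X n u) \<le> integral {u..v} speed"
proof -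
  show "X n v - X n u = integral {u..v} (G n (Y n))"
    using assms integral_diff_interval[OF G_integrable_on[OF Y_continuous] assms] by (simp add: X_eq)
  then show "norm (X n v - X n u) \<le> integral {u..v} speed"
    using norm_integral_le_AE[OF G_integrable[OF Y_continuous] speed_integrable G_bound[OF Y_continuous]] assms
    by metis
qed

text \<open>The increments of \<open>\<Gamma>\<close> bound those of every approximation; the clamping of \<open>t\<close> accounts for the constant
history before \<open>t0\<close>.\<close>

definition \<Gamma> :: "real \<Rightarrow> real" where "\<Gamma> t = integral {t0..max t0 (min t (t0 + 1))} speed"

lemma \<Gamma>_continuous: "continuous_on UNIV \<Gamma>"
proof -
  have "continuous_on {t0..t0 + 1} (\<lambda>t. integral {t0..t} speed)"
    by (rule indefinite_integral_continuous_1[OF speed_integrable_on])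
  then show ?thesis
    unfolding \<Gamma>_def[abs_def] by (rule continuous_on_compose2) (auto intro!: continuous_intros)
qed

lemma X_diff_\<Gamma>:
  assumes "u \<le> v" "v \<le> t0 + 1"
  shows "norm (X n v - X n u) \<le> \<Gamma> v - \<Gamma> u"
proof -
  define u' v' where "u' = max t0 u" and "v' = max t0 v"
  have uv: "t0 \<le> u'" "u' \<le> v'" "v' \<le> t0 + 1" using assms by (auto simp: u'_def v'_def)
  have "X n u = X n u'" "X n v = X n v'"
    using X_before[of _ n] by (auto simp: u'_def v'_def max_def)
  moreover have "\<Gamma> v - \<Gamma> u = integral {u'..v'} speed"
    using integral_diff_interval[OF speed_integrable_on uv] assms
    by (simp add: \<Gamma>_def u'_def v'_def min_absorb1)
  ultimately show ?thesis using X_diff(2)[OF uv] by simp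
qed

text \<open>All approximations move at most with the integrable speed \<open>speed\<close>, so one time \<open>a\<close> serves all of them.\<close>

lemma short_time:
  obtains a where "0 < a" "a \<le> 1" "\<And>n t. t \<le> t0 + a \<Longrightarrow> X n t \<in> cball x0 1"
proof -
  have "isCont \<Gamma> t0" using \<Gamma>_continuous by (simp add: continuous_on_eq_continuous_at)
  from LIM_D[OF isContD[OF this], of 1] obtain d where d: "d > 0"
    "\<And>t. t \<noteq> t0 \<Longrightarrow> norm (t - t0) < d \<Longrightarrow> norm (\<Gamma> t - \<Gamma> t0) < 1" by auto
  show thesis
  proof (rule that[of "min 1 (d / 2)"])
    fix n t assume t: "t \<le> t0 + min 1 (d / 2)"
    show "X n t \<in> cball x0 1"
    proof (cases "t \<le> t0")
      case False
      then have "norm (X n t - X n t0) \<le> \<Gamma> t - \<Gamma> t0" using t by (intro X_diff_\<Gamma>) auto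
      also have "\<dots> < 1"
      proof -
        have "t \<le> t0 + d / 2" using t min.cobounded2[of 1 "d / 2"] by linarith
        then have "norm (t - t0) < d" using False d(1) by auto
        then have "norm (\<Gamma> t - \<Gamma> t0) < 1" using d(2)[of t] False by auto
        then show ?thesis by simp
      qed
      finally show ?thesis by (simp add: X_before dist_norm norm_minus_commute)
    qed (simp add: X_before)
  qed (use d in auto)
qed

definition accurate :: "nat \<Rightarrow> real \<Rightarrow> bool" where
  "accurate n \<sigma> \<longleftrightarrow> step n \<le> \<sigma> \<and> (\<forall>t\<in>{t0..t0 + 1}. norm (X n t - Y n t) \<le> \<sigma>)"

lemma accurateD:
  assumes "accurate n \<sigma>"
  shows "t \<in> {t0..t0 + 1} \<Longrightarrow> norm (X n t - Y n t) \<le> \<sigma>" "step n \<le> \<sigma>"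
  using assms by (simp_all add: accurate_def)

lemma eventually_accurate:
  assumes "\<sigma> > 0"
  obtains N where "\<And>n. n \<ge> N \<Longrightarrow> accurate n \<sigma>"
proof -
  have "uniformly_continuous_on {t0 - 1..t0 + 1} \<Gamma>"
    by (rule compact_uniformly_continuous[OF continuous_on_subset[OF \<Gamma>_continuous]]) auto
  then obtain d where d: "d > 0"
    "\<And>s t. s \<in> {t0 - 1..t0 + 1} \<Longrightarrow> t \<in> {t0 - 1..t0 + 1} \<Longrightarrow> dist t s < d \<Longrightarrow> dist (\<Gamma> t) (\<Gamma> s) < \<sigma>"
    using \<open>\<sigma> > 0\<close> unfolding uniformly_continuous_on_def by metis
  have "\<forall>\<^sub>F n in sequentially. step n < min d \<sigma>"
    by (rule order_tendstoD(2)[OF step_tendsto]) (use d \<open>\<sigma> > 0\<close> in simp)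
  then obtain N where N: "\<And>n. n \<ge> N \<Longrightarrow> step n < min d \<sigma>"
    by (auto simp: eventually_sequentially)
  show thesis
  proof (rule that[of N])
    fix n assume n: "n \<ge> N"
    have "norm (X n t - Y n t) \<le> \<sigma>" if t: "t \<in> {t0..t0 + 1}" for t
    proof -
      have "norm (X n t - Y n t) \<le> \<Gamma> t - \<Gamma> (t - step n)"
        unfolding Y_def using step_pos[of n] t by (intro X_diff_\<Gamma>) auto
      also have "\<dots> \<le> \<sigma>"
        using d(2)[of "t - step n" t] N[OF n] t step_le[of n] step_pos[of n] by (auto simp: dist_real_def)
      finally show ?thesis .
    qed
    then show "accurate n \<sigma>" unfolding accurate_def using N[OF n] by simp
  qed
qed

definition rate :: real where "rate = 2 * L + 2 * (c * K) + 1"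

definition defect :: "real \<Rightarrow> real" where "defect t = 8 * m t + 32 * L + c * K"

lemma rate_pos: "rate > 0"
  unfolding rate_def using L c K by (simp add: add_nonneg_pos)

lemma defect_nonneg: "0 \<le> defect t"
  unfolding defect_def using L c K m(2)[of t] by simp

lemma defect_integrable: "integrable J defect"
  unfolding defect_def[abs_def] using m(1) by simp

text \<open>This is the uniqueness estimate for two approximations, with a defect. Delay and averaging displace the points
at which \<open>f\<close> is evaluated by at most a multiple of \<open>\<sigma>\<close>. The hull estimate and the bound on \<open>f\<close> turn
this into an error of size \<open>\<sigma>\<close> times an integrable function of time.\<close>

lemma energy_estimate:
  assumes a: "0 < a" "a \<le> 1" "\<And>n t. t \<le> t0 + a \<Longrightarrow> X n t \<in> cball x0 1"
    and \<sigma>: "0 < \<sigma>" "\<sigma> \<le> 1"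
    and n: "accurate n \<sigma>" and k: "accurate k \<sigma>"
    and t: "t \<in> {t0..t0 + a}"
    and regular: "regular_time t"
    and R: "\<And>s. s \<in> {t0..t} \<Longrightarrow> norm (X n s - X k s) \<le> R"
  shows "(X n t - X k t) \<bullet> (G n (Y n) t - G k (Y k) t) \<le> rate * R\<^sup>2 + \<sigma> * defect t"
proof -
  note n = accurateD[OF n] and k = accurateD[OF k]
  note osl = regular_timeD(1)[OF regular] and bd = regular_timeD(2)[OF regular] and V = regular_timeD(3)[OF regular]
  have t1: "t \<in> {t0..t0 + 1}" using t a by auto
  have Yin: "Y j s \<in> cball x0 1" if "s \<le> t0 + a" for j s
    unfolding Y_def by (rule a(3)) (use that step_pos[of j] in linarith)
  have R0: "R \<ge> 0" using R[of t0] t by (auto intro: order_trans[OF norm_ge_zero])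
  have YY: "norm (Y n s - Y k s) \<le> R + 2 * \<sigma>" "norm ((X n s - X k s) - (Y n s - Y k s)) \<le> 2 * \<sigma>" if s: "s \<in> {t0..t}" for s
  proof -
    have s1: "s \<in> {t0..t0 + 1}" using s t1 by auto
    have eq: "(X n s - X k s) - (Y n s - Y k s) = (X n s - Y n s) - (X k s - Y k s)" by simp
    show 1: "norm ((X n s - X k s) - (Y n s - Y k s)) \<le> 2 * \<sigma>"
      unfolding eq
      using norm_triangle_ineq4[of "X n s - Y n s" "X k s - Y k s"] n(1)[OF s1] k(1)[OF s1] by linarith
    show "norm (Y n s - Y k s) \<le> R + 2 * \<sigma>"
      using norm_triangle_ineq4[of "X n s - X k s" "(X n s - X k s) - (Y n s - Y k s)"] 1 R[OF s] by simp
  qed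
  define p q v v' where "p = Y n t" and "q = Y k t" and "v = V n (Y n) t" and "v' = V k (Y k) t"
  have pq: "p \<in> cball x0 1" "q \<in> cball x0 1" using Yin t by (auto simp: p_def q_def)
  have v: "v \<in> closure (convex hull ((\<lambda>y. f (t, y)) ` ball p (step n)))" "norm v \<le> m t"
    and v': "v' \<in> closure (convex hull ((\<lambda>y. f (t, y)) ` ball q (step k)))" "norm v' \<le> m t"
    using V[of "{}" n "Y n"] V[of "{}" k "Y k"] proj_id[OF pq(1)] proj_id[OF pq(2)]
      regular_timeD(4)[OF regular, of n "Y n"] regular_timeD(4)[OF regular, of k "Y k"]
    unfolding v_def v'_def p_def q_def by simp_all
  have sub: "ball y (step j) \<subseteq> cball x0 2" if y: "y \<in> cball x0 1" for y j
  proof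
    fix z assume "z \<in> ball y (step j)"
    then show "z \<in> cball x0 2" using y step_le[of j] dist_triangle[of x0 z y] by auto
  qed
  have hull: "(p - q) \<bullet> (v - v') \<le> L * (norm (p - q) + (step n + step k))\<^sup>2 + 2 * m t * (step n + step k)"
    by (rule one_sided_Lipschitz_hull[OF osl L _ sub[OF pq(1)] sub[OF pq(2)] step_pos step_pos v(1) v'(1)])
       (rule bd)
  have 1: "(p - q) \<bullet> (v - v') \<le> L * (2 * R\<^sup>2 + 32 * \<sigma>) + 4 * m t * \<sigma>"
  proof -
    have "norm (p - q) + (step n + step k) \<le> R + 4 * \<sigma>"
      using YY(1)[of t] t n(2) k(2) by (auto simp: p_def q_def)
    then have "(norm (p - q) + (step n + step k))\<^sup>2 \<le> (R + 4 * \<sigma>)\<^sup>2"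
      using step_pos[of n] step_pos[of k] by (intro power_mono) auto
    also have "\<dots> \<le> 2 * R\<^sup>2 + 32 * \<sigma>\<^sup>2"
      using zero_le_power2[of "R - 4 * \<sigma>"] by (simp add: power2_sum power2_diff power_mult_distrib)
    also have "\<dots> \<le> 2 * R\<^sup>2 + 32 * \<sigma>"
      using \<sigma> mult_left_le[of \<sigma> \<sigma>] by (simp add: power2_eq_square)
    finally have "L * (norm (p - q) + (step n + step k))\<^sup>2 \<le> L * (2 * R\<^sup>2 + 32 * \<sigma>)"
      using L by (rule mult_left_mono)
    moreover have "2 * m t * (step n + step k) \<le> 2 * m t * (2 * \<sigma>)"
      using n(2) k(2) m(2)[of t] by (intro mult_left_mono) auto
    ultimately show ?thesis using hull by linarith
  qed
  have 2: "((X n t - X k t) - (p - q)) \<bullet> (v - v') \<le> 4 * m t * \<sigma>"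
  proof -
    have "norm (v - v') \<le> 2 * m t" using norm_triangle_ineq4[of v v'] v v' by linarith
    then have "norm ((X n t - X k t) - (p - q)) * norm (v - v') \<le> (2 * \<sigma>) * (2 * m t)"
      using YY(2)[of t] t \<sigma> by (intro mult_mono) (auto simp: p_def q_def)
    then show ?thesis
      using norm_cauchy_schwarz[of "(X n t - X k t) - (p - q)" "v - v'"] by (simp add: mult_ac)
  qed
  have 3: "(X n t - X k t) \<bullet> (W (Y n) t - W (Y k) t) \<le> c * K * (2 * R\<^sup>2 + \<sigma>)"
  proof -
    have "norm (W (Y n) t - W (Y k) t) \<le> c * K * (R + 2 * \<sigma>)"
    proof (rule W_diff[OF Y_continuous Y_continuous t1])
      fix \<tau> assume \<tau>: "\<tau> \<in> {t0..t}"
      then have "\<tau> \<le> t0 + a" using t by auto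
      then show "norm (proj (Y n \<tau>) - proj (Y k \<tau>)) \<le> R + 2 * \<sigma>"
        using YY(1)[OF \<tau>] proj_id[OF Yin] by simp
    qed (use R0 \<sigma> in auto)
    then have "norm (X n t - X k t) * norm (W (Y n) t - W (Y k) t) \<le> R * (c * K * (R + 2 * \<sigma>))"
      using R[of t] t R0 by (intro mult_mono) auto
    also have "\<dots> = c * K * (R\<^sup>2 + 2 * R * \<sigma>)" by (simp add: algebra_simps power2_eq_square)
    also have "\<dots> \<le> c * K * (2 * R\<^sup>2 + \<sigma>)"
    proof (rule mult_left_mono)
      have "2 * R * \<sigma> \<le> R\<^sup>2 + \<sigma>\<^sup>2" using zero_le_power2[of "R - \<sigma>"] by (simp add: power2_diff)
      also have "\<sigma>\<^sup>2 \<le> \<sigma>" using \<sigma> mult_left_le[of \<sigma> \<sigma>] by (simp add: power2_eq_square)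
      finally show "R\<^sup>2 + 2 * R * \<sigma> \<le> 2 * R\<^sup>2 + \<sigma>" by simp
    qed (use c K in simp)
    finally show ?thesis
      using norm_cauchy_schwarz[of "X n t - X k t" "W (Y n) t - W (Y k) t"] by linarith
  qed
  have "(X n t - X k t) \<bullet> (G n (Y n) t - G k (Y k) t)
     = (p - q) \<bullet> (v - v') + ((X n t - X k t) - (p - q)) \<bullet> (v - v') + (X n t - X k t) \<bullet> (W (Y n) t - W (Y k) t)"
    unfolding G_def v_def v'_def by (simp add: algebra_simps)
  also have "\<dots> \<le> L * (2 * R\<^sup>2 + 32 * \<sigma>) + 4 * m t * \<sigma> + 4 * m t * \<sigma> + c * K * (2 * R\<^sup>2 + \<sigma>)"
    using 1 2 3 by linarith
  also have "\<dots> \<le> rate * R\<^sup>2 + \<sigma> * defect t"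
    unfolding rate_def defect_def by (simp add: algebra_simps)
  finally show ?thesis .
qed

text \<open>Gronwall's inequality applied to the energy estimate: the bound tends to 0 with \<open>\<sigma>\<close>, uniformly in \<open>t\<close>, so the approximations
form a uniform Cauchy sequence.\<close>

lemma X_close:
  assumes a: "0 < a" "a \<le> 1" "\<And>n t. t \<le> t0 + a \<Longrightarrow> X n t \<in> cball x0 1"
    and \<sigma>: "0 < \<sigma>" "\<sigma> \<le> 1"
    and n: "accurate n \<sigma>" and k: "accurate k \<sigma>"
    and t: "t \<in> {t0..t0 + a}"
  shows "(norm (X n t - X k t))\<^sup>2 \<le> 4 * \<sigma> * integral {t0..t0 + a} defect * exp (4 * rate * a)"
proof -
  have sub: "{t0..t0 + a} \<subseteq> {t0..t0 + 1}" using a by auto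
  have GI: "G j (Y j) integrable_on {t0..t0 + a}" for j
    by (rule integrable_on_subinterval[OF G_integrable_on[OF Y_continuous] sub])
  obtain N where N: "negligible N" "\<And>s. s \<in> {t0..t0 + 1} - N \<Longrightarrow> regular_time s"
    using AE_lebesgue_on_negligibleE[OF AE_regular_time] by blast
  have "\<exists>N. negligible N \<and> (\<forall>s\<in>{t0..t0 + a} - N. (X j has_vector_derivative G j (Y j) s) (at s within {t0..t0 + a}))" for j
  proof -
    from indefinite_integral_has_vector_derivative_AE[OF GI[of j]] obtain N where N: "negligible N"
      "\<And>s. s \<in> {t0..t0 + a} - N \<Longrightarrow>
        ((\<lambda>r. integral {t0..r} (G j (Y j))) has_vector_derivative G j (Y j) s) (at s within {t0..t0 + a})" by blast
    have "(X j has_vector_derivative G j (Y j) s) (at s within {t0..t0 + a})" if s: "s \<in> {t0..t0 + a} - N" for s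
    proof (rule has_vector_derivative_transform)
      show "((\<lambda>r. x0 + integral {t0..r} (G j (Y j))) has_vector_derivative G j (Y j) s) (at s within {t0..t0 + a})"
        using has_vector_derivative_add[OF has_vector_derivative_const N(2)[OF s], of x0] by simp
      show "s \<in> {t0..t0 + a}" using s by simp
      show "X j r = x0 + integral {t0..r} (G j (Y j))" if "r \<in> {t0..t0 + a}" for r
        using X_eq[of r j] that sub by auto
    qed
    with N(1) show ?thesis by blast
  qed
  then obtain D where D: "\<And>j. negligible (D j)"
    "\<And>j s. s \<in> {t0..t0 + a} - D j \<Longrightarrow> (X j has_vector_derivative G j (Y j) s) (at s within {t0..t0 + a})"
    by metis
  have "(norm (X n t - X k t))\<^sup>2 \<le> 4 * \<sigma> * integral {t0..t0 + a} defect * exp (4 * rate * (t0 + a - t0))"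
  proof (rule gronwall_memory[where N = "N \<union> D n \<union> D k" and e = "\<lambda>t. X n t - X k t"])
    show "t0 \<le> t0 + a" using a by simp
    have sI: "(\<lambda>t. 2 * speed t) integrable_on {t0..t0 + a}"
      by (intro integrable_on_mult_right integrable_on_subinterval[OF speed_integrable_on sub])
    show "abs_cont t0 (t0 + a) (\<lambda>t. X n t - X k t)"
    proof (rule abs_cont_if_integral_bound[OF sI])
      show "0 \<le> 2 * speed t" for t using speed_nonneg[of t] by simp
      fix u v assume uv: "t0 \<le> u" "u \<le> v" "v \<le> t0 + a"
      then have uv': "t0 \<le> u" "u \<le> v" "v \<le> t0 + 1" using a by auto
      have "norm ((X n v - X k v) - (X n u - X k u)) = norm ((X n v - X n u) - (X k v - X k u))"
        by (simp add: algebra_simps)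
      also have "\<dots> \<le> norm (X n v - X n u) + norm (X k v - X k u)" by (rule norm_triangle_ineq4)
      also have "\<dots> \<le> 2 * integral {u..v} speed"
        using X_diff(2)[OF uv', of n] X_diff(2)[OF uv', of k] by simp
      finally show "norm ((X n v - X k v) - (X n u - X k u)) \<le> integral {u..v} (\<lambda>t. 2 * speed t)" by simp
    qed
    show "X n t0 - X k t0 = 0" by (simp add: X_before)
    show "defect integrable_on {t0..t0 + a}"
      by (rule integrable_on_subinterval[OF integrable_on_lebesgue_on[OF defect_integrable] sub]) simp
    show "0 \<le> defect t" for t by (rule defect_nonneg)
    show "negligible (N \<union> D n \<union> D k)" using N D by (intro negligible_Un)
    fix s assume s: "s \<in> {t0..t0 + a} - (N \<union> D n \<union> D k)"
    then have s': "s \<in> {t0..t0 + a}" "s \<in> {t0..t0 + 1} - N"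
      "s \<in> {t0..t0 + a} - D n" "s \<in> {t0..t0 + a} - D k" using sub by auto
    have "((\<lambda>t. X n t - X k t) has_vector_derivative G n (Y n) s - G k (Y k) s) (at s within {t0..t0 + a})"
      by (intro has_vector_derivative_diff D(2) s')
    moreover have "(X n s - X k s) \<bullet> (G n (Y n) s - G k (Y k) s) \<le> rate * R\<^sup>2 + \<sigma> * defect s"
      if R: "\<forall>r\<in>{t0..s}. norm (X n r - X k r) \<le> R" for R
      by (rule energy_estimate[OF a \<sigma> n k s'(1) N(2)[OF s'(2)]]) (use R in auto)
    ultimately show "\<exists>d. ((\<lambda>t. X n t - X k t) has_vector_derivative d) (at s within {t0..t0 + a}) \<and>
       (\<forall>R. (\<forall>r\<in>{t0..s}. norm (X n r - X k r) \<le> R) \<longrightarrow> (X n s - X k s) \<bullet> d \<le> rate * R\<^sup>2 + \<sigma> * defect s)"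
      by blast
  qed (use \<sigma> t rate_pos in auto)
  then show ?thesis by simp
qed

section \<open>Existence\<close>

definition X_lim :: "real \<Rightarrow> real^'n" where "X_lim t = lim (\<lambda>n. X n t)"

lemma uniform_approximation:
  assumes a: "0 < a" "a \<le> 1" "\<And>n t. t \<le> t0 + a \<Longrightarrow> X n t \<in> cball x0 1" and "e > 0"
  shows "\<exists>N. \<forall>n\<ge>N. step n \<le> e \<and> (\<forall>t\<in>{t0..t0 + a}.
    norm (X n t - X_lim t) \<le> e \<and> norm (Y n t - X_lim t) \<le> e)"
proof -
  define B where "B = 4 * integral {t0..t0 + a} defect * exp (4 * rate * a)"
  have "integral {t0..t0 + a} defect \<ge> 0"
    by (rule integral_nonneg[OF integrable_on_subinterval[OF integrable_on_lebesgue_on[OF defect_integrable]]])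
       (use a defect_nonneg in auto)
  then have B: "B \<ge> 0" by (simp add: B_def)
  have cauchy: "\<exists>N. \<forall>n\<ge>N. \<forall>k\<ge>N. step n \<le> e \<and> (\<forall>t\<in>{t0..t0 + a}.
     norm (X n t - Y n t) \<le> e \<and> norm (X n t - X k t) \<le> e)" if "e > 0" for e
  proof -
    \<comment> \<open>The squared distance of two late approximations is at most \<open>\<sigma> B\<close>.\<close>
    define \<sigma> where "\<sigma> = min (min 1 e) (e\<^sup>2 / (B + 1))"
    have \<sigma>: "0 < \<sigma>" "\<sigma> \<le> 1" "\<sigma> \<le> e" using \<open>e > 0\<close> B by (auto simp: \<sigma>_def)
    have "\<sigma> * B \<le> \<sigma> * (B + 1)" using \<sigma> by simp
    also have "\<dots> \<le> e\<^sup>2 / (B + 1) * (B + 1)" using B by (intro mult_right_mono) (auto simp: \<sigma>_def)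
    also have "\<dots> = e\<^sup>2" using B by simp
    finally have \<sigma>B: "\<sigma> * B \<le> e\<^sup>2" .
    obtain N where N: "\<And>n. n \<ge> N \<Longrightarrow> accurate n \<sigma>"
      using eventually_accurate[OF \<sigma>(1)] by blast
    have "norm (X n t - X k t) \<le> e" if "n \<ge> N" "k \<ge> N" "t \<in> {t0..t0 + a}" for n k t
    proof -
      have "(norm (X n t - X k t))\<^sup>2 \<le> 4 * \<sigma> * integral {t0..t0 + a} defect * exp (4 * rate * a)"
        by (rule X_close[OF a \<sigma>(1,2) N[OF that(1)] N[OF that(2)] that(3)])
      also have "\<dots> = \<sigma> * B" by (simp add: B_def mult_ac)
      also note \<sigma>B
      finally show ?thesis by (rule power2_le_imp_le) (use \<open>e > 0\<close> in simp)
    qed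
    moreover have "norm (X n t - Y n t) \<le> e" if "n \<ge> N" "t \<in> {t0..t0 + a}" for n t
      using accurateD(1)[OF N[OF that(1)], of t] that(2) a \<sigma>(3) by auto
    moreover have "step n \<le> e" if "n \<ge> N" for n using accurateD(2)[OF N[OF that]] \<sigma>(3) by simp
    ultimately show ?thesis by blast
  qed
  have lim: "(\<lambda>n. X n t) \<longlonglongrightarrow> X_lim t" if t: "t \<in> {t0..t0 + a}" for t
  proof -
    have "Cauchy (\<lambda>n. X n t)"
    proof (rule CauchyI)
      fix e :: real assume "e > 0"
      then have "e / 2 > 0" by simp
      from cauchy[OF this] obtain N where "\<forall>n\<ge>N. \<forall>k\<ge>N. norm (X n t - X k t) \<le> e / 2" using t by blast
      moreover have "e / 2 < e" using \<open>e > 0\<close> by simp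
      ultimately show "\<exists>N. \<forall>n\<ge>N. \<forall>k\<ge>N. norm (X n t - X k t) < e" by (meson le_less_trans)
    qed
    then show ?thesis by (simp add: X_lim_def Cauchy_convergent_iff convergent_LIMSEQ_iff)
  qed
  have "e / 2 > 0" using \<open>e > 0\<close> by simp
  from cauchy[OF this] obtain N where N: "\<And>n. n \<ge> N \<Longrightarrow> step n \<le> e / 2"
    "\<And>n k t. n \<ge> N \<Longrightarrow> k \<ge> N \<Longrightarrow> t \<in> {t0..t0 + a} \<Longrightarrow> norm (X n t - X k t) \<le> e / 2"
    "\<And>n t. n \<ge> N \<Longrightarrow> t \<in> {t0..t0 + a} \<Longrightarrow> norm (X n t - Y n t) \<le> e / 2" by blast
  have 1: "norm (X n t - X_lim t) \<le> e / 2" if "n \<ge> N" "t \<in> {t0..t0 + a}" for n t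
    by (rule Lim_bounded[OF tendsto_norm[OF tendsto_diff[OF tendsto_const lim[OF that(2)]]], of N])
       (use N(2)[OF that(1) _ that(2)] in auto)
  have 2: "norm (Y n t - X_lim t) \<le> e" if "n \<ge> N" "t \<in> {t0..t0 + a}" for n t
    using norm_triangle_ineq4[of "X n t - X_lim t" "X n t - Y n t"] 1[OF that] N(3)[OF that] by simp
  show ?thesis
    using N(1) 1 2 \<open>e > 0\<close> by (intro exI[of _ N]) (fastforce intro: order_trans)
qed

text \<open>The velocity of the limit curve is split into its memory part, for which uniform convergence passes through the
integral, and the remainder \<open>u\<close>, which \<open>weak_limit_selection\<close> extracts from the averages. Membership of
\<open>u t\<close> in the regularization follows because the averaging balls eventually lie in any
fixed ball around the limit \<open>x t\<close>.\<close>

lemma solution_exists: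
  "\<exists>a>0. \<exists>x. Filippov_solution \<Phi> f f' t0 x0 {t0..<t0 + a} x"
proof -
  obtain a where a: "0 < a" "a \<le> 1" "\<And>n t. t \<le> t0 + a \<Longrightarrow> X n t \<in> cball x0 1"
    using short_time by blast
  define x where "x = X_lim"
  define T where "T = {t0..t0 + a}"
  have sub: "T \<subseteq> {t0..t0 + 1}" using a by (auto simp: T_def)
  have Tl: "T \<in> sets lebesgue" by (simp add: T_def)
  have approx: "\<exists>N. \<forall>n\<ge>N. step n \<le> e \<and> (\<forall>t\<in>T. norm (X n t - x t) \<le> e \<and> norm (Y n t - x t) \<le> e)"
    if "e > 0" for e
    using uniform_approximation[OF a that] unfolding x_def T_def .
  have ul: "uniform_limit T X x sequentially"
    unfolding uniform_limit_iff
  proof (intro allI impI)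
    fix e :: real assume "e > 0"
    then have "e / 2 > 0" "e / 2 < e" by auto
    from approx[OF this(1)] obtain N where "\<forall>n\<ge>N. \<forall>t\<in>T. norm (X n t - x t) \<le> e / 2" by blast
    then show "\<forall>\<^sub>F n in sequentially. \<forall>t\<in>T. dist (X n t) (x t) < e"
      using \<open>e / 2 < e\<close> unfolding eventually_sequentially dist_norm by (meson le_less_trans)
  qed
  have lim: "(\<lambda>n. X n t) \<longlonglongrightarrow> x t" if "t \<in> T" for t
    using tendsto_uniform_limitI[OF ul that] .
  have x_cont: "continuous_on T x"
    by (rule uniform_limit_theorem[OF _ ul])
       (auto intro: continuous_on_subset[OF X_continuous] eventuallyI)
  have x_in: "x t \<in> cball x0 1" if "t \<in> T" for t
    by (rule Lim_in_closed_set[OF closed_cball _ sequentially_bot lim[OF that]])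
       (use a(3) that in \<open>auto simp: T_def\<close>)
  have "(\<lambda>n. X n t0) \<longlonglongrightarrow> x t0" using a by (intro lim) (simp add: T_def)
  then have x_t0: "x t0 = x0" by (simp add: X_before LIMSEQ_const_iff)
  \<comment> \<open>The limit, extended to a continuous curve on the whole line, can be fed into \<open>W\<close>.\<close>
  define y where "y t = x (max t0 (min t (t0 + a)))" for t
  have y_cont: "continuous_on UNIV y"
    unfolding y_def by (rule continuous_on_compose2[OF x_cont]) (use a in \<open>auto simp: T_def intro!: continuous_intros\<close>)
  have y_eq: "y t = x t" "proj (y t) = x t" if "t \<in> T" for t
    using that proj_id[OF x_in[OF that]] by (auto simp: y_def T_def max_absorb2 min_absorb1)
  have W_conv: "norm (W (Y n) t - W y t) \<le> c * K * e"
    if n: "\<forall>t\<in>T. norm (Y n t - x t) \<le> e" and t: "t \<in> T" and "e \<ge> 0" for n t e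
  proof (rule W_diff[OF Y_continuous y_cont])
    show "t \<in> {t0..t0 + 1}" using t sub by blast
    fix \<tau> assume "\<tau> \<in> {t0..t}"
    then have \<tau>: "\<tau> \<in> T" using t by (auto simp: T_def)
    have "Y n \<tau> \<in> cball x0 1"
      unfolding Y_def by (rule a(3)) (use \<tau> step_pos[of n] in \<open>auto simp: T_def\<close>)
    then show "norm (proj (Y n \<tau>) - proj (y \<tau>)) \<le> e"
      using n \<tau> by (simp add: proj_id y_eq(2))
  qed fact
  \<comment> \<open>The approximations and their memory terms converge uniformly, so the integrals of the remaining part of
    the velocities converge as well.\<close>
  have V_lim: "(\<lambda>n. integral {t0..t} (V n (Y n))) \<longlonglongrightarrow> x t - x0 - integral {t0..t} (W y)" if t: "t \<in> T" for t
  proof (rule LIMSEQ_I)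
    fix e :: real assume "e > 0"
    have st: "{t0..t} \<subseteq> {t0..t0 + 1}" using t sub by (auto simp: T_def)
    define d where "d = e / 2 / (1 + c * K)"
    have cK: "c * K \<ge> 0" using c K by simp
    then have "d > 0" using \<open>e > 0\<close> by (simp add: d_def)
    from approx[OF this] obtain N where N: "\<And>n. n \<ge> N \<Longrightarrow> \<forall>t\<in>T. norm (X n t - x t) \<le> d"
      "\<And>n. n \<ge> N \<Longrightarrow> \<forall>t\<in>T. norm (Y n t - x t) \<le> d" by blast
    have "norm (integral {t0..t} (V n (Y n)) - (x t - x0 - integral {t0..t} (W y))) < e" if n: "n \<ge> N" for n
    proof -
      have I: "g integrable_on {t0..t}" if "integrable J g" for g :: "real \<Rightarrow> real^'n"
        by (rule integrable_on_subinterval[OF integrable_on_lebesgue_on[OF that] st]) simp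
      note iV = I[OF V_integrable[OF Y_continuous, of n n]] and iW = I[OF W_integrable[OF Y_continuous, of n]]
        and iWy = I[OF W_integrable[OF y_cont]]
      have "X n t = x0 + (integral {t0..t} (V n (Y n)) + integral {t0..t} (W (Y n)))"
        using X_eq[of t n] t sub Henstock_Kurzweil_Integration.integral_add[OF iV iW]
        by (auto simp: G_def[abs_def])
      then have eq: "integral {t0..t} (V n (Y n)) - (x t - x0 - integral {t0..t} (W y))
          = (X n t - x t) - (integral {t0..t} (W (Y n)) - integral {t0..t} (W y))"
        by (simp add: algebra_simps)
      have "norm ((X n t - x t) - (integral {t0..t} (W (Y n)) - integral {t0..t} (W y)))
          \<le> norm (X n t - x t) + norm (integral {t0..t} (W (Y n)) - integral {t0..t} (W y))"
        by (rule norm_triangle_ineq4)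
      also have "\<dots> \<le> d + c * K * d"
      proof (rule add_mono)
        show "norm (X n t - x t) \<le> d" using N(1)[OF n] t by blast
        have "norm (integral {t0..t} (\<lambda>s. W (Y n) s - W y s)) \<le> integral {t0..t} (\<lambda>_. c * K * d)"
        proof (rule integral_norm_bound_integral)
          show "(\<lambda>s. W (Y n) s - W y s) integrable_on {t0..t}" by (rule integrable_diff[OF iW iWy])
          show "norm (W (Y n) s - W y s) \<le> c * K * d" if "s \<in> {t0..t}" for s
            by (rule W_conv[OF N(2)[OF n]]) (use that t \<open>d > 0\<close> in \<open>auto simp: T_def\<close>)
        qed auto
        also have "\<dots> = (t - t0) * (c * K * d)"
          using t by (simp add: T_def)
        also have "\<dots> \<le> 1 * (c * K * d)"
        proof (rule mult_right_mono)
          show "t - t0 \<le> 1" using t a by (simp add: T_def)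
          show "0 \<le> c * K * d" using cK \<open>d > 0\<close> by simp
        qed
        finally show "norm (integral {t0..t} (W (Y n)) - integral {t0..t} (W y)) \<le> c * K * d"
          by (simp add: Henstock_Kurzweil_Integration.integral_diff[OF iW iWy])
      qed
      also have "\<dots> = (1 + c * K) * d" by (simp add: algebra_simps)
      also have "\<dots> = e / 2"
      proof -
        have "1 + c * K \<noteq> 0" using cK by linarith
        then show ?thesis unfolding d_def by (metis nonzero_mult_div_cancel_left times_divide_eq_right)
      qed
      finally show ?thesis unfolding eq using \<open>e > 0\<close> by simp
    qed
    then show "\<exists>N. \<forall>n\<ge>N. norm (integral {t0..t} (V n (Y n)) - (x t - x0 - integral {t0..t} (W y))) < e" by blast
  qed
  have JT: "integrable (lebesgue_on T) g" if "integrable J g" for g :: "real \<Rightarrow> 'b::euclidean_space"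
    by (rule integrable_lebesgue_on_subset[OF that sub]) (auto simp: T_def)
  have AET: "AE t in lebesgue_on T. P t" if "AE t in J. P t" for P
    by (rule AE_lebesgue_on_subset[OF that sub]) (auto simp: T_def)
  have set_int: "(\<integral>\<tau>\<in>{t0..t}. g \<tau> \<partial>lebesgue_on T) = integral {t0..t} g"
    if "integrable (lebesgue_on T) g" "t \<in> T" for g :: "real \<Rightarrow> real^'n" and t
    using set_integral_lebesgue_on_interval[of t0 "t0 + a" g t] that by (simp add: T_def)
  \<comment> \<open>The limits are indexed by the intervals \<open>[t0, t]\<close>; \<open>Sup\<close> recovers \<open>t\<close>.\<close>
  have "\<exists>u. u \<in> borel_measurable (lebesgue_on T) \<and> (AE t in lebesgue_on T. norm (u t) \<le> m t + 1) \<and>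
    (AE t in lebesgue_on T. \<forall>k. u t \<in> closure (convex hull ((\<lambda>j. V j (Y j) t) ` {k..}))) \<and>
    (\<forall>S\<in>(\<lambda>t. {t0..t}) ` T. (\<integral>t\<in>S. u t \<partial>lebesgue_on T) = x (Sup S) - x0 - integral S (W y))"
  proof (rule weak_limit_selection[where M = "lebesgue_on T" and m = "\<lambda>t. m t + 1" and v = "\<lambda>n. V n (Y n)"
        and \<S> = "(\<lambda>t. {t0..t}) ` T" and z = "\<lambda>S. x (Sup S) - x0 - integral S (W y)"])
    show "integrable (lebesgue_on T) (\<lambda>t. m t + 1)"
      by (rule JT) (intro Bochner_Integration.integrable_add m(1) integrable_J_const)
    show "0 < m t + 1" for t using m(2)[of t] by simp
    show "V k (Y k) \<in> borel_measurable (lebesgue_on T)" for k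
      by (rule borel_measurable_integrable[OF JT[OF V_integrable[OF Y_continuous]]])
    show "AE t in lebesgue_on T. norm (V k (Y k) t) \<le> m t + 1" for k
      using AET[OF V_bound[of k "Y k"]] by eventually_elim simp
    show "S \<in> sets (lebesgue_on T)" if "S \<in> (\<lambda>t. {t0..t}) ` T" for S
      using that by (auto simp: sets_restrict_space_iff Tl T_def)
    show "(\<lambda>k. \<integral>t\<in>S. V k (Y k) t \<partial>lebesgue_on T) \<longlonglongrightarrow> x (Sup S) - x0 - integral S (W y)"
      if S: "S \<in> (\<lambda>t. {t0..t}) ` T" for S
    proof -
      from S obtain t where t: "t \<in> T" "S = {t0..t}" by blast
      then have "Sup S = t" by (auto simp: T_def)
      with V_lim[OF t(1)] show ?thesis
        by (simp add: t(2) set_int[OF JT[OF V_integrable[OF Y_continuous]] t(1)])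
    qed
  qed blast
  then obtain u where u: "u \<in> borel_measurable (lebesgue_on T)" "AE t in lebesgue_on T. norm (u t) \<le> m t + 1"
    "AE t in lebesgue_on T. \<forall>k. u t \<in> closure (convex hull ((\<lambda>j. V j (Y j) t) ` {k..}))"
    "\<And>t. t \<in> T \<Longrightarrow> (\<integral>\<tau>\<in>{t0..t}. u \<tau> \<partial>lebesgue_on T) = x (Sup {t0..t}) - x0 - integral {t0..t} (W y)"
    by blast
  have m1: "integrable (lebesgue_on T) (\<lambda>t. m t + 1)"
    by (rule JT) (intro Bochner_Integration.integrable_add m(1) integrable_J_const)
  have u_int: "integrable (lebesgue_on T) u"
    by (rule Bochner_Integration.integrable_bound[OF m1 u(1)]) (use u(2) m(2) in \<open>auto elim!: eventually_mono\<close>)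
  define g where "g t = u t + W y t" for t
  have g_int: "integrable (lebesgue_on T) g"
    unfolding g_def by (intro Bochner_Integration.integrable_add u_int JT W_integrable y_cont)
  have x_eq: "x t = x0 + integral {t0..t} g" if t: "t \<in> T" for t
  proof -
    have st: "{t0..t} \<subseteq> T" using t by (auto simp: T_def)
    have I: "h integrable_on {t0..t}" if "integrable (lebesgue_on T) h" for h :: "real \<Rightarrow> real^'n"
      by (rule integrable_on_subinterval[OF integrable_on_lebesgue_on[OF that Tl] st])
    have "integral {t0..t} g = integral {t0..t} u + integral {t0..t} (W y)"
      unfolding g_def
      by (rule Henstock_Kurzweil_Integration.integral_add[OF I[OF u_int] I[OF JT[OF W_integrable[OF y_cont]]]])
    moreover have "integral {t0..t} u = x t - x0 - integral {t0..t} (W y)"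
      using u(4)[OF t] set_int[OF u_int t] t by (simp add: T_def)
    ultimately show ?thesis by simp
  qed
  have g_on: "g integrable_on {t0..t0 + a}"
    using integrable_on_lebesgue_on[OF g_int Tl] by (simp add: T_def)
  have ac: "abs_cont t0 (t0 + a) x"
  proof (rule abs_cont_if_integral_bound)
    let ?p = "\<lambda>t. norm (g t)"
    show "?p integrable_on {t0..t0 + a}"
      using integrable_on_lebesgue_on[OF integrable_norm[OF g_int] Tl] by (simp add: T_def)
    fix r s assume rs: "t0 \<le> r" "r \<le> s" "s \<le> t0 + a"
    then have "x s - x r = integral {r..s} g"
      using integral_diff_interval[OF g_on rs] by (simp add: x_eq T_def)
    also have "norm \<dots> \<le> integral {r..s} ?p"
      using norm_integral_le_AE[of t0 "t0 + a" g ?p r s] g_int rs by (simp add: T_def)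
    finally show "norm (x s - x r) \<le> integral {r..s} ?p" .
  qed simp
  obtain N where N: "negligible N"
    "\<And>t. t \<in> {t0..t0 + a} - N \<Longrightarrow> ((\<lambda>s. integral {t0..s} g) has_vector_derivative g t) (at t within {t0..t0 + a})"
    using indefinite_integral_has_vector_derivative_AE[OF g_on] by blast
  have deriv: "AE t in lebesgue_on T. (x has_vector_derivative g t) (at t within T)"
  proof -
    have "AE t in lebesgue. t \<notin> N" using N(1) by (simp add: negligible_iff_null_sets AE_not_in)
    then have "AE t in lebesgue. t \<in> T \<longrightarrow> (x has_vector_derivative g t) (at t within T)"
    proof eventually_elim
      case (elim t)
      show ?case
      proof
        assume t: "t \<in> T"
        with elim have "((\<lambda>s. x0 + integral {t0..s} g) has_vector_derivative 0 + g t) (at t within T)"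
          unfolding T_def by (intro has_vector_derivative_add has_vector_derivative_const N(2)) auto
        then have "((\<lambda>s. x0 + integral {t0..s} g) has_vector_derivative g t) (at t within T)" by simp
        then show "(x has_vector_derivative g t) (at t within T)"
          by (rule has_vector_derivative_transform[OF t, rotated]) (simp add: x_eq)
      qed
    qed
    then show ?thesis by (simp add: AE_lebesgue_on_iff[OF Tl])
  qed
  have u_reg: "AE t in lebesgue_on T. u t \<in> Filippov_reg f t (x t)"
  proof -
    have "AE t in lebesgue_on T. t \<in> T" by (rule AE_I2) simp
    with u(3) AET[OF AE_regular_time] show ?thesis
    proof eventually_elim
      case (elim t)
      show ?case
        unfolding Filippov_reg_def
      proof (intro INT_I)
        fix \<delta> and M :: "(real^'n) set" assume "\<delta> \<in> {0::real<..}" and M: "M \<in> null_sets lebesgue"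
        then have "\<delta> / 3 > 0" by simp
        from approx[OF this] obtain k where k: "\<And>j. j \<ge> k \<Longrightarrow> step j \<le> \<delta> / 3"
          "\<And>j. j \<ge> k \<Longrightarrow> norm (Y j t - x t) \<le> \<delta> / 3" using elim(3) by blast
        let ?C = "closure (convex hull ((\<lambda>y. f (t, y)) ` (ball (x t) \<delta> - M)))"
        have "V j (Y j) t \<in> ?C" if "j \<ge> k" for j
        proof -
          have Yin: "Y j t \<in> cball x0 1"
            unfolding Y_def by (rule a(3)) (use elim(3) step_pos[of j] in \<open>auto simp: T_def\<close>)
          have "ball (Y j t) (step j) \<subseteq> ball (x t) \<delta>"
          proof
            fix p assume "p \<in> ball (Y j t) (step j)"
            then show "p \<in> ball (x t) \<delta>"
              using k[OF that] \<open>\<delta> / 3 > 0\<close> dist_triangle[of "x t" p "Y j t"] dist_commute[of "x t" "Y j t"]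
              by (simp add: dist_norm)
          qed
          then have "closure (convex hull ((\<lambda>y. f (t, y)) ` (ball (Y j t) (step j) - M))) \<subseteq> ?C"
            by (intro closure_mono hull_mono image_mono Diff_mono) auto
          moreover have "V j (Y j) t \<in> closure (convex hull ((\<lambda>y. f (t, y)) ` (ball (Y j t) (step j) - M)))"
            using regular_timeD(3)[OF elim(2) M, of j "Y j"] proj_id[OF Yin] by simp
          ultimately show ?thesis by (rule subsetD)
        qed
        then have "(\<lambda>j. V j (Y j) t) ` {k..} \<subseteq> ?C" by auto
        with elim(1) show "u t \<in> ?C"
          using closure_convex_hull_induct[of "u t" "(\<lambda>j. V j (Y j) t) ` {k..}" ?C]
          by (simp add: convex_closure)
      qed
    qed
  qed
  have reg': "Filippov_reg f' \<tau> z = {f' (\<tau>, z)}" for \<tau> z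
    by (rule Filippov_reg_continuous) (rule f'_cont)
  have w_reg: "AE t in lebesgue_on T. W y t \<in>
      Aumann_integral {t0..t} (\<lambda>\<tau>. (\<lambda>z. \<Phi> (t, \<tau>) *v z) ` Filippov_reg f' \<tau> (x \<tau>))"
  proof -
    have "AE t in lebesgue. t \<in> T \<longrightarrow> W y t \<in>
      Aumann_integral {t0..t} (\<lambda>\<tau>. (\<lambda>z. \<Phi> (t, \<tau>) *v z) ` Filippov_reg f' \<tau> (x \<tau>))"
      using \<Phi>\<Psi>
    proof eventually_elim
      case (elim t)
      show ?case
      proof
        assume t: "t \<in> T"
        then have t1: "t \<le> t0 + 1" using sub by auto
        have "AE \<tau> in lebesgue_on {t0..t}. \<Psi> (t, \<tau>) *v Q y \<tau> \<in> (\<lambda>z. \<Phi> (t, \<tau>) *v z) ` Filippov_reg f' \<tau> (x \<tau>)"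
        proof -
          have "AE \<tau> in lebesgue. \<tau> \<in> {t0..t} \<longrightarrow>
              \<Psi> (t, \<tau>) *v Q y \<tau> \<in> (\<lambda>z. \<Phi> (t, \<tau>) *v z) ` Filippov_reg f' \<tau> (x \<tau>)"
            using elim
          proof eventually_elim
            case (elim \<tau>)
            show ?case
            proof
              assume \<tau>: "\<tau> \<in> {t0..t}"
              then have "\<tau> \<in> T" using t by (auto simp: T_def)
              then have "Q y \<tau> = f' (\<tau>, x \<tau>)" by (simp add: Q_def y_eq(2))
              moreover have "\<Phi> (t, \<tau>) = \<Psi> (t, \<tau>)" using elim \<tau> t1 by simp
              ultimately show "\<Psi> (t, \<tau>) *v Q y \<tau> \<in> (\<lambda>z. \<Phi> (t, \<tau>) *v z) ` Filippov_reg f' \<tau> (x \<tau>)"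
                by (simp add: reg')
            qed
          qed
          then show ?thesis by (simp add: AE_lebesgue_on_iff)
        qed
        moreover have "integrable (lebesgue_on {t0..t}) (\<lambda>\<tau>. \<Psi> (t, \<tau>) *v Q y \<tau>)"
          by (rule memory_integrable[OF \<Psi> Q_integrable[OF y_cont] t1])
        ultimately show "W y t \<in> Aumann_integral {t0..t} (\<lambda>\<tau>. (\<lambda>z. \<Phi> (t, \<tau>) *v z) ` Filippov_reg f' \<tau> (x \<tau>))"
          unfolding Aumann_integral_def W_def memory_def by blast
      qed
    qed
    then show ?thesis by (simp add: AE_lebesgue_on_iff[OF Tl])
  qed
  have "Filippov_solution \<Phi> f f' t0 x0 {t0..<t0 + a} x"
    unfolding Filippov_solution_iff
  proof (intro conjI)
    show "(\<exists>\<alpha>>0. {t0..<t0 + a} = {t0..<t0 + \<alpha>}) \<or> {t0..<t0 + a} = {t0..}" using a(1) by blast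
    show "abs_continuous_on {t0..<t0 + a} x"
      unfolding abs_continuous_on_def abs_continuous_on_interval_iff
    proof (intro allI impI)
      fix p q assume "p \<le> q \<and> {p..q} \<subseteq> {t0..<t0 + a}"
      then have "p \<in> {t0..<t0 + a}" "q \<in> {t0..<t0 + a}" by auto
      then show "abs_cont p q x" by (intro abs_cont_subinterval[OF ac]) auto
    qed
    show "x t0 = x0" by (rule x_t0)
    have IT: "{t0..<t0 + a} \<subseteq> T" by (auto simp: T_def)
    have "AE t in lebesgue_on T. \<exists>d\<in>admissible_velocities \<Phi> f f' t0 x t.
        (x has_vector_derivative d) (at t within {t0..<t0 + a})"
      using u_reg w_reg deriv
    proof eventually_elim
      case (elim t)
      have "(x has_vector_derivative (u t + W y t)) (at t within {t0..<t0 + a})"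
        using elim(3) IT unfolding g_def by (rule has_vector_derivative_within_subset)
      with elim(1,2) show ?case unfolding admissible_velocities_def by blast
    qed
    then show "AE t in lebesgue_on {t0..<t0 + a}. \<exists>d\<in>admissible_velocities \<Phi> f f' t0 x t.
        (x has_vector_derivative d) (at t within {t0..<t0 + a})"
      by (rule AE_lebesgue_on_subset[OF _ IT Tl]) simp
  qed
  with a(1) show ?thesis by blast
qed

end

text \<open>The normalization of the hypotheses; \<open>f'\<close> is in particular one-sided Lipschitz, so its bound at every point is obtained as for \<open>f\<close>.\<close>

lemma Filippov_solution_exists:
  fixes \<Phi> :: "real \<times> real \<Rightarrow> real^'n^'n" and f f' :: "real \<times> (real^'n) \<Rightarrow> real^'n"
  assumes \<Delta>: "\<Delta> = {(t, \<tau>). t \<ge> \<tau>}"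
    and \<Phi>: "\<Phi> \<in> borel_measurable (lebesgue_on \<Delta>)" "locally_ess_bounded_on \<Delta> \<Phi>"
    and F: "Filippov_condition f" "locally_one_sided_Lipschitz f"
    and F': "Filippov_condition f'" "locally_Lipschitz f'"
  shows "\<exists>a>0. \<exists>x. Filippov_solution \<Phi> f f' t0 x0 {t0..<t0 + a} x"
proof -
  define r where "r = norm x0 + 2"
  have "r > 0" by (simp add: r_def add_nonneg_pos)
  have sub: "cball x0 2 \<subseteq> cball 0 r" "cball x0 1 \<subseteq> cball 0 r"
    unfolding r_def subset_iff by (auto simp: dist_norm norm_minus_commute intro: order_trans[OF norm_triangle_sub[of _ x0]])
  obtain L where L: "L \<ge> 0"
    "AE t in lebesgue_on {t0..t0 + 1}. one_sided_Lipschitz_on L (cball x0 2) (\<lambda>y. f (t, y))"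
    using locally_one_sided_Lipschitz_AE[OF F(2) compact_cball] by blast
  obtain m where m: "integrable (lebesgue_on {t0..t0 + 1}) m" "\<And>t. 0 \<le> m t"
    "AE t in lebesgue_on {t0..t0 + 1}. \<forall>y\<in>cball 0 r. norm (f (t, y)) \<le> m t"
    using Filippov_one_sided_bound[OF F \<open>r > 0\<close>] by blast
  obtain m' where m': "integrable (lebesgue_on {t0..t0 + 1}) m'" "\<And>t. 0 \<le> m' t"
    "AE t in lebesgue_on {t0..t0 + 1}. \<forall>y\<in>cball 0 r. norm (f' (t, y)) \<le> m' t"
    using Filippov_one_sided_bound[OF F'(1) locally_Lipschitz_imp_one_sided[OF F'(2)] \<open>r > 0\<close>] by blast
  obtain K where K: "K \<ge> 0" "AE t in lebesgue_on {t0..t0 + 1}.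
      \<forall>y\<in>cball x0 1. \<forall>z\<in>cball x0 1. norm (f' (t, y) - f' (t, z)) \<le> K * norm (y - z)"
    using locally_Lipschitz_AE[OF F'(2) compact_cball] by blast
  have "f \<in> borel_measurable lebesgue" and f'_meas: "f' \<in> borel_measurable lebesgue"
    using F(1) F'(1) by (simp_all add: Filippov_condition_def)
  then obtain fB where fB: "fB \<in> borel_measurable borel" "AE z in lborel. f z = fB z"
    using lebesgue_measurable_ex_borel by metis
  obtain \<Psi> c where \<Psi>: "\<Psi> \<in> borel_measurable borel" "\<And>z. norm (\<Psi> z) \<le> c" "c \<ge> 0"
    "AE t in lebesgue. AE \<tau> in lebesgue. t0 \<le> \<tau> \<and> \<tau> \<le> t \<and> t \<le> t0 + 1 \<longrightarrow> \<Phi> (t, \<tau>) = \<Psi> (t, \<tau>)"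
    by (rule kernel_borel_version[OF \<Delta> \<Phi>, of t0 "t0 + 1"]) blast
  interpret normalized_ivp f f' fB \<Phi> \<Psi> t0 x0 L K c m m'
  proof
    show "AE t in lebesgue_on {t0..t0 + 1}. \<forall>y\<in>cball x0 2. norm (f (t, y)) \<le> m t"
      using m(3) by eventually_elim (use sub in blast)
    show "AE t in lebesgue_on {t0..t0 + 1}. \<forall>y\<in>cball x0 1. norm (f' (t, y)) \<le> m' t"
      using m'(3) by eventually_elim (use sub in blast)
    show "AE t in lborel. AE y in lborel. f (t, y) = fB (t, y)"
      using AE_lborel_iterated[OF fB(2)] .
    show "isCont (\<lambda>y. f' (t, y)) y" for t y
      by (rule locally_Lipschitz_isCont[OF F'(2)])
  qed (fact L K \<Psi> m m' f'_meas fB)+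
  show ?thesis by (rule solution_exists)
qed

section \<open>Uniqueness\<close>

text \<open>Everything uniqueness needs about a solution, on the compact segment up to a common time \<open>T\<close>.\<close>

lemma Filippov_solution_initial_segment:
  assumes sol: "Filippov_solution \<Phi> f f' t0 x0 I x" and "T \<in> I"
  shows "{t0..T} \<subseteq> I" "t0 \<le> T" "abs_cont t0 T x" "x t0 = x0"
    "AE t in lebesgue_on {t0..T}. \<exists>d\<in>admissible_velocities \<Phi> f f' t0 x t. (x has_vector_derivative d) (at t within {t0..T})"
proof -
  have I: "(\<exists>\<alpha>>0. I = {t0..<t0 + \<alpha>}) \<or> I = {t0..}"
    using sol by (simp add: Filippov_solution_iff)
  then show sub: "{t0..T} \<subseteq> I" and le: "t0 \<le> T" using \<open>T \<in> I\<close> by auto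
  have Il: "I \<in> sets lebesgue" using I by auto
  have "abs_continuous_on I x" using sol by (simp add: Filippov_solution_iff)
  then show "abs_cont t0 T x"
    unfolding abs_continuous_on_def abs_continuous_on_interval_iff using sub le by blast
  show "x t0 = x0" using sol by (simp add: Filippov_solution_iff)
  have "AE t in lebesgue_on I. \<exists>d\<in>admissible_velocities \<Phi> f f' t0 x t. (x has_vector_derivative d) (at t within I)"
    using sol by (simp add: Filippov_solution_iff)
  then have "AE t in lebesgue_on {t0..T}. \<exists>d\<in>admissible_velocities \<Phi> f f' t0 x t. (x has_vector_derivative d) (at t within I)"
    by (rule AE_lebesgue_on_subset[OF _ sub Il]) simp
  then show "AE t in lebesgue_on {t0..T}. \<exists>d\<in>admissible_velocities \<Phi> f f' t0 x t. (x has_vector_derivative d) (at t within {t0..T})"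
    by eventually_elim (use has_vector_derivative_within_subset[OF _ sub] in blast)
qed

lemma Aumann_integral_singletonE:
  fixes \<Phi> :: "real \<times> real \<Rightarrow> real^'n^'n"
  assumes "w \<in> Aumann_integral {t0..t} (\<lambda>\<tau>. (\<lambda>z. \<Phi> (t, \<tau>) *v z) ` {h \<tau>})"
  obtains s where "integrable (lebesgue_on {t0..t}) s" "AE \<tau> in lebesgue_on {t0..t}. s \<tau> = \<Phi> (t, \<tau>) *v h \<tau>"
    "w = integral\<^sup>L (lebesgue_on {t0..t}) s"
  using assms unfolding Aumann_integral_def by auto

text \<open>On \<open>[t0, T]\<close> both curves stay in a ball on which the Lipschitz data are uniform in time up to a null set. The
Gronwall inequality without defect then applies to their difference.\<close>

lemma Filippov_solution_unique:
  fixes \<Phi> :: "real \<times> real \<Rightarrow> real^'n^'n" and f f' :: "real \<times> (real^'n) \<Rightarrow> real^'n"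
  assumes \<Delta>: "\<Delta> = {(t, \<tau>). t \<ge> \<tau>}"
    and \<Phi>: "\<Phi> \<in> borel_measurable (lebesgue_on \<Delta>)" "locally_ess_bounded_on \<Delta> \<Phi>"
    and F: "Filippov_condition f" "locally_one_sided_Lipschitz f" and F': "locally_Lipschitz f'"
    and x: "Filippov_solution \<Phi> f f' t0 x0 I x" "T \<in> I"
    and y: "Filippov_solution \<Phi> f f' t0 x0 J y" "T \<in> J"
  shows "x T = y T"
proof -
  note X = Filippov_solution_initial_segment[OF x] and Y = Filippov_solution_initial_segment[OF y]
  have "bounded (x ` {t0..T} \<union> y ` {t0..T})"
    using abs_cont_imp_continuous_on[OF X(3)] abs_cont_imp_continuous_on[OF Y(3)]
    by (simp add: compact_imp_bounded compact_continuous_image)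
  then obtain B where "B > 0" and B: "\<forall>z\<in>x ` {t0..T} \<union> y ` {t0..T}. norm z \<le> B"
    using bounded_pos by metis
  define r where "r = B + 1"
  have "r > 0" using \<open>B > 0\<close> by (simp add: r_def)
  have in_ball: "x t \<in> ball 0 r" "y t \<in> ball 0 r" if "t \<in> {t0..T}" for t
  proof -
    have "norm (x t) \<le> B" "norm (y t) \<le> B" using B that by blast+
    then show "x t \<in> ball 0 r" "y t \<in> ball 0 r" by (simp_all add: r_def)
  qed
  obtain L where L: "L \<ge> 0" "AE t in lebesgue_on {t0..T}. one_sided_Lipschitz_on L (cball 0 r) (\<lambda>y. f (t, y))"
    using locally_one_sided_Lipschitz_AE[OF F(2) compact_cball] by blast
  obtain m where m: "integrable (lebesgue_on {t0..T}) m" "\<And>t. 0 \<le> m t"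
    "AE t in lebesgue_on {t0..T}. \<forall>y\<in>cball 0 r. norm (f (t, y)) \<le> m t"
    using Filippov_one_sided_bound[OF F \<open>r > 0\<close>] by blast
  obtain K where K: "K \<ge> 0"
    "AE t in lebesgue_on {t0..T}. \<forall>x\<in>cball 0 r. \<forall>y\<in>cball 0 r. norm (f' (t, x) - f' (t, y)) \<le> K * norm (x - y)"
    using locally_Lipschitz_AE[OF F' compact_cball] by blast
  obtain \<Psi> c where "\<Psi> \<in> borel_measurable borel" and \<Psi>: "\<And>z. norm (\<Psi> z) \<le> c" "c \<ge> 0"
    "AE t in lebesgue. AE \<tau> in lebesgue. t0 \<le> \<tau> \<and> \<tau> \<le> t \<and> t \<le> T \<longrightarrow> \<Phi> (t, \<tau>) = \<Psi> (t, \<tau>)"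
    by (rule kernel_borel_version[OF \<Delta> \<Phi>, of t0 T]) blast
  have reg': "Filippov_reg f' \<tau> z = {f' (\<tau>, z)}" for \<tau> z
    by (rule Filippov_reg_continuous) (rule locally_Lipschitz_isCont[OF F'])
  define C where "C = L + c * K * (T - t0) + 1"
  have C: "C > 0" unfolding C_def using L(1) K(1) \<Psi>(2) X(2) by (intro add_nonneg_pos add_nonneg_nonneg mult_nonneg_nonneg) auto
  have \<Psi>T: "AE t in lebesgue_on {t0..T}. AE \<tau> in lebesgue. t0 \<le> \<tau> \<and> \<tau> \<le> t \<longrightarrow> \<Phi> (t, \<tau>) = \<Psi> (t, \<tau>)"
    by (subst AE_lebesgue_on_iff) (use \<Psi>(3) in \<open>auto elim!: eventually_mono\<close>)
  \<comment> \<open>The summand \<open>0 * 0\<close> is the defect term of the Gronwall inequality.\<close>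
  have "AE t in lebesgue_on {t0..T}. t \<in> {t0..T}" by (rule AE_I2) simp
  then have "AE t in lebesgue_on {t0..T}. \<exists>d. ((\<lambda>t. x t - y t) has_vector_derivative d) (at t within {t0..T}) \<and>
       (\<forall>R. (\<forall>s\<in>{t0..t}. norm (x s - y s) \<le> R) \<longrightarrow> (x t - y t) \<bullet> d \<le> C * R\<^sup>2 + 0 * 0)"
    using X(5) Y(5) L(2) m(3) \<Psi>T
  proof eventually_elim
    case (elim t)
    from elim(2) obtain v w where vw: "v \<in> Filippov_reg f t (x t)"
        "w \<in> Aumann_integral {t0..t} (\<lambda>\<tau>. (\<lambda>z. \<Phi> (t, \<tau>) *v z) ` {f' (\<tau>, x \<tau>)})"
        "(x has_vector_derivative (v + w)) (at t within {t0..T})" unfolding reg' admissible_velocities_def by blast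
    from elim(3) obtain v' w' where vw': "v' \<in> Filippov_reg f t (y t)"
        "w' \<in> Aumann_integral {t0..t} (\<lambda>\<tau>. (\<lambda>z. \<Phi> (t, \<tau>) *v z) ` {f' (\<tau>, y \<tau>)})"
        "(y has_vector_derivative (v' + w')) (at t within {t0..T})" unfolding reg' admissible_velocities_def by blast
    obtain s where s: "integrable (lebesgue_on {t0..t}) s" "AE \<tau> in lebesgue_on {t0..t}. s \<tau> = \<Phi> (t, \<tau>) *v f' (\<tau>, x \<tau>)"
      "w = integral\<^sup>L (lebesgue_on {t0..t}) s" using Aumann_integral_singletonE[OF vw(2)] .
    obtain s' where s': "integrable (lebesgue_on {t0..t}) s'" "AE \<tau> in lebesgue_on {t0..t}. s' \<tau> = \<Phi> (t, \<tau>) *v f' (\<tau>, y \<tau>)"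
      "w' = integral\<^sup>L (lebesgue_on {t0..t}) s'" using Aumann_integral_singletonE[OF vw'(2)] .
    have "(x t - y t) \<bullet> ((v + w) - (v' + w')) \<le> C * R\<^sup>2 + 0 * 0"
      if R: "\<forall>s\<in>{t0..t}. norm (x s - y s) \<le> R" for R
    proof -
      have tR: "norm (x t - y t) \<le> R" using R elim(1) by auto
      then have "R \<ge> 0" using norm_ge_zero order_trans by blast
      have "(x t - y t) \<bullet> (v - v') \<le> L * (norm (x t - y t))\<^sup>2"
        by (rule Filippov_reg_one_sided_Lipschitz[OF elim(4) L(1) _ in_ball(1)[OF elim(1)] in_ball(2)[OF elim(1)] vw(1) vw'(1)])
           (use elim(5) in blast)
      also have "\<dots> \<le> L * R\<^sup>2" by (intro mult_left_mono power_mono tR L(1) norm_ge_zero)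
      finally have 1: "(x t - y t) \<bullet> (v - v') \<le> L * R\<^sup>2" .
      have "norm (w - w') \<le> c * K * (T - t0) * R"
      proof -
        have st: "{t0..t} \<subseteq> {t0..T}" using elim(1) by auto
        have K': "AE \<tau> in lebesgue_on {t0..t}. \<forall>x\<in>cball 0 r. \<forall>y\<in>cball 0 r. norm (f' (\<tau>, x) - f' (\<tau>, y)) \<le> K * norm (x - y)"
          by (rule AE_lebesgue_on_subset[OF K(2) st]) auto
        have \<Psi>': "AE \<tau> in lebesgue_on {t0..t}. \<Phi> (t, \<tau>) = \<Psi> (t, \<tau>)"
          by (subst AE_lebesgue_on_iff) (use elim(6) in \<open>auto elim!: eventually_mono\<close>)
        have "AE \<tau> in lebesgue_on {t0..t}. \<tau> \<in> {t0..t}" by (rule AE_I2) simp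
        then have bd: "AE \<tau> in lebesgue_on {t0..t}. norm (s \<tau> - s' \<tau>) \<le> c * (K * R)"
          using s(2) s'(2) K' \<Psi>'
        proof eventually_elim
          case (elim \<tau>)
          have \<tau>: "\<tau> \<in> {t0..T}" using elim(1) st by blast
          have "norm (s \<tau> - s' \<tau>) = norm (\<Psi> (t, \<tau>) *v (f' (\<tau>, x \<tau>) - f' (\<tau>, y \<tau>)))"
            using elim by (simp add: matrix_vector_mult_diff_distrib)
          also have "\<dots> \<le> norm (\<Psi> (t, \<tau>)) * norm (f' (\<tau>, x \<tau>) - f' (\<tau>, y \<tau>))"
            by (rule norm_matrix_vector_mult_le)
          also have "\<dots> \<le> c * (K * R)"
          proof (rule mult_mono[OF \<Psi>(1) _ \<Psi>(2) norm_ge_zero])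
            have "norm (f' (\<tau>, x \<tau>) - f' (\<tau>, y \<tau>)) \<le> K * norm (x \<tau> - y \<tau>)"
              using elim(4) in_ball[OF \<tau>] ball_subset_cball by blast
            also have "\<dots> \<le> K * R" using R elim(1) K(1) by (intro mult_left_mono) auto
            finally show "norm (f' (\<tau>, x \<tau>) - f' (\<tau>, y \<tau>)) \<le> K * R" .
          qed
          finally show ?case .
        qed
        have "norm (w - w') = norm (integral\<^sup>L (lebesgue_on {t0..t}) (\<lambda>\<tau>. s \<tau> - s' \<tau>))"
          using s s' by simp
        also have "\<dots> \<le> integral\<^sup>L (lebesgue_on {t0..t}) (\<lambda>\<tau>. norm (s \<tau> - s' \<tau>))"
          by (rule integral_norm_bound)
        also have "\<dots> \<le> integral\<^sup>L (lebesgue_on {t0..t}) (\<lambda>_. c * (K * R))"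
          by (rule integral_mono_AE[OF _ _ bd])
             (auto intro!: integrable_norm Bochner_Integration.integrable_diff s(1) s'(1)
                finite_measure.integrable_const finite_measure_lebesgue_on)
        also have "\<dots> = (t - t0) * (c * (K * R))"
          using elim(1) by (simp add: measure_restrict_space)
        also have "\<dots> \<le> (T - t0) * (c * (K * R))"
          using elim(1) K(1) \<Psi>(2) \<open>R \<ge> 0\<close> by (intro mult_right_mono) auto
        finally show ?thesis by (simp add: mult_ac)
      qed
      then have "norm (x t - y t) * norm (w - w') \<le> R * (c * K * (T - t0) * R)"
        using tR \<open>R \<ge> 0\<close> by (intro mult_mono) auto
      with norm_cauchy_schwarz[of "x t - y t" "w - w'"]
      have 2: "(x t - y t) \<bullet> (w - w') \<le> c * K * (T - t0) * R\<^sup>2"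
        by (simp add: power2_eq_square mult_ac)
      have "(x t - y t) \<bullet> ((v + w) - (v' + w')) = (x t - y t) \<bullet> (v - v') + (x t - y t) \<bullet> (w - w')"
        by (simp add: algebra_simps)
      moreover have "C * R\<^sup>2 + 0 * 0 = L * R\<^sup>2 + c * K * (T - t0) * R\<^sup>2 + R\<^sup>2"
        by (simp add: C_def algebra_simps)
      ultimately show ?thesis using 1 2 zero_le_power2[of R] by linarith
    qed
    moreover have "((\<lambda>t. x t - y t) has_vector_derivative (v + w) - (v' + w')) (at t within {t0..T})"
      by (rule has_vector_derivative_diff[OF vw(3) vw'(3)])
    ultimately show ?case by blast
  qed
  from AE_lebesgue_on_negligibleE[OF this] obtain N where N: "negligible N" "\<And>t. t \<in> {t0..T} - N \<Longrightarrow>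
      \<exists>d. ((\<lambda>t. x t - y t) has_vector_derivative d) (at t within {t0..T}) \<and>
       (\<forall>R. (\<forall>s\<in>{t0..t}. norm (x s - y s) \<le> R) \<longrightarrow> (x t - y t) \<bullet> d \<le> C * R\<^sup>2 + 0 * 0)"
    by blast
  have "(norm (x T - y T))\<^sup>2 \<le> 4 * 0 * integral {t0..T} (\<lambda>_. 0) * exp (4 * C * (T - t0))"
  proof (rule gronwall_memory[where e = "\<lambda>t. x t - y t" and N = N])
    show "abs_cont t0 T (\<lambda>t. x t - y t)"
    proof (rule abs_cont_dominated[OF X(3) Y(3)])
      fix u v
      have eq: "(x v - y v) - (x u - y u) = (x v - x u) - (y v - y u)" by simp
      show "norm ((x v - y v) - (x u - y u)) \<le> 1 * norm (x v - x u) + norm (y v - y u)"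
        unfolding eq mult_1 by (rule norm_triangle_ineq4)
    qed simp
    show "x t0 - y t0 = 0" using X(4) Y(4) by simp
  qed (use X(2) C N in auto)
  then show ?thesis by simp
qed

section \<open>Existence and uniqueness of Filippov solutions\<close>

theorem theorem16:
  fixes \<Phi> :: "real \<times> real \<Rightarrow> real^'n^'n"
    and f f' :: "real \<times> (real^'n) \<Rightarrow> real^'n"
    and \<Delta> :: "(real \<times> real) set"
    and t0 :: real and x0 :: "real^'n"
  assumes "\<Delta> = {(t, \<tau>). t \<ge> \<tau>}"
    and "\<Phi> \<in> borel_measurable (lebesgue_on \<Delta>)"
    and "locally_ess_bounded_on \<Delta> \<Phi>"
    and "Filippov_condition f" and "Filippov_condition f'"
    and "locally_one_sided_Lipschitz f" and "locally_Lipschitz f'"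
  shows "(\<exists>I x. Filippov_solution \<Phi> f f' t0 x0 I x) \<and>
         (\<forall>I J x y. Filippov_solution \<Phi> f f' t0 x0 I x \<and> Filippov_solution \<Phi> f f' t0 x0 J y
            \<longrightarrow> (\<forall>t\<in>I \<inter> J. x t = y t))"
proof (intro conjI allI impI ballI)
  show "\<exists>I x. Filippov_solution \<Phi> f f' t0 x0 I x"
    using Filippov_solution_exists[OF assms(1-4,6,5,7)] by blast
  fix I J x y t
  assume "Filippov_solution \<Phi> f f' t0 x0 I x \<and> Filippov_solution \<Phi> f f' t0 x0 J y" "t \<in> I \<inter> J"
  then show "x t = y t"
    using Filippov_solution_unique[OF assms(1-4,6,7)] by blast
qed

end
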